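(* Let $\bar A=(A_0,A_1)$ be a compatible couple of (quasi-)Banach spaces with $A_0\cap A_1\neq\{0\}$. Let $0<q_1,r_1\le\infty$ and $a_1,b_1\in SV$ be such that $\left\|s^{-1/r_1}b_1(s)\|u^{-1/q_1}a_1(u)\|_{q_1,(s,1)}\right\|_{r_1,(0,1)}<\infty$, and put $$\chi_1(t)=\left\|s^{-1/r_1}b_1(s)\|u^{-1/q_1}a_1(u)\|_{q_1,(s,t)}\right\|_{r_1,(0,t)}.$$ Let $0<r\le\infty$ and $a\in SV$. Put $\rho(t)=\frac{t}{\chi_1(t)}$. For given $0\le\theta\le1$ denote $a^{\#}=\chi_1^{\theta}\,(a\circ\rho)$. (i) If $0<\theta<1$, then $\left(A_0,\bar A^{\mathcal R}_{1,r_1,b_1,q_1,a_1}\right)_{\theta,r,a}=\bar A_{\theta,r,a^{\#}}$. (ii) If $\|s^{-1/r}a(s)\|_{r,(1,\infty)}<\infty$, then $\left(A_0,\bar A^{\mathcal R}_{1,r_1,b_1,q_1,a_1}\right)_{0,r,a}=\bar A_{0,r,a\circ\rho}$. (iii) If $\|s^{-1/r}a(s)\|_{r,(0,1)}<\infty$, then, with $\theta=1$ (i.e. $a^{\#}=\chi_1\,(a\circ\rho)$), $$\left(A_0,\bar A^{\mathcal R}_{1,r_1,b_1,q_1,a_1}\right)_{1,r,a}=\bar A_{1,r,a^{\#}}\cap\bar A^{\mathcal R}_{1,r,B_1,q_1,a_1}\cap\bar A^{\mathcal R,\mathcal R}_{1,r,a\circ\rho,r_1,b_1,q_1,a_1},$$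 where $B_1(t)=\|s^{-1/r_1}b_1(s)\|_{r_1,(0,t)}\,a(\rho(t))$.
   Context: Conventions: $1/\infty=0$; $\|\cdot\|_{q,(a,b)}$ is the usual (quasi-)norm of $L_q$ on the interval $(a,b)$, $0<q\le\infty$. Two positive functions satisfy $f\approx g$ (are equivalent) if $C^{-1}g\le f\le Cg$ for some constant $C>0$ independent of all significant quantities. $b\in SV$ (slowly varying) means that $b$ is a positive Lebesgue measurable function on $(0,\infty)$ such that for each $\varepsilon>0$ the function $t^{\varepsilon}b(t)$ is equivalent to an increasing function and $t^{-\varepsilon}b(t)$ is equivalent to a decreasing function. For a compatible couple $(X_0,X_1)$ of (quasi-)normed spaces, $K(t,f;X_0,X_1)=\inf\{\|f_0\|_{X_0}+t\|f_1\|_{X_1}: f=f_0+f_1,\ f_i\in X_i\}$ for $f\in X_0+X_1$, $t>0$; $K(t,f):=K(t,f;A_0,A_1)$. For $0\le\theta\le1$, $0<q\le\infty$, $b\in SV$, $(X_0,X_1)_{\theta,q,b}$ is the space of all $f\in X_0+X_1$ with finite (quasi-)norm $\|u^{-\theta-1/q}b(u)K(u,f;X_0,X_1)\|_{q,(0,\infty)}$, and $\bar A_{\theta,q,b}:=(A_0,A_1)_{\theta,q,b}$. For $0<p,r,q\le\infty$ and $a,b,c\in SV$, the following are the spaces of all $f\in A_0+A_1$ with finite (quasi-)norm: - $\bar A^{\mathcal R}_{\theta,r,b,q,a}$: $\left\|t^{-1/r}b(t)\|u^{-\theta-1/q}a(u)K(u,f)\|_{q,(t,\infty)}\right\|_{r,(0,\infty)}$;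 - $\bar A^{\mathcal R,\mathcal R}_{\theta,p,c,r,b,q,a}$: $\left\|t^{-1/p}c(t)\left\|u^{-1/r}b(u)\|v^{-\theta-1/q}a(v)K(v,f)\|_{q,(u,\infty)}\right\|_{r,(t,\infty)}\right\|_{p,(0,\infty)}$. Equality of (quasi-)normed spaces means that each is continuously embedded in the other; intersections carry the maximum (equivalently, the sum) of the (quasi-)norms. Standing assumption: none of the spaces under consideration is $\{0\}$. *)

theory Defs
  imports "HOL-Analysis.Analysis"
begin

section \<open>Quasi-Banach spaces and compatible couples\<close>

text \<open>
  Hausdorff topological vector spaces over the reals. Continuity of scalar multiplication is
  phrased with product filters, as the library does for continuity of addition.
  Complex spaces are covered by restriction of scalars.
\<close>

class hausdorff_tvs = real_vector + topological_ab_group_add + t2_space +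
  assumes tendsto_scaleR_Pair:
    "LIM p (nhds c \<times>\<^sub>F nhds x). fst p *\<^sub>R snd p :> nhds (c *\<^sub>R x)"

instance real_normed_vector \<subseteq> hausdorff_tvs
proof
  fix c :: real and x :: 'a
  show "LIM p (nhds c \<times>\<^sub>F nhds x). fst p *\<^sub>R snd p :> nhds (c *\<^sub>R x)"
    by (intro tendsto_scaleR filterlim_fst filterlim_snd)
qed

text \<open>
  A quasi-normed space inside an ambient vector space is represented by its extended quasi-norm,
  which takes the value \<open>\<infinity>\<close> exactly outside the space.
\<close>

definition carrier_of :: "('v \<Rightarrow> ennreal) \<Rightarrow> 'v set" where
  "carrier_of N = {x. N x < \<infinity>}"

definition quasi_norm :: "('v::real_vector \<Rightarrow> ennreal) \<Rightarrow> bool" where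
  "quasi_norm N \<longleftrightarrow>
     (\<forall>x. N x = 0 \<longleftrightarrow> x = 0) \<and>
     (\<forall>c x. N (c *\<^sub>R x) = ennreal \<bar>c\<bar> * N x) \<and>
     (\<exists>C\<ge>1. \<forall>x y. N (x + y) \<le> ennreal C * (N x + N y))"

definition quasi_banach :: "('v::real_vector \<Rightarrow> ennreal) \<Rightarrow> bool" where
  "quasi_banach N \<longleftrightarrow> quasi_norm N \<and>
     (\<forall>X :: nat \<Rightarrow> 'v. range X \<subseteq> carrier_of N \<longrightarrow>
        (\<forall>e>0. \<exists>M. \<forall>m\<ge>M. \<forall>n\<ge>M. N (X m - X n) < e) \<longrightarrow>
        (\<exists>x\<in>carrier_of N. (\<lambda>n. N (X n - x)) \<longlonglongrightarrow> 0))"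

text \<open>By linearity, continuity of the inclusion need only be required at \<open>0\<close>.\<close>

definition embeds_in_ambient :: "('v::hausdorff_tvs \<Rightarrow> ennreal) \<Rightarrow> bool" where
  "embeds_in_ambient N \<longleftrightarrow>
     (\<forall>U. open U \<and> 0 \<in> U \<longrightarrow> (\<exists>e>0. \<forall>x. N x < e \<longrightarrow> x \<in> U))"

definition compatible_couple ::
    "('v::hausdorff_tvs \<Rightarrow> ennreal) \<Rightarrow> ('v \<Rightarrow> ennreal) \<Rightarrow> bool" where
  "compatible_couple A0 A1 \<longleftrightarrow>
     quasi_banach A0 \<and> quasi_banach A1 \<and> embeds_in_ambient A0 \<and> embeds_in_ambient A1"

definition sum_space :: "('v::real_vector \<Rightarrow> ennreal) \<Rightarrow> ('v \<Rightarrow> ennreal) \<Rightarrow> 'v set" where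
  "sum_space X0 X1 = {f0 + f1 | f0 f1. f0 \<in> carrier_of X0 \<and> f1 \<in> carrier_of X1}"

definition inter_space :: "('v \<Rightarrow> ennreal) \<Rightarrow> ('v \<Rightarrow> ennreal) \<Rightarrow> 'v \<Rightarrow> ennreal" where
  "inter_space X Y f = max (X f) (Y f)"

definition nontrivial :: "('v::real_vector \<Rightarrow> ennreal) \<Rightarrow> bool" where
  "nontrivial N \<longleftrightarrow> carrier_of N \<noteq> {0}"

definition cont_embedded :: "('v \<Rightarrow> ennreal) \<Rightarrow> ('v \<Rightarrow> ennreal) \<Rightarrow> bool" where
  "cont_embedded X Y \<longleftrightarrow> carrier_of X \<subseteq> carrier_of Y \<and>
     (\<exists>C::real. \<forall>f\<in>carrier_of X. Y f \<le> ennreal C * X f)"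

definition same_space :: "('v \<Rightarrow> ennreal) \<Rightarrow> ('v \<Rightarrow> ennreal) \<Rightarrow> bool" where
  "same_space X Y \<longleftrightarrow> cont_embedded X Y \<and> cont_embedded Y X"


section \<open>Lebesgue quasi-norms and slowly varying functions\<close>

text \<open>\<open>recip q = 1/q\<close> for \<open>0 < q \<le> \<infinity>\<close>, with \<open>1/\<infinity> = 0\<close>.\<close>

definition recip :: "ennreal \<Rightarrow> real" where
  "recip q = enn2real (inverse q)"

text \<open>Only used for exponents \<open>p > 0\<close>.\<close>

definition epowr :: "ennreal \<Rightarrow> real \<Rightarrow> ennreal" where
  "epowr x p = (if x = \<infinity> then \<infinity> else ennreal (enn2real x powr p))"

text \<open>
  The essential supremum is written with an almost-everywhere bound, not with \<open>esssup\<close>, which is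
  \<open>\<infinity>\<close> on every non-measurable function. This matters because the composition \<open>a \<circ> \<rho>\<close> below is
  equivalent to a measurable function but, for a Lebesgue measurable \<open>a\<close>, need not be Lebesgue
  measurable itself. The integral of a non-measurable function is the lower integral, so
  \<open>Lq_norm\<close> is monotone in the function for every \<open>q\<close>.
\<close>

definition Lq_norm :: "ennreal \<Rightarrow> real set \<Rightarrow> (real \<Rightarrow> ennreal) \<Rightarrow> ennreal" where
  "Lq_norm q S g =
     (if q = \<infinity> then Inf {z. AE x in lebesgue_on S. g x \<le> z}
      else epowr (\<integral>\<^sup>+ x. epowr (g x) (enn2real q) \<partial>lebesgue_on S) (recip q))"

definition equiv_pos :: "(real \<Rightarrow> real) \<Rightarrow> (real \<Rightarrow> real) \<Rightarrow> bool" where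
  "equiv_pos f g \<longleftrightarrow> (\<exists>C>0. \<forall>t>0. g t / C \<le> f t \<and> f t \<le> C * g t)"

definition SV :: "(real \<Rightarrow> real) set" where
  "SV = {b. (\<forall>t>0. b t > 0) \<and> b \<in> borel_measurable (lebesgue_on {0<..}) \<and>
     (\<forall>\<epsilon>>0.
        (\<exists>g. (\<forall>t>0. g t > 0) \<and> mono_on {0<..} g \<and>
             equiv_pos (\<lambda>t. t powr \<epsilon> * b t) g) \<and>
        (\<exists>h. (\<forall>t>0. h t > 0) \<and> antimono_on {0<..} h \<and>
             equiv_pos (\<lambda>t. t powr (- \<epsilon>) * b t) h))}"


section \<open>Interpolation spaces\<close>

definition K_fun ::
    "('v::real_vector \<Rightarrow> ennreal) \<Rightarrow> ('v \<Rightarrow> ennreal) \<Rightarrow> real \<Rightarrow> 'v \<Rightarrow> ennreal" where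
  "K_fun X0 X1 t f =
     Inf {X0 f0 + ennreal t * X1 f1 | f0 f1.
            f = f0 + f1 \<and> f0 \<in> carrier_of X0 \<and> f1 \<in> carrier_of X1}"

text \<open>The space \<open>(X0, X1)\<^bsub>\<theta>,q,b\<^esub>\<close>.\<close>

definition interp ::
    "('v::real_vector \<Rightarrow> ennreal) \<Rightarrow> ('v \<Rightarrow> ennreal) \<Rightarrow> real \<Rightarrow> ennreal \<Rightarrow> (real \<Rightarrow> real)
      \<Rightarrow> 'v \<Rightarrow> ennreal" where
  "interp X0 X1 \<theta> q b f =
     (if f \<in> sum_space X0 X1
      then Lq_norm q {0<..}
             (\<lambda>u. ennreal (u powr (- \<theta> - recip q) * b u) * K_fun X0 X1 u f)
      else \<infinity>)"

definition interp_R ::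
    "('v::real_vector \<Rightarrow> ennreal) \<Rightarrow> ('v \<Rightarrow> ennreal) \<Rightarrow> real
      \<Rightarrow> ennreal \<Rightarrow> (real \<Rightarrow> real) \<Rightarrow> ennreal \<Rightarrow> (real \<Rightarrow> real) \<Rightarrow> 'v \<Rightarrow> ennreal" where
  "interp_R A0 A1 \<theta> r b q a f =
     (if f \<in> sum_space A0 A1
      then Lq_norm r {0<..} (\<lambda>t. ennreal (t powr (- recip r) * b t) *
             Lq_norm q {t<..}
               (\<lambda>u. ennreal (u powr (- \<theta> - recip q) * a u) * K_fun A0 A1 u f))
      else \<infinity>)"

definition interp_RR ::
    "('v::real_vector \<Rightarrow> ennreal) \<Rightarrow> ('v \<Rightarrow> ennreal) \<Rightarrow> real \<Rightarrow> ennreal \<Rightarrow> (real \<Rightarrow> real)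
      \<Rightarrow> ennreal \<Rightarrow> (real \<Rightarrow> real) \<Rightarrow> ennreal \<Rightarrow> (real \<Rightarrow> real) \<Rightarrow> 'v \<Rightarrow> ennreal" where
  "interp_RR A0 A1 \<theta> p c r b q a f =
     (if f \<in> sum_space A0 A1
      then Lq_norm p {0<..} (\<lambda>t. ennreal (t powr (- recip p) * c t) *
             Lq_norm r {t<..} (\<lambda>u. ennreal (u powr (- recip r) * b u) *
               Lq_norm q {u<..}
                 (\<lambda>v. ennreal (v powr (- \<theta> - recip q) * a v) * K_fun A0 A1 v f)))
      else \<infinity>)"


section \<open>The auxiliary functions\<close>

definition chi :: "ennreal \<Rightarrow> (real \<Rightarrow> real) \<Rightarrow> ennreal \<Rightarrow> (real \<Rightarrow> real) \<Rightarrow> real \<Rightarrow> ennreal" where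
  "chi r1 b1 q1 a1 t =
     Lq_norm r1 {0<..<t} (\<lambda>s. ennreal (s powr (- recip r1) * b1 s) *
       Lq_norm q1 {s<..<t} (\<lambda>u. ennreal (u powr (- recip q1) * a1 u)))"

text \<open>
  The weights below are real-valued: under the standing condition \<open>chi r1 b1 q1 a1 1 < \<infinity>\<close>, slow
  variation makes \<open>chi r1 b1 q1 a1 t\<close> and the norm in \<open>B_weight\<close> finite for every \<open>t > 0\<close>, so that
  \<open>enn2real\<close> loses nothing.
\<close>

definition rho :: "ennreal \<Rightarrow> (real \<Rightarrow> real) \<Rightarrow> ennreal \<Rightarrow> (real \<Rightarrow> real) \<Rightarrow> real \<Rightarrow> real" where
  "rho r1 b1 q1 a1 t = t / enn2real (chi r1 b1 q1 a1 t)"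

definition a_sharp ::
    "ennreal \<Rightarrow> (real \<Rightarrow> real) \<Rightarrow> ennreal \<Rightarrow> (real \<Rightarrow> real) \<Rightarrow> (real \<Rightarrow> real) \<Rightarrow> real \<Rightarrow> real \<Rightarrow> real"
  where
  "a_sharp r1 b1 q1 a1 a \<theta> t =
     enn2real (chi r1 b1 q1 a1 t) powr \<theta> * a (rho r1 b1 q1 a1 t)"

definition B_weight ::
    "ennreal \<Rightarrow> (real \<Rightarrow> real) \<Rightarrow> ennreal \<Rightarrow> (real \<Rightarrow> real) \<Rightarrow> (real \<Rightarrow> real) \<Rightarrow> real \<Rightarrow> real" where
  "B_weight r1 b1 q1 a1 a t =
     enn2real (Lq_norm r1 {0<..<t} (\<lambda>s. ennreal (s powr (- recip r1) * b1 s))) *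
     a (rho r1 b1 q1 a1 t)"

end

theory Submission
  imports Defs
begin

text \<open>
  Fix \<open>f\<close> and write \<open>K(t) = K(t, f; A0, A1)\<close>, \<open>Y\<close> for the limiting space with the parameters
  \<open>q1, r1, a1, b1\<close>, and \<open>\<chi>\<close> for \<open>\<chi>1\<close>. Let \<open>I(t)\<close> be the inner norm over \<open>(t, \<infinity>)\<close> in the
  definition of \<open>Y\<close>, let \<open>J(t)\<close> be the outer norm of \<open>I\<close> over \<open>(t, \<infinity>)\<close>, and let
  \<open>B(t)\<close> be the norm of \<open>b1\<close> over \<open>(0, t)\<close>. The theorem rests on a Holmstedt formula,
  \<open>K(\<rho>(t), f; A0, Y) \<approx> K(t) + \<rho>(t) (B(t) I(t) + J(t))\<close>
  (lemmas \<open>holmstedt_upper\<close> and \<open>holmstedt_lower\<close>).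

  For the upper bound, decompose \<open>f = f0 + f1\<close>. Below \<open>t\<close> the function \<open>K(u, f1)\<close> is at most
  \<open>u \<parallel>f1\<parallel>\<close>, which contributes \<open>\<chi>(t) \<parallel>f1\<parallel>\<close> to the norm of \<open>f1\<close> in \<open>Y\<close>; this is why the
  natural parameter is \<open>\<rho>(t) = t / \<chi>(t)\<close>. Above \<open>t\<close> it is at most a multiple of
  \<open>\<parallel>f0\<parallel> + K(u)\<close>. For the lower bound, \<open>K(u, g) / u\<close> decreases, so that
  \<open>\<chi>(t) K(t, g) / t \<le> \<parallel>g\<parallel>\<close> in \<open>Y\<close>. In both bounds the constant \<open>\<parallel>f0\<parallel>\<close> is harmless in the tails,
  because slow variation bounds the tail expression of the constant function \<open>1\<close> by a multiple of
  \<open>1 / \<rho>(t)\<close> (lemma \<open>tail_part_const\<close>).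

  Slow variation of the increasing function \<open>\<chi>\<close> (lemma \<open>chi_growth\<close>) makes \<open>u = \<rho>(t)\<close> an admissible
  substitution in norms with respect to \<open>du / u\<close> (lemma \<open>haar_norm_change_of_variables\<close>). It turns
  the quasi-norm of \<open>(A0, Y)\<close> with parameters \<open>\<theta>, r, a\<close> into the norm of \<open>\<rho>\<^sup>-\<^sup>\<theta> (a \<circ> \<rho>)\<close> times the
  Holmstedt expression. For \<open>\<theta> = 1\<close> the three summands give the three spaces of the intersection.
  For \<open>\<theta> < 1\<close> the weight \<open>\<rho>\<^sup>1\<^sup>-\<^sup>\<theta> (a \<circ> \<rho>)\<close> grows at least like a power of \<open>t\<close>, and a Hardy
  inequality (lemma \<open>tail_part_hardy\<close>) absorbs the two tails into the first summand; this covers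
  \<open>\<theta> = 0\<close> as well.

  The exponents may be less than one and \<open>a \<circ> \<rho>\<close> may fail to be measurable. The estimates
  therefore concern functions that are almost constant on dyadic intervals (\<open>tempered\<close>): they are
  equivalent to Borel step functions, and the substitution and the Hardy inequality become instances
  of a Schur test. Constants are extended reals \<open>C < \<infinity>\<close> chosen before \<open>f\<close>. Since \<open>K = \<infinity>\<close>
  outside \<open>A0 + A1\<close>, all inequalities hold for every \<open>f\<close> of the ambient space.
\<close>

section \<open>Norms with respect to the measure du/u\<close>

lemma epowr_mono: "0 \<le> p \<Longrightarrow> x \<le> y \<Longrightarrow> epowr x p \<le> epowr y p"
  by (cases x; cases y) (auto simp: epowr_def ennreal_leI powr_mono2 top_unique)

lemma epowr_mult: "0 < p \<Longrightarrow> epowr (x * y) p = epowr x p * epowr y p"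
  by (cases x; cases y; cases "x = 0"; cases "y = 0")
     (auto simp: epowr_def ennreal_mult_top ennreal_top_mult powr_mult
        simp flip: ennreal_mult)

lemma epowr_epowr: "0 < p \<Longrightarrow> 0 < q \<Longrightarrow> epowr (epowr x p) q = epowr x (p * q)"
  by (cases x) (auto simp: epowr_def powr_powr)

lemma epowr_one: "epowr x 1 = x"
  by (cases x) (auto simp: epowr_def)

lemma epowr_zero: "epowr 0 p = 0"
  by (auto simp: epowr_def)

lemma epowr_base_one: "epowr 1 p = 1"
  by (auto simp: epowr_def)

lemma epowr_less_top: "x < \<infinity> \<Longrightarrow> epowr x p < \<infinity>"
  by (auto simp: epowr_def)

lemma epowr_ennreal: "0 \<le> x \<Longrightarrow> epowr (ennreal x) p = ennreal (x powr p)"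
  by (auto simp: epowr_def)

text \<open>
  The sum is at most twice the maximum. Unlike convexity, this serves all exponents \<open>p > 0\<close>.
\<close>

lemma epowr_add_le:
  assumes "0 < p"
  shows "epowr (x + y) p \<le> ennreal (2 powr p) * (epowr x p + epowr y p)"
proof -
  have "x + y \<le> 2 * max x y"
    by (metis add_mono max.cobounded1 max.cobounded2 mult_2)
  then have "epowr (x + y) p \<le> epowr (2 * max x y) p"
    using assms by (intro epowr_mono) auto
  also have "\<dots> = ennreal (2 powr p) * epowr (max x y) p"
    using epowr_ennreal[of 2 p] by (simp add: epowr_mult[OF assms])
  also have "\<dots> \<le> ennreal (2 powr p) * (epowr x p + epowr y p)"
    by (intro mult_left_mono) (auto simp: max_def)
  finally show ?thesis .
qed

lemma measurable_epowr [measurable]: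
  assumes [measurable]: "h \<in> borel_measurable M"
  shows "(\<lambda>x. epowr (h x) p) \<in> borel_measurable M"
  unfolding epowr_def infinity_ennreal_def by measurable

definition haar_integral :: "(real \<Rightarrow> ennreal) \<Rightarrow> ennreal" where
  "haar_integral h = (\<integral>\<^sup>+ u. ennreal (1 / u) * h u \<partial>lebesgue_on {0<..})"

text \<open>
  The factor \<open>u powr (- 1 / q)\<close> turns Lebesgue measure into the dilation-invariant measure \<open>du / u\<close>;
  for \<open>q = \<infinity>\<close> the norm is an essential supremum.
\<close>

definition haar_norm :: "ennreal \<Rightarrow> (real \<Rightarrow> ennreal) \<Rightarrow> ennreal" where
  "haar_norm q h = Lq_norm q {0<..} (\<lambda>u. ennreal (u powr (- recip q)) * h u)"

text \<open>
  Lebesgue measurability, because members of \<open>SV\<close> need not be Borel functions.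
\<close>

abbreviation pos_meas :: "(real \<Rightarrow> ennreal) \<Rightarrow> bool" where
  "pos_meas h \<equiv> h \<in> borel_measurable (lebesgue_on {0<..})"

lemma pos_meas_borel: "h \<in> borel_measurable borel \<Longrightarrow> pos_meas h"
  by (simp add: measurable_completion measurable_restrict_space1)

lemma pos_meas_indicator: "S \<in> sets borel \<Longrightarrow> pos_meas (indicator S)"
  by (intro pos_meas_borel) simp

lemma haar_integral_lborel:
  "haar_integral h = (\<integral>\<^sup>+ u. indicator {0<..} u * ennreal (1 / u) * h u \<partial>lborel)"
  unfolding haar_integral_def
  by (subst nn_integral_restrict_space) (auto simp: nn_integral_completion ac_simps)

lemma AE_pos_iff:
  "(AE u in lebesgue_on {0<..}. P u) \<longleftrightarrow> (AE u in lebesgue. 0 < u \<longrightarrow> P u)" for P :: "real \<Rightarrow> bool"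
  by (subst AE_restrict_space_iff) auto

lemma AE_pos_neq: "AE u in lebesgue_on {0<..}. 0 < u \<and> u \<noteq> (t::real)"
proof -
  have "AE u in lborel. u \<noteq> t"
    by (rule AE_lborel_singleton)
  then have "AE u in lebesgue. u \<noteq> t"
    by (rule AE_completion)
  then show ?thesis
    unfolding AE_pos_iff by eventually_elim auto
qed

lemma haar_integral_mono_AE:
  "AE u in lebesgue_on {0<..}. g u \<le> h u \<Longrightarrow> haar_integral g \<le> haar_integral h"
  unfolding haar_integral_def by (intro nn_integral_mono_AE) (auto elim!: eventually_mono intro: mult_left_mono)

lemma haar_integral_mono:
  "(\<And>u. 0 < u \<Longrightarrow> g u \<le> h u) \<Longrightarrow> haar_integral g \<le> haar_integral h"
  by (rule haar_integral_mono_AE) (use AE_pos_neq[of 0] in \<open>auto elim!: eventually_mono\<close>)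

lemma pos_meas_inverse [measurable]: "pos_meas (\<lambda>u. ennreal (1 / u))"
  by (intro pos_meas_borel) measurable

lemma haar_integral_cmult:
  "pos_meas h \<Longrightarrow> haar_integral (\<lambda>u. c * h u) = c * haar_integral h"
  unfolding haar_integral_def
  by (subst nn_integral_cmult[symmetric]) (auto simp: ac_simps intro!: borel_measurable_times pos_meas_inverse)

lemma haar_integral_add:
  "pos_meas g \<Longrightarrow> pos_meas h \<Longrightarrow> haar_integral (\<lambda>u. g u + h u) = haar_integral g + haar_integral h"
  unfolding haar_integral_def
  by (subst nn_integral_add[symmetric]) (auto simp: distrib_left intro!: borel_measurable_times pos_meas_inverse)

lemma recip_top [simp]: "recip top = 0"
  by (simp add: recip_def)

lemma exponent_cases:
  assumes "0 < (q::ennreal)"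
  obtains "q = \<infinity>" | p where "0 < p" "q = ennreal p" "recip q = 1 / p" "enn2real q = p"
proof (cases q)
  case (real p)
  then have "0 < p" using assms by auto
  moreover have "recip q = 1 / p"
    using real \<open>0 < p\<close> unfolding recip_def
    by (metis enn2real_ennreal inverse_ennreal inverse_eq_divide less_eq_real_def zero_le_divide_1_iff)
  ultimately show ?thesis using real that by auto
qed (use that in auto)

lemma haar_norm_top:
  "haar_norm \<infinity> h = Inf {z. AE u in lebesgue_on {0<..}. h u \<le> z}"
proof -
  have "(AE u in lebesgue_on {0<..}. ennreal (u powr (- recip \<infinity>)) * h u \<le> z) \<longleftrightarrow>
        (AE u in lebesgue_on {0<..}. h u \<le> z)" for z
    unfolding AE_pos_iff by (intro AE_cong) auto
  then show ?thesis by (simp add: haar_norm_def Lq_norm_def)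
qed

lemma haar_norm_finite_exponent:
  assumes "0 < p"
  shows "haar_norm (ennreal p) h = epowr (haar_integral (\<lambda>u. epowr (h u) p)) (1 / p)"
proof -
  have r: "recip (ennreal p) = 1 / p"
    using exponent_cases[of "ennreal p"] assms by (metis enn2real_ennreal ennreal_less_zero_iff ennreal_neq_top infinity_ennreal_def less_eq_real_def)
  have "epowr (ennreal (u powr (- (1 / p))) * h u) p = ennreal (1 / u) * epowr (h u) p" if "0 < u" for u
    using assms that by (simp add: epowr_mult epowr_ennreal powr_powr powr_minus inverse_eq_divide powr_divide)
  then have "(\<integral>\<^sup>+ u. epowr (ennreal (u powr (- (1 / p))) * h u) p \<partial>lebesgue_on {0<..}) =
      (\<integral>\<^sup>+ u. ennreal (1 / u) * epowr (h u) p \<partial>lebesgue_on {0<..})"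
    by (intro nn_integral_cong) (auto simp: space_restrict_space)
  then show ?thesis
    using assms by (simp add: haar_norm_def Lq_norm_def r haar_integral_def)
qed

text \<open>
  The least essential bound is a limit of a sequence of essential bounds, and countably many null
  sets have a null union.
\<close>

lemma haar_norm_top_AE: "AE u in lebesgue_on {0<..}. h u \<le> haar_norm \<infinity> h"
proof -
  let ?A = "{z. AE u in lebesgue_on {0<..}. h u \<le> z}"
  have "?A \<noteq> {}" by (auto intro!: exI[of _ top])
  from ennreal_Inf_countable_INF[OF this] obtain f :: "nat \<Rightarrow> ennreal"
    where f: "range f \<subseteq> ?A" "Inf ?A = (INF i. f i)" by metis
  have "AE u in lebesgue_on {0<..}. \<forall>i. h u \<le> f i"
    unfolding AE_all_countable using f(1) by auto
  then show ?thesis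
    unfolding haar_norm_top f(2) by eventually_elim (auto intro: INF_greatest)
qed

lemma haar_norm_top_le: "AE u in lebesgue_on {0<..}. h u \<le> z \<Longrightarrow> haar_norm \<infinity> h \<le> z"
  unfolding haar_norm_top by (rule Inf_lower) simp

lemma haar_norm_mono_AE:
  assumes "0 < q" "AE u in lebesgue_on {0<..}. g u \<le> h u"
  shows "haar_norm q g \<le> haar_norm q h"
  using assms(1)
proof (cases q rule: exponent_cases)
  case 1
  have "AE u in lebesgue_on {0<..}. g u \<le> haar_norm \<infinity> h"
    using assms(2) haar_norm_top_AE[of h] by eventually_elim auto
  then show ?thesis using 1 haar_norm_top_le by auto
next
  case (2 p)
  have "haar_integral (\<lambda>u. epowr (g u) p) \<le> haar_integral (\<lambda>u. epowr (h u) p)"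
    by (rule haar_integral_mono_AE) (use assms(2) 2 in \<open>auto elim!: eventually_mono intro: epowr_mono\<close>)
  then show ?thesis using 2 by (auto simp: haar_norm_finite_exponent intro: epowr_mono)
qed

text \<open>Used to split a half-line at \<open>t\<close> into two open intervals.\<close>

lemma haar_norm_mono_except:
  assumes "0 < q" "\<And>u. 0 < u \<Longrightarrow> u \<noteq> t \<Longrightarrow> g u \<le> h u"
  shows "haar_norm q g \<le> haar_norm q h"
  using assms(1) by (rule haar_norm_mono_AE) (rule eventually_mono[OF AE_pos_neq[of t]], use assms(2) in auto)

lemma haar_norm_mono:
  assumes "0 < q" "\<And>u. 0 < u \<Longrightarrow> g u \<le> h u"
  shows "haar_norm q g \<le> haar_norm q h"
  using assms by (rule haar_norm_mono_except)

lemma haar_norm_cong: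
  assumes "\<And>u. 0 < u \<Longrightarrow> g u = h u"
  shows "haar_norm q g = haar_norm q h"
proof -
  have "(\<integral>\<^sup>+ u. epowr (ennreal (u powr - recip q) * g u) (enn2real q) \<partial>lebesgue_on {0<..})
    = (\<integral>\<^sup>+ u. epowr (ennreal (u powr - recip q) * h u) (enn2real q) \<partial>lebesgue_on {0<..})"
    using assms by (intro nn_integral_cong) (auto simp: space_restrict_space)
  moreover have "(AE u in lebesgue_on {0<..}. ennreal (u powr - recip q) * g u \<le> z) =
     (AE u in lebesgue_on {0<..}. ennreal (u powr - recip q) * h u \<le> z)" for z
    unfolding AE_pos_iff using assms by (intro AE_cong) auto
  ultimately show ?thesis unfolding haar_norm_def Lq_norm_def by (simp only:)
qed

lemma ennreal_le_divide:
  fixes x y c :: ennreal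
  assumes "0 < c" "c < top"
  shows "x \<le> y / c \<longleftrightarrow> c * x \<le> y"
proof
  have c: "c * (z / c) = z" for z
    using assms ennreal_mult_divide_eq[of c z] by (simp add: ennreal_times_divide mult.commute)
  show "c * x \<le> y" if "x \<le> y / c"
    using mult_left_mono[OF that, of c] c by simp
  show "x \<le> y / c" if "c * x \<le> y"
    using divide_right_mono_ennreal[OF that, of c] assms ennreal_mult_divide_eq[of c x]
    by (simp add: mult.commute)
qed

text \<open>
  The factor \<open>c = \<infinity>\<close> is included, so that infinite values of \<open>K\<close>-functionals and tails need no
  separate treatment.
\<close>

lemma haar_norm_cmult:
  assumes "0 < q" "pos_meas h"
  shows "haar_norm q (\<lambda>u. c * h u) = c * haar_norm q h"
  using assms(1)
proof (cases q rule: exponent_cases)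
  case 1
  have "haar_norm \<infinity> (\<lambda>u. c * h u) \<le> c * haar_norm \<infinity> h"
    using haar_norm_top_AE[of h] by (intro haar_norm_top_le) (auto elim!: eventually_mono intro: mult_left_mono)
  moreover have "c * haar_norm \<infinity> h \<le> haar_norm \<infinity> (\<lambda>u. c * h u)"
  proof -
    let ?z = "haar_norm \<infinity> (\<lambda>u. c * h u)"
    have z: "AE u in lebesgue_on {0<..}. c * h u \<le> ?z"
      by (rule haar_norm_top_AE)
    consider "c = 0" | "0 < c" "c < \<infinity>" | "c = \<infinity>" "?z = \<infinity>" | "c = \<infinity>" "?z < \<infinity>"
      by (metis infinity_ennreal_def not_gr_zero top.not_eq_extremum)
    then show ?thesis
    proof cases
      case 2
      have "AE u in lebesgue_on {0<..}. h u \<le> ?z / c"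
        using z by eventually_elim (use 2 in \<open>simp add: ennreal_le_divide\<close>)
      then have "haar_norm \<infinity> h \<le> ?z / c" by (rule haar_norm_top_le)
      then show ?thesis using 2 by (simp add: ennreal_le_divide)
    next
      case 4
      have "AE u in lebesgue_on {0<..}. h u \<le> 0"
        using z by eventually_elim (use 4 in \<open>auto simp: ennreal_top_mult split: if_splits\<close>)
      then have "haar_norm \<infinity> h \<le> 0" by (rule haar_norm_top_le)
      then show ?thesis by simp
    qed auto
  qed
  ultimately show ?thesis using 1 by auto
next
  case (2 p)
  have "pos_meas (\<lambda>u. epowr (h u) p)" using assms by measurable
  then show ?thesis using 2
    by (simp add: haar_norm_finite_exponent epowr_mult haar_integral_cmult epowr_epowr epowr_one)
qed

lemma haar_norm_add:
  assumes "0 < q"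
  obtains C where "C < \<infinity>" "1 \<le> C"
    "\<And>g h. pos_meas g \<Longrightarrow> pos_meas h \<Longrightarrow> haar_norm q (\<lambda>u. g u + h u) \<le> C * (haar_norm q g + haar_norm q h)"
  using assms
proof (cases q rule: exponent_cases)
  case 1
  have "haar_norm \<infinity> (\<lambda>u. g u + h u) \<le> haar_norm \<infinity> g + haar_norm \<infinity> h" for g h
    by (rule haar_norm_top_le) (use haar_norm_top_AE[of g] haar_norm_top_AE[of h] in
      \<open>eventually_elim, auto intro: add_mono\<close>)
  then show ?thesis using that[of 1] 1 by auto
next
  case (2 p)
  let ?C = "ennreal ((2 powr p) powr (1 / p)) * ennreal (2 powr (1 / p))"
  have eq: "?C = ennreal (2 * 2 powr (1/p))" using 2 powr_powr[of 2 p "1 / p"] by (subst ennreal_mult[symmetric]) auto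
  show ?thesis
  proof (rule that)
    show "?C < \<infinity>" by (simp add: ennreal_mult_less_top)
    show "1 \<le> ?C" unfolding eq using ge_one_powr_ge_zero[of 2 "1/p"] 2 by auto
    fix g h assume [measurable]: "pos_meas g" "pos_meas h"
    let ?G = "haar_integral (\<lambda>u. epowr (g u) p)" and ?H = "haar_integral (\<lambda>u. epowr (h u) p)"
    have "haar_integral (\<lambda>u. epowr (g u + h u) p) \<le>
        haar_integral (\<lambda>u. ennreal (2 powr p) * (epowr (g u) p + epowr (h u) p))"
      using 2 by (intro haar_integral_mono epowr_add_le)
    also have "\<dots> = ennreal (2 powr p) * (?G + ?H)"
      by (subst haar_integral_cmult, measurable, subst haar_integral_add) auto
    finally have "epowr (haar_integral (\<lambda>u. epowr (g u + h u) p)) (1 / p) \<le>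
       epowr (ennreal (2 powr p) * (?G + ?H)) (1/p)"
      using 2 by (intro epowr_mono) auto
    also have "\<dots> = ennreal ((2 powr p) powr (1 / p)) * epowr (?G + ?H) (1/p)"
      using 2 by (simp add: epowr_mult epowr_ennreal)
    also have "\<dots> \<le> ennreal ((2 powr p) powr (1 / p)) * (ennreal (2 powr (1/p)) *
        (epowr ?G (1/p) + epowr ?H (1/p)))"
      using 2 by (intro mult_left_mono epowr_add_le) auto
    finally show "haar_norm q (\<lambda>u. g u + h u) \<le> ?C * (haar_norm q g + haar_norm q h)"
      using 2 by (simp add: haar_norm_finite_exponent mult.assoc)
  qed
qed

text \<open>
  Norms over subintervals become norms of cut-off functions, so that splitting an interval is
  pointwise addition.
\<close>

lemma haar_norm_restrict:
  assumes "0 < q" "S \<in> sets lebesgue" "S \<subseteq> {0<..}"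
  shows "Lq_norm q S (\<lambda>u. ennreal (u powr (- recip q)) * h u) = haar_norm q (\<lambda>u. indicator S u * h u)"
  using assms(1)
proof (cases q rule: exponent_cases)
  case 1
  have "(AE u in lebesgue_on S. ennreal (u powr (- recip \<infinity>)) * h u \<le> z) \<longleftrightarrow>
        (AE u in lebesgue_on {0<..}. indicator S u * h u \<le> z)" for z
    unfolding AE_pos_iff using assms(2,3)
    by (subst AE_restrict_space_iff) (auto intro!: AE_cong simp: indicator_def)
  then show ?thesis unfolding 1 haar_norm_top by (simp add: Lq_norm_def)
next
  case (2 p)
  have "epowr (ennreal (u powr (- (1 / p))) * h u) p * indicator S u =
     (ennreal (1 / u) * epowr (indicator S u * h u) p) * indicator {0<..} u" for u
    using assms(3) 2
    by (auto simp: indicator_def epowr_mult epowr_zero epowr_base_one epowr_ennreal powr_powr powr_minus inverse_eq_divide powr_divide)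
  then show ?thesis using 2 assms(2,3)
    by (simp add: haar_norm_finite_exponent Lq_norm_def haar_integral_def nn_integral_restrict_space)
qed

text \<open>Superlevel sets of a monotone function are intervals.\<close>

lemma pos_meas_mono:
  fixes h :: "real \<Rightarrow> ennreal"
  assumes "mono_on {0<..} h \<or> antimono_on {0<..} h"
  shows "pos_meas h"
proof (rule borel_measurableI_greater)
  fix y
  have "is_interval {x. 0 < x \<and> y < h x}"
    unfolding is_interval_1 using assms
    by (auto simp: monotone_on_def) (metis greaterThan_iff order_less_le_trans)+
  then have "{x. 0 < x \<and> y < h x} \<in> sets borel" by (rule real_interval_borel_measurable)
  moreover have "{x \<in> space (lebesgue_on {0<..}). y < h x} = {0<..} \<inter> {x. 0 < x \<and> y < h x}"
    by (auto simp: space_restrict_space)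
  ultimately show "{x \<in> space (lebesgue_on {0<..}). y < h x} \<in> sets (lebesgue_on {0<..})"
    by (auto simp: sets_restrict_space)
qed

section \<open>Model integrals and a Schur test\<close>

lemma haar_integral_tail:
  assumes "0 < e" "0 < t"
  shows "haar_integral (\<lambda>u. indicator {t<..} u * ennreal ((t / u) powr e)) \<le> ennreal (1 / e)"
proof -
  have "((\<lambda>u. t powr e * (u powr (- e - 1))) has_integral (t powr e * (-(t powr (- e - 1 + 1)) / (- e - 1 + 1)))) {t..}"
    using assms by (intro has_integral_mult_right has_integral_powr_to_inf) auto
  then have "((\<lambda>u. t powr e * (u powr (- e - 1))) has_integral (1 / e)) {t..}"
    using assms by (simp add: powr_minus field_simps)
  then have "(\<integral>\<^sup>+ u. ennreal (t powr e * (u powr (- e - 1))) * indicator {t..} u \<partial>lborel) = ennreal (1 / e)"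
    by (intro nn_integral_has_integral_lebesgue') auto
  moreover have "indicator {0<..} u * ennreal (1 / u) * (indicator {t<..} u * ennreal ((t / u) powr e)) \<le>
      ennreal (t powr e * (u powr (- e - 1))) * indicator {t..} u" for u
    using assms
    by (auto simp: indicator_def powr_diff powr_minus powr_divide field_simps simp flip: ennreal_mult)
  ultimately show ?thesis unfolding haar_integral_lborel
    by (metis (no_types, lifting) nn_integral_mono)
qed

lemma haar_integral_head:
  assumes "0 < e" "0 < t"
  shows "haar_integral (\<lambda>u. indicator {..t} u * ennreal ((u / t) powr e)) \<le> ennreal (1 / e)"
proof -
  have "((\<lambda>u. u powr (e - 1)) has_integral (t powr (e - 1 + 1) / (e - 1 + 1))) {0..t}"
    using assms by (intro has_integral_powr_from_0) auto
  then have "((\<lambda>u. t powr (- e) * (u powr (e - 1))) has_integral (t powr (- e) * (t powr (e - 1 + 1) / (e - 1 + 1)))) {0..t}"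
    by (rule has_integral_mult_right)
  then have "((\<lambda>u. t powr (- e) * (u powr (e - 1))) has_integral (1 / e)) {0..t}"
    using assms by (simp add: powr_minus field_simps)
  then have "(\<integral>\<^sup>+ u. ennreal (t powr (- e) * (u powr (e - 1))) * indicator {0..t} u \<partial>lborel) = ennreal (1 / e)"
    by (intro nn_integral_has_integral_lebesgue') auto
  moreover have "indicator {0<..} u * ennreal (1 / u) * (indicator {..t} u * ennreal ((u / t) powr e)) \<le>
      ennreal (t powr (- e) * (u powr (e - 1))) * indicator {0..t} u" for u
    using assms
    by (auto simp: indicator_def powr_diff powr_minus powr_divide field_simps simp flip: ennreal_mult)
  ultimately show ?thesis unfolding haar_integral_lborel
    by (metis (no_types, lifting) nn_integral_mono)
qed

lemma haar_integral_interval_ge: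
  assumes "0 < a" "a \<le> b"
  shows "ennreal ((b - a) / b) \<le> haar_integral (indicator {a<..<b})"
proof -
  have "(\<integral>\<^sup>+ u. ennreal (1 / b) * indicator {a<..<b} u \<partial>lborel) = ennreal ((b - a) / b)"
    using assms by (subst nn_integral_cmult) (auto simp flip: ennreal_mult)
  moreover have "ennreal (1 / b) * indicator {a<..<b} u \<le>
      indicator {0<..} u * ennreal (1 / u) * indicator {a<..<b} u" for u
    using assms by (auto simp: indicator_def frac_le)
  ultimately show ?thesis unfolding haar_integral_lborel
    by (metis (no_types, lifting) nn_integral_mono)
qed

lemma haar_integral_interval_le:
  assumes "0 < a" "a \<le> b"
  shows "haar_integral (indicator {a..b}) \<le> ennreal ((b - a) / a)"
proof -
  have "(\<integral>\<^sup>+ u. ennreal (1 / a) * indicator {a..b} u \<partial>lborel) = ennreal ((b - a) / a)"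
    using assms by (subst nn_integral_cmult) (auto simp flip: ennreal_mult)
  moreover have "indicator {0<..} u * ennreal (1 / u) * indicator {a..b} u \<le> ennreal (1 / a) * indicator {a..b} u" for u
    using assms by (auto simp: indicator_def frac_le)
  ultimately show ?thesis unfolding haar_integral_lborel
    by (metis (no_types, lifting) nn_integral_mono)
qed

lemma haar_norm_tail:
  assumes "0 < q" "0 < e"
  obtains C where "C < \<infinity>"
    "\<And>t. 0 < t \<Longrightarrow> haar_norm q (\<lambda>u. indicator {t<..} u * ennreal ((t / u) powr e)) \<le> C"
  using assms(1)
proof (cases q rule: exponent_cases)
  case 1
  have "haar_norm q (\<lambda>u. indicator {t<..} u * ennreal ((t / u) powr e)) \<le> 1" if "0 < t" for t
    unfolding 1
  proof (intro haar_norm_top_le AE_I2)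
    fix u
    show "indicator {t<..} u * ennreal ((t / u) powr e) \<le> 1"
      using that assms powr_mono2[of e "t / u" 1] by (auto simp: indicator_def)
  qed
  then show ?thesis using that[of 1] by auto
next
  case (2 p)
  have "haar_norm q (\<lambda>u. indicator {t<..} u * ennreal ((t / u) powr e)) \<le> epowr (ennreal (1 / (e * p))) (1 / p)"
    if "0 < t" for t
  proof -
    have "epowr (indicator {t<..} u * ennreal ((t / u) powr e)) p = indicator {t<..} u * ennreal ((t / u) powr (e * p))" for u
      using 2 by (auto simp: indicator_def epowr_zero epowr_ennreal powr_powr)
    then show ?thesis using 2 that assms haar_integral_tail[of "e * p" t]
      by (auto simp: haar_norm_finite_exponent intro: epowr_mono)
  qed
  then show ?thesis using that[of "epowr (ennreal (1 / (e * p))) (1 / p)"] epowr_less_top[of "ennreal (1 / (e * p))" "1 / p"]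
    by (simp add: ennreal_less_top)
qed

text \<open>
  The interval \<open>(t, 2 t)\<close> has measure at least \<open>1 / 2\<close> for \<open>du / u\<close>.
\<close>

lemma haar_integral_ge_dyadic:
  assumes "0 < t" "\<And>u. t < u \<Longrightarrow> u < 2 * t \<Longrightarrow> x \<le> h u"
  shows "x \<le> 2 * haar_integral h"
proof -
  have "ennreal (1 / 2) * x \<le> haar_integral (indicator {t<..<2 * t}) * x"
    using haar_integral_interval_ge[of t "2 * t"] assms(1) by (intro mult_right_mono) auto
  also have "\<dots> = haar_integral (\<lambda>u. x * indicator {t<..<2 * t} u)"
    by (subst haar_integral_cmult) (auto simp: mult.commute intro: pos_meas_borel)
  also have "\<dots> \<le> haar_integral h"
    using assms(2) by (intro haar_integral_mono) (simp add: indicator_def)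
  finally have "2 * (ennreal (1 / 2) * x) \<le> 2 * haar_integral h"
    by (rule mult_left_mono) simp
  moreover have "2 * ennreal (1 / 2) = 1"
    using ennreal_mult[of 2 "1 / 2"] by simp
  ultimately show ?thesis by (simp add: mult.assoc[symmetric])
qed

text \<open>
  Substitute for evaluation at a point: it bounds a value by a norm once that value is comparable to
  the values on a neighbouring dyadic interval.
\<close>

lemma haar_norm_ge_dyadic:
  assumes "0 < q"
  obtains C where "C < \<infinity>"
    "\<And>t x h. 0 < t \<Longrightarrow> (\<And>u. t < u \<Longrightarrow> u < 2 * t \<Longrightarrow> x \<le> h u) \<Longrightarrow> x \<le> C * haar_norm q h"
  using assms
proof (cases q rule: exponent_cases)
  case 1
  have "x \<le> 1 * haar_norm q h" if t: "0 < t" and x: "\<And>u. t < u \<Longrightarrow> u < 2 * t \<Longrightarrow> x \<le> h u" for t x h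
  proof (rule ccontr)
    assume "\<not> ?thesis"
    then have less: "haar_norm q h < x" by auto
    have "AE u in lebesgue_on {0<..}. indicator {t<..<2 * t} u \<le> (0::ennreal)"
      using haar_norm_top_AE[of h]
    proof eventually_elim
      case (elim u)
      then have "\<not> (t < u \<and> u < 2 * t)" using x[of u] less 1 by (metis leD order.trans)
      then show ?case by auto
    qed
    then have "haar_integral (indicator {t<..<2 * t}) \<le> haar_integral (\<lambda>u. 0)"
      by (rule haar_integral_mono_AE)
    also have "\<dots> = 0" by (simp add: haar_integral_def)
    finally show False
      using haar_integral_interval_ge[of t "2 * t"] t by auto
  qed
  then show ?thesis using that[of 1] by auto
next
  case (2 p)
  show ?thesis
  proof (rule that)
    show "epowr 2 (1 / p) < \<infinity>" by (rule epowr_less_top) simp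
    fix t :: real and x :: ennreal and h :: "real \<Rightarrow> ennreal"
    assume t: "0 < t" and x: "\<And>u. t < u \<Longrightarrow> u < 2 * t \<Longrightarrow> x \<le> h u"
    have "epowr x p \<le> epowr (h u) p" if "t < u" "u < 2 * t" for u
      using x[OF that] \<open>0 < p\<close> by (simp add: epowr_mono)
    then have "epowr x p \<le> 2 * haar_integral (\<lambda>u. epowr (h u) p)"
      by (rule haar_integral_ge_dyadic[OF t])
    then have "epowr (epowr x p) (1 / p) \<le> epowr (2 * haar_integral (\<lambda>u. epowr (h u) p)) (1 / p)"
      using \<open>0 < p\<close> by (simp add: epowr_mono)
    also have "epowr (epowr x p) (1 / p) = x"
      using \<open>0 < p\<close> by (simp add: epowr_epowr epowr_one)
    also have "epowr (2 * haar_integral (\<lambda>u. epowr (h u) p)) (1 / p) = epowr 2 (1 / p) * haar_norm q h"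
      unfolding \<open>q = ennreal p\<close> haar_norm_finite_exponent[OF \<open>0 < p\<close>]
      using \<open>0 < p\<close> by (intro epowr_mult) simp
    finally show "x \<le> epowr 2 (1 / p) * haar_norm q h" .
  qed
qed

text \<open>
  Integrate the bound on \<open>F\<close> in \<open>u\<close>, interchange the integrals by Tonelli, and use the bound on the
  kernel for fixed \<open>t\<close>.
\<close>

lemma haar_norm_schur:
  assumes p: "0 < p"
    and k [measurable]: "case_prod k \<in> borel_measurable (borel \<Otimes>\<^sub>M borel)"
    and G [measurable]: "G \<in> borel_measurable borel"
    and F: "\<And>u. 0 < u \<Longrightarrow> epowr (F u) p \<le> C * haar_integral (\<lambda>t. k u t * epowr (G t) p)"
    and D: "\<And>t. 0 < t \<Longrightarrow> haar_integral (\<lambda>u. k u t) \<le> D"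
  shows "haar_norm (ennreal p) F \<le> epowr (C * D) (1 / p) * haar_norm (ennreal p) G"
proof -
  let ?w = "\<lambda>u. indicator {0<..} u * ennreal (1 / u) :: ennreal"
  have [measurable]: "case_prod k \<in> borel_measurable (lborel \<Otimes>\<^sub>M lborel)"
    using k by (simp cong: measurable_cong_sets)
  define g where "g t = epowr (G t) p" for t
  have [measurable]: "g \<in> borel_measurable borel" unfolding g_def[abs_def] by measurable
  define H where "H u = (\<integral>\<^sup>+ t. ?w t * (k u t * g t) \<partial>lborel)" for u
  have [measurable]: "H \<in> borel_measurable lborel" unfolding H_def[abs_def] by measurable
  have H: "H u = haar_integral (\<lambda>t. k u t * g t)" for u
    by (simp add: H_def haar_integral_lborel)
  have "haar_integral (\<lambda>u. epowr (F u) p) \<le> haar_integral (\<lambda>u. C * H u)"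
    unfolding H g_def by (intro haar_integral_mono F)
  also have "\<dots> = C * (\<integral>\<^sup>+ u. ?w u * H u \<partial>lborel)"
  proof -
    have "?w u * (C * H u) = C * (?w u * H u)" for u by (simp only: mult.left_commute)
    then show ?thesis unfolding haar_integral_lborel by (simp only:) (rule nn_integral_cmult; measurable)
  qed
  also have "(\<integral>\<^sup>+ u. ?w u * H u \<partial>lborel) =
      (\<integral>\<^sup>+ u. (\<integral>\<^sup>+ t. ?w u * (?w t * (k u t * g t)) \<partial>lborel) \<partial>lborel)"
    unfolding H_def by (intro nn_integral_cong nn_integral_cmult[symmetric]) measurable
  also have "\<dots> = (\<integral>\<^sup>+ t. (\<integral>\<^sup>+ u. ?w u * (?w t * (k u t * g t)) \<partial>lborel) \<partial>lborel)"
    by (rule lborel_pair.Fubini') measurable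
  also have "\<dots> = (\<integral>\<^sup>+ t. ?w t * g t * haar_integral (\<lambda>u. k u t) \<partial>lborel)"
  proof (rule nn_integral_cong)
    fix t
    have "?w u * (?w t * (k u t * g t)) = ?w t * g t * (?w u * k u t)" for u
      by (simp only: mult.left_commute mult.commute mult.assoc)
    then show "(\<integral>\<^sup>+ u. ?w u * (?w t * (k u t * g t)) \<partial>lborel) = ?w t * g t * haar_integral (\<lambda>u. k u t)"
      unfolding haar_integral_lborel by (simp only:) (rule nn_integral_cmult; measurable)
  qed
  also have "\<dots> \<le> (\<integral>\<^sup>+ t. D * (?w t * g t) \<partial>lborel)"
  proof (rule nn_integral_mono)
    fix t
    show "?w t * g t * haar_integral (\<lambda>u. k u t) \<le> D * (?w t * g t)"
    proof (cases "0 < t")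
      case True
      from D[OF this] show ?thesis by (simp only: mult.commute[of D]) (rule mult_left_mono, auto)
    qed simp
  qed
  also have "\<dots> = D * haar_integral g"
    unfolding haar_integral_lborel by (rule nn_integral_cmult) measurable
  also have "g = (\<lambda>t. epowr (G t) p)" by (simp add: g_def[abs_def])
  finally have "haar_integral (\<lambda>u. epowr (F u) p) \<le> C * D * haar_integral (\<lambda>t. epowr (G t) p)"
    by (simp add: mult_left_mono mult.assoc)
  then have "epowr (haar_integral (\<lambda>u. epowr (F u) p)) (1 / p) \<le> epowr (C * D * haar_integral (\<lambda>t. epowr (G t) p)) (1 / p)"
    using p by (intro epowr_mono) auto
  then show ?thesis using p by (simp add: haar_norm_finite_exponent epowr_mult)
qed

section \<open>Tempered functions and dyadic step functions\<close>

text \<open>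
  This is \<open>exp \<bar>ln s - ln t\<bar>\<close> for positive arguments, a multiplicative distance.
\<close>

definition dil :: "real \<Rightarrow> real \<Rightarrow> real" where
  "dil s t = max (s / t) (t / s)"

lemma dil_commute: "dil s t = dil t s"
  by (simp add: dil_def max.commute)

lemma dil_le: "0 < s \<Longrightarrow> s \<le> t \<Longrightarrow> dil s t = t / s"
proof -
  assume *: "0 < s" "s \<le> t"
  then have "s / t \<le> 1" "1 \<le> t / s" by auto
  then show ?thesis unfolding dil_def by linarith
qed

lemma dil_ge_1: "0 < s \<Longrightarrow> 0 < t \<Longrightarrow> 1 \<le> dil s t"
  using dil_le[of s t] dil_le[of t s] dil_commute[of s t] by (cases "s \<le> t") auto

lemma dil_le_iff: "0 < s \<Longrightarrow> 0 < t \<Longrightarrow> dil s t \<le> M \<longleftrightarrow> s \<le> M * t \<and> t \<le> M * s"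
  unfolding dil_def by (auto simp: field_simps)

lemma dil_triangle: "0 < s \<Longrightarrow> 0 < t \<Longrightarrow> 0 < u \<Longrightarrow> dil s u \<le> dil s t * dil t u"
proof -
  assume *: "0 < s" "0 < t" "0 < u"
  have "s / u = (s / t) * (t / u)" "u / s = (t / s) * (u / t)" using * by auto
  moreover have "(s / t) * (t / u) \<le> dil s t * dil t u" "(t / s) * (u / t) \<le> dil s t * dil t u"
    using * by (intro mult_mono; auto simp: dil_def le_max_iff_disj)+
  ultimately have "s / u \<le> dil s t * dil t u" "u / s \<le> dil s t * dil t u" by argo+
  then show ?thesis by (simp add: dil_def[of s u])
qed

text \<open>
  At most polynomial growth and decay. The constants are parameters because they have to be the same
  for all functions \<open>K(\<cdot>, f)\<close>.
\<close>

definition tempered :: "real \<Rightarrow> ennreal \<Rightarrow> (real \<Rightarrow> ennreal) \<Rightarrow> bool" where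
  "tempered p C h \<longleftrightarrow> (\<forall>s>0. \<forall>t>0. h s \<le> C * ennreal (dil s t powr p) * h t)"

lemma temperedD: "tempered p C h \<Longrightarrow> 0 < s \<Longrightarrow> 0 < t \<Longrightarrow> h s \<le> C * ennreal (dil s t powr p) * h t"
  by (auto simp: tempered_def)

lemma tempered_near:
  assumes "tempered p C h" "0 \<le> p" "0 < s" "0 < t" "dil s t \<le> M"
  shows "h s \<le> C * ennreal (M powr p) * h t"
proof -
  have "h s \<le> C * ennreal (dil s t powr p) * h t"
    using assms by (intro temperedD)
  also have "\<dots> \<le> C * ennreal (M powr p) * h t"
    using assms dil_ge_1[of s t]
    by (intro mult_right_mono mult_left_mono ennreal_leI powr_mono2) auto
  finally show ?thesis .
qed

lemma tempered_mult:
  assumes "tempered p C g" "tempered p' C' h"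
  shows "tempered (p + p') (C * C') (\<lambda>u. g u * h u)"
  unfolding tempered_def
proof (intro allI impI)
  fix s t :: real assume "0 < s" "0 < t"
  then have "g s * h s \<le> (C * ennreal (dil s t powr p) * g t) * (C' * ennreal (dil s t powr p') * h t)"
    using assms by (intro mult_mono temperedD) auto
  then show "g s * h s \<le> C * C' * ennreal (dil s t powr (p + p')) * (g t * h t)"
    by (simp add: powr_add ennreal_mult ac_simps)
qed

lemma tempered_powr: "tempered \<bar>p\<bar> 1 (\<lambda>u. ennreal (u powr p))"
  unfolding tempered_def
proof (intro allI impI)
  fix s t :: real assume st: "0 < s" "0 < t"
  have "s powr p / t powr p = (s / t) powr p"
    using st by (simp add: powr_divide)
  also have "\<dots> \<le> dil s t powr \<bar>p\<bar>"
  proof (cases "0 \<le> p")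
    case True
    then show ?thesis using st by (auto simp: dil_def intro!: powr_mono2)
  next
    case False
    have "(s / t) powr p = (t / s) powr (- p)"
      using st by (simp add: powr_minus powr_divide)
    also have "\<dots> \<le> dil s t powr \<bar>p\<bar>" using False st by (simp add: dil_def powr_mono2)
    finally show ?thesis .
  qed
  finally have "s powr p \<le> dil s t powr \<bar>p\<bar> * t powr p"
    using st by (simp add: field_simps)
  then show "ennreal (s powr p) \<le> 1 * ennreal (dil s t powr \<bar>p\<bar>) * ennreal (t powr p)"
    by (simp add: ennreal_leI flip: ennreal_mult)
qed

text \<open>
  A function of an integer argument composed with a Borel function, hence Borel for every \<open>h\<close>. This is
  what makes Tonelli applicable to weights such as \<open>a \<circ> \<rho>\<close>.
\<close>

definition step :: "(real \<Rightarrow> ennreal) \<Rightarrow> real \<Rightarrow> ennreal" where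
  "step h t = h (2 powr real_of_int \<lfloor>log 2 t\<rfloor>)"

lemma step_measurable [measurable]: "step h \<in> borel_measurable borel"
proof -
  have "(\<lambda>t. \<lfloor>log 2 t\<rfloor>) \<in> measurable borel (count_space UNIV)" by measurable
  then have "(\<lambda>k. h (2 powr real_of_int k)) \<circ> (\<lambda>t. \<lfloor>log 2 t\<rfloor>) \<in> borel_measurable borel"
    by (rule measurable_comp) simp
  then show ?thesis by (simp add: step_def[abs_def] comp_def)
qed

lemma dyadic_floor:
  assumes "0 < (t::real)" shows "2 powr real_of_int \<lfloor>log 2 t\<rfloor> \<le> t" "t < 2 * 2 powr real_of_int \<lfloor>log 2 t\<rfloor>"
proof -
  have "2 powr real_of_int \<lfloor>log 2 t\<rfloor> \<le> 2 powr log 2 t" by (intro powr_mono) auto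
  then show "2 powr real_of_int \<lfloor>log 2 t\<rfloor> \<le> t" using assms by simp
  have "2 powr log 2 t < 2 powr (1 + real_of_int \<lfloor>log 2 t\<rfloor>)" by (intro powr_less_mono) linarith+
  then show "t < 2 * 2 powr real_of_int \<lfloor>log 2 t\<rfloor>" using assms by (simp add: powr_add)
qed

lemma tempered_step:
  assumes "tempered p C h" "0 \<le> p" "0 < t"
  shows "h t \<le> C * ennreal (2 powr p) * step h t" "step h t \<le> C * ennreal (2 powr p) * h t"
proof -
  let ?s = "2 powr real_of_int \<lfloor>log 2 t\<rfloor>"
  have "dil t ?s \<le> 2" "dil ?s t \<le> 2"
    using dyadic_floor[OF assms(3)] assms(3) by (auto simp: dil_le_iff)
  then show "h t \<le> C * ennreal (2 powr p) * step h t" "step h t \<le> C * ennreal (2 powr p) * h t"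
    unfolding step_def using assms by (intro tempered_near; simp)+
qed

lemma ennreal_inverse_cancel:
  fixes D x :: ennreal
  assumes "D < \<infinity>" "D \<noteq> 0"
  shows "inverse D * (D * x) = x" "D * (inverse D * x) = x"
proof -
  have "D * inverse D = 1"
    using assms by (simp add: ennreal_divide_self divide_ennreal_def[symmetric])
  then show "inverse D * (D * x) = x" "D * (inverse D * x) = x"
    by (metis mult.assoc mult.commute mult_1)+
qed

text \<open>
  Both bounds hold pointwise; the factor is pulled out of the norm on the side of the step function,
  where measurability is guaranteed.
\<close>

lemma tempered_norm_step:
  assumes "0 < q" "0 \<le> p" "A < \<infinity>"
  obtains D where "D < \<infinity>"
    "\<And>h. tempered p A h \<Longrightarrow> haar_norm q (step h) \<le> D * haar_norm q h"
    "\<And>h. tempered p A h \<Longrightarrow> haar_norm q h \<le> D * haar_norm q (step h)"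
proof -
  \<comment> \<open>the summand 1 makes the constant invertible\<close>
  let ?D = "A * ennreal (2 powr p) + 1"
  have D: "?D < \<infinity>" "?D \<noteq> 0" using assms by (auto simp: ennreal_mult_less_top)
  have "haar_norm q (step h) \<le> ?D * haar_norm q h" "haar_norm q h \<le> ?D * haar_norm q (step h)"
    if h: "tempered p A h" for h
  proof -
    have "A * ennreal (2 powr p) * x \<le> ?D * x" for x by (intro mult_right_mono) auto
    then have 1: "h u \<le> ?D * step h u" "step h u \<le> ?D * h u" if "0 < u" for u
      using tempered_step[OF h assms(2) that] order.trans by blast+
    have "haar_norm q h \<le> haar_norm q (\<lambda>u. ?D * step h u)"
      using 1 assms by (intro haar_norm_mono)
    then show "haar_norm q h \<le> ?D * haar_norm q (step h)"
      by (subst (asm) haar_norm_cmult) (auto intro: assms pos_meas_borel)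
    have "haar_norm q (\<lambda>u. inverse ?D * step h u) \<le> haar_norm q h"
    proof (rule haar_norm_mono[OF assms(1)])
      fix u :: real assume "0 < u"
      then have "inverse ?D * step h u \<le> inverse ?D * (?D * h u)"
        using 1 by (intro mult_left_mono) auto
      also have "\<dots> = h u"
        by (rule ennreal_inverse_cancel(1)[OF D])
      finally show "inverse ?D * step h u \<le> h u" .
    qed
    then have "inverse ?D * haar_norm q (step h) \<le> haar_norm q h"
      by (subst (asm) haar_norm_cmult) (auto intro: assms pos_meas_borel)
    then have "?D * (inverse ?D * haar_norm q (step h)) \<le> ?D * haar_norm q h"
      by (rule mult_left_mono) auto
    then show "haar_norm q (step h) \<le> ?D * haar_norm q h"
      by (simp only: ennreal_inverse_cancel(2)[OF D])
  qed
  with D that show ?thesis by blast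
qed

lemma tempered_le_norm:
  assumes "0 < q" "0 \<le> p" "A < \<infinity>"
  obtains D where "D < \<infinity>"
    "\<And>h t. tempered p A h \<Longrightarrow> 0 < t \<Longrightarrow> h t \<le> D * haar_norm q h"
proof -
  obtain C where C: "C < \<infinity>"
    "\<And>t x h. 0 < t \<Longrightarrow> (\<And>u. t < u \<Longrightarrow> u < 2 * t \<Longrightarrow> x \<le> h u) \<Longrightarrow> x \<le> C * haar_norm q h"
    using haar_norm_ge_dyadic[OF assms(1)] by blast
  obtain E where E: "E < \<infinity>" "\<And>h. tempered p A h \<Longrightarrow> haar_norm q (step h) \<le> E * haar_norm q h"
    using tempered_norm_step[OF assms] by metis
  let ?a = "A * ennreal (2 powr p)"
  have "h t \<le> C * (?a * ?a) * E * haar_norm q h" if h: "tempered p A h" "0 < t" for h t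
  proof -
    have "h t \<le> C * haar_norm q (\<lambda>u. ?a * ?a * step h u)"
    proof (rule C(2)[of t])
      fix u assume u: "t < u" "u < 2 * t"
      then have "0 < u" using h(2) by linarith
      have "h t \<le> ?a * h u"
        using u h assms by (intro tempered_near) (auto simp: dil_le_iff)
      also have "\<dots> \<le> ?a * (?a * step h u)"
        using tempered_step(1)[OF h(1) assms(2) \<open>0 < u\<close>] by (rule mult_left_mono) simp
      finally show "h t \<le> ?a * ?a * step h u" by (simp only: mult.assoc)
    qed (use h in auto)
    also have "haar_norm q (\<lambda>u. ?a * ?a * step h u) = ?a * ?a * haar_norm q (step h)"
      by (intro haar_norm_cmult assms pos_meas_borel step_measurable)
    also have "\<dots> \<le> ?a * ?a * (E * haar_norm q h)"
      using E(2)[OF h(1)] by (rule mult_left_mono) simp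
    finally show ?thesis by (simp add: mult.assoc mult_left_mono)
  qed
  moreover have "C * (?a * ?a) * E < \<infinity>" using C(1) E(1) assms by (auto simp: ennreal_mult_less_top)
  ultimately show ?thesis using that by blast
qed

section \<open>Change of variables and a Hardy inequality\<close>

text \<open>
  The relation \<open>E\<close> pairs points at which \<open>F\<close> and \<open>G\<close> are compared: every \<open>u\<close> is paired with a
  whole dyadic interval of points \<open>t\<close>, and the points \<open>u\<close> paired with one \<open>t\<close> stay within a bounded
  factor. For finite \<open>q\<close> this is the Schur test for the indicator function of \<open>E\<close>.
\<close>

lemma haar_norm_comparison:
  assumes "0 < q" "B < \<infinity>" "1 \<le> R"
  obtains D where "D < \<infinity>"
    "\<And>E F G. Measurable.pred (borel \<Otimes>\<^sub>M borel) (case_prod E) \<Longrightarrow> G \<in> borel_measurable borel \<Longrightarrow>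
      (\<And>u. 0 < u \<Longrightarrow> \<exists>t0>0. \<forall>t. t0 < t \<and> t < 2 * t0 \<longrightarrow> E u t \<and> F u \<le> B * G t) \<Longrightarrow>
      (\<And>t. 0 < t \<Longrightarrow> \<exists>u1>0. \<forall>u>0. E u t \<longrightarrow> dil u u1 \<le> R) \<Longrightarrow>
      haar_norm q F \<le> D * haar_norm q G"
  using assms(1)
proof (cases q rule: exponent_cases)
  case 1
  obtain C where C: "C < \<infinity>"
    "\<And>t x h. 0 < t \<Longrightarrow> (\<And>u. t < u \<Longrightarrow> u < 2 * t \<Longrightarrow> x \<le> h u) \<Longrightarrow> x \<le> C * haar_norm q h"
    using haar_norm_ge_dyadic[OF assms(1)] by blast
  show ?thesis
  proof (rule that)
    show "C * B < \<infinity>" using C assms by (auto simp: ennreal_mult_less_top)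
    fix E :: "real \<Rightarrow> real \<Rightarrow> bool" and F G :: "real \<Rightarrow> ennreal"
    assume G: "G \<in> borel_measurable borel"
      and *: "\<And>u. 0 < u \<Longrightarrow> \<exists>t0>0. \<forall>t. t0 < t \<and> t < 2 * t0 \<longrightarrow> E u t \<and> F u \<le> B * G t"
    have "F u \<le> C * haar_norm q (\<lambda>t. B * G t)" if u: "0 < u" for u
    proof -
      from *[OF u] obtain t0 where t0: "0 < t0" "\<And>t. t0 < t \<Longrightarrow> t < 2 * t0 \<Longrightarrow> F u \<le> B * G t" by blast
      show ?thesis using t0(2) by (rule C(2)[OF t0(1)])
    qed
    then have "F u \<le> C * B * haar_norm q G" if "0 < u" for u
      using that haar_norm_cmult[OF assms(1) pos_meas_borel[OF G], of B] by (simp add: mult.assoc)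
    then show "haar_norm q F \<le> C * B * haar_norm q G"
      unfolding 1 by (intro haar_norm_top_le) (auto intro: eventually_mono[OF AE_pos_neq[of 0]])
  qed
next
  case (2 p)
  let ?C = "2 * epowr B p" and ?D = "ennreal (R\<^sup>2)"
  show ?thesis
  proof (rule that)
    show "epowr (?C * ?D) (1 / p) < \<infinity>"
      using assms epowr_less_top[of B p] by (intro epowr_less_top) (auto simp: ennreal_mult_less_top)
    fix E :: "real \<Rightarrow> real \<Rightarrow> bool" and F G :: "real \<Rightarrow> ennreal"
    assume E [measurable]: "Measurable.pred (borel \<Otimes>\<^sub>M borel) (case_prod E)"
      and G [measurable]: "G \<in> borel_measurable borel"
      and lower: "\<And>u. 0 < u \<Longrightarrow> \<exists>t0>0. \<forall>t. t0 < t \<and> t < 2 * t0 \<longrightarrow> E u t \<and> F u \<le> B * G t"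
      and upper: "\<And>t. 0 < t \<Longrightarrow> \<exists>u1>0. \<forall>u>0. E u t \<longrightarrow> dil u u1 \<le> R"
    define k :: "real \<Rightarrow> real \<Rightarrow> ennreal" where "k u t = (if E u t then 1 else 0)" for u t
    have k: "case_prod k = (\<lambda>x. if case_prod E x then 1 else 0)"
      by (auto simp: k_def)
    have [measurable]: "k u \<in> borel_measurable borel" for u
    proof -
      have "(\<lambda>t. if case_prod E (u, t) then 1 else 0 :: ennreal) \<in> borel_measurable borel" by measurable
      then show ?thesis by (simp add: k_def[abs_def])
    qed
    show "haar_norm q F \<le> epowr (?C * ?D) (1 / p) * haar_norm q G"
      unfolding \<open>q = ennreal p\<close>
    proof (rule haar_norm_schur[OF \<open>0 < p\<close>, where k = k])
      show "case_prod k \<in> borel_measurable (borel \<Otimes>\<^sub>M borel)" unfolding k by measurable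
    next
      fix u :: real assume "0 < u"
      from lower[OF this] obtain t0 where t0: "0 < t0"
        "\<And>t. t0 < t \<Longrightarrow> t < 2 * t0 \<Longrightarrow> E u t \<and> F u \<le> B * G t" by blast
      have "epowr (F u) p \<le> 2 * haar_integral (\<lambda>t. epowr B p * (k u t * epowr (G t) p))"
      proof (rule haar_integral_ge_dyadic[OF t0(1)])
        fix t assume "t0 < t" "t < 2 * t0"
        then have "E u t" "F u \<le> B * G t" using t0 by auto
        then have "epowr (F u) p \<le> epowr (B * G t) p" using 2 by (intro epowr_mono) auto
        then show "epowr (F u) p \<le> epowr B p * (k u t * epowr (G t) p)"
          using \<open>E u t\<close> 2 by (simp add: k_def epowr_mult)
      qed
      also have "\<dots> = ?C * haar_integral (\<lambda>t. k u t * epowr (G t) p)"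
        by (subst haar_integral_cmult) (auto intro!: pos_meas_borel simp: mult.assoc)
      finally show "epowr (F u) p \<le> ?C * haar_integral (\<lambda>t. k u t * epowr (G t) p)" .
    next
      fix t :: real assume "0 < t"
      from upper[OF this] obtain u1 where u1: "0 < u1" "\<And>u. 0 < u \<Longrightarrow> E u t \<Longrightarrow> dil u u1 \<le> R" by blast
      have "haar_integral (\<lambda>u. k u t) \<le> haar_integral (indicator {u1 / R..R * u1})"
      proof (rule haar_integral_mono)
        fix u :: real assume "0 < u"
        then show "k u t \<le> indicator {u1 / R..R * u1} u"
          using u1(1) u1(2)[of u] assms(3) by (auto simp: k_def indicator_def dil_le_iff field_simps)
      qed
      also have "\<dots> \<le> ennreal ((R * u1 - u1 / R) / (u1 / R))"
      proof (rule haar_integral_interval_le)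
        show "0 < u1 / R" using u1(1) assms(3) by simp
        have "u1 / R \<le> u1 / 1" using u1(1) assms(3) by (intro divide_left_mono) auto
        also have "\<dots> \<le> R * u1" using u1(1) assms(3) by simp
        finally show "u1 / R \<le> R * u1" .
      qed
      also have "(R * u1 - u1 / R) / (u1 / R) = R\<^sup>2 - 1"
        using u1(1) assms(3) by (simp add: divide_simps power2_eq_square) (simp add: algebra_simps)
      also have "ennreal (R\<^sup>2 - 1) \<le> ?D" by (intro ennreal_leI) simp
      finally show "haar_integral (\<lambda>u. k u t) \<le> ?D" .
    qed measurable
  qed
qed

text \<open>
  Growth of \<open>t / \<chi>(t)\<close> for an increasing slowly varying \<open>\<chi>\<close>: at most linear and, up to a constant,
  at least like a square root.
\<close>

locale sublinear_growth =
  fixes \<rho> :: "real \<Rightarrow> real" and L :: real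
  assumes pos: "\<And>t. 0 < t \<Longrightarrow> 0 < \<rho> t"
    and up: "\<And>s t. 0 < s \<Longrightarrow> s \<le> t \<Longrightarrow> \<rho> t \<le> t / s * \<rho> s"
    and lo: "\<And>s t. 0 < s \<Longrightarrow> s \<le> t \<Longrightarrow> sqrt (t / s) * \<rho> s \<le> L * \<rho> t"
    and L: "1 \<le> L"
begin

lemma dil_up:
  assumes st: "0 < s" "0 < t"
  shows "dil (\<rho> s) (\<rho> t) \<le> L * dil s t"
proof -
  have *: "dil (\<rho> s) (\<rho> t) \<le> L * dil s t" if st: "0 < s" "s \<le> t" for s t
  proof -
    have "1 \<le> t / s" using st by auto
    have "1 * \<rho> s \<le> sqrt (t / s) * \<rho> s" using \<open>1 \<le> t / s\<close> pos[of s] st by (intro mult_right_mono) auto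
    then have a: "\<rho> s \<le> L * \<rho> t" using lo[OF st] by linarith
    have "L * \<rho> t \<le> L * (t / s) * \<rho> t"
      using mult_left_mono[OF \<open>1 \<le> t / s\<close>, of "L * \<rho> t"] L pos[of t] st by (simp add: ac_simps)
    moreover have "t / s * \<rho> s \<le> L * (t / s) * \<rho> s"
      using mult_right_mono[OF L, of "t / s * \<rho> s"] pos[of s] st by (simp add: ac_simps)
    ultimately show ?thesis using a up[OF st] pos[of s] pos[of t] st
      by (subst dil_le_iff) (auto simp: dil_le)
  qed
  show ?thesis
    using *[of s t] *[of t s] st dil_commute[of s t] dil_commute[of "\<rho> s" "\<rho> t"]
    by (metis linorder_linear)
qed

lemma tempered_comp:
  assumes F: "tempered p A F" "0 \<le> p"
  shows "tempered p (A * ennreal (L powr p)) (\<lambda>t. F (\<rho> t))"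
  unfolding tempered_def
proof (intro allI impI)
  fix s t :: real assume st: "0 < s" "0 < t"
  then have "F (\<rho> s) \<le> A * ennreal ((L * dil s t) powr p) * F (\<rho> t)"
    using F dil_up pos by (intro tempered_near) auto
  then show "F (\<rho> s) \<le> A * ennreal (L powr p) * ennreal (dil s t powr p) * F (\<rho> t)"
    using L dil_ge_1[OF st] by (simp add: powr_mult ennreal_mult mult.assoc)
qed
text \<open>
  Pair \<open>u\<close> with \<open>t\<close> if \<open>u\<close> and \<open>\<rho>(t)\<close> differ by a bounded factor. Every \<open>u\<close> is within a factor 2 of
  some \<open>\<rho>(t)\<close>, because \<open>\<rho>(2\<^sup>n s)\<close> passes from below \<open>u\<close> to above \<open>u\<close> and at most doubles in each
  step; and the points \<open>t\<close> with \<open>\<rho>(t)\<close> near a given \<open>u\<close> are close to one another by the lower growth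
  bound. So the comparison lemma applies in both directions.
\<close>

lemma haar_norm_change_of_variables:
  assumes "0 < q" "0 \<le> p" "A < \<infinity>"
    and meas: "\<rho> \<in> borel_measurable (restrict_space borel {0<..})"
  obtains D where "D < \<infinity>"
    "\<And>F. tempered p A F \<Longrightarrow> haar_norm q F \<le> D * haar_norm q (\<lambda>t. F (\<rho> t))"
    "\<And>F. tempered p A F \<Longrightarrow> haar_norm q (\<lambda>t. F (\<rho> t)) \<le> D * haar_norm q F"
proof -
  have dil_lo: "dil s t \<le> (L * dil (\<rho> s) (\<rho> t))\<^sup>2" if st: "0 < s" "0 < t" for s t
  proof -
    have *: "dil s t \<le> (L * dil (\<rho> s) (\<rho> t))\<^sup>2" if st: "0 < s" "s \<le> t" for s t
    proof -
      have "sqrt (t / s) \<le> L * (\<rho> t / \<rho> s)" using lo[OF st] pos[of s] st by (simp add: field_simps)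
      also have "\<dots> \<le> L * dil (\<rho> s) (\<rho> t)" using L by (intro mult_left_mono) (auto simp: dil_def)
      finally have "(sqrt (t / s))\<^sup>2 \<le> (L * dil (\<rho> s) (\<rho> t))\<^sup>2"
        using st by (intro power_mono) auto
      then show ?thesis using st by (simp add: dil_le)
    qed
    show ?thesis
      using *[of s t] *[of t s] st dil_commute[of s t] dil_commute[of "\<rho> s" "\<rho> t"]
      by (metis linorder_linear)
  qed
  have onto: "\<exists>t>0. dil u (\<rho> t) \<le> 2" if u: "0 < u" for u
  proof -
    \<comment> \<open>\<open>s = x\<^sup>2\<close> is so small that the lower growth bound between \<open>s\<close> and 1 gives \<open>\<rho> s \<le> u\<close>\<close>
    define x where "x = min 1 (u / (L * \<rho> 1))"
    have x: "0 < x" "x \<le> 1" using u L pos[of 1] by (auto simp: x_def)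
    have "L * \<rho> 1 * x \<le> u" using u L pos[of 1] by (auto simp: x_def min_def field_simps)
    define s where "s = x\<^sup>2"
    have s: "0 < s" "s \<le> 1" using x by (auto simp: s_def power_le_one)
    have "\<rho> s \<le> L * \<rho> 1 * x"
      using lo[OF s] x by (simp add: s_def real_sqrt_divide field_simps)
    then have s_le: "\<rho> s \<le> u" using \<open>L * \<rho> 1 * x \<le> u\<close> by linarith
    have "\<exists>n::nat. u < \<rho> (2 ^ n * s)"
    proof -
      obtain n :: nat where "L * u / \<rho> s < 2 ^ n" using real_arch_pow[of 2] by auto
      then have n: "L * u < 2 ^ n * \<rho> s" using pos[OF s(1)] by (simp add: field_simps)
      \<comment> \<open>\<open>2 n\<close> doublings, since the lower growth bound takes a square root\<close>
      have "s \<le> 2 ^ (2 * n) * s" using s by simp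
      from lo[OF s(1) this] have "2 ^ n * \<rho> s \<le> L * \<rho> (2 ^ (2 * n) * s)"
        using s by (simp add: power_mult power2_eq_square[symmetric] real_sqrt_power[symmetric] mult.commute[of 2 n])
      with n have "L * u < L * \<rho> (2 ^ (2 * n) * s)" by linarith
      then show ?thesis using L by auto
    qed
    then obtain n where n: "u < \<rho> (2 ^ n * s)" "\<And>m. m < n \<Longrightarrow> \<rho> (2 ^ m * s) \<le> u"
      using exists_least_iff[of "\<lambda>n. u < \<rho> (2 ^ n * s)"] by (auto simp: not_less)
    have "n \<noteq> 0" using n(1) s_le by (metis leD mult_1 power_0)
    then obtain m where m: "n = Suc m" by (cases n) auto
    define t where "t = 2 ^ m * s"
    have "0 < t" using s by (simp add: t_def)
    have "\<rho> t \<le> u" using n(2)[of m] m by (simp add: t_def)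
    moreover have "u \<le> 2 * \<rho> t"
      using n(1) up[of t "2 * t"] \<open>0 < t\<close> s(1) m by (simp add: t_def mult.assoc)
    ultimately show ?thesis using \<open>0 < t\<close> pos[of t] u by (auto simp: dil_le_iff intro!: exI[of _ t])
  qed
  \<comment> \<open>a Borel function on the whole line, as Tonelli requires\<close>
  define \<rho>' where "\<rho>' t = (if t \<in> {0<..} then \<rho> t else 1)" for t
  have [measurable]: "\<rho>' \<in> borel_measurable borel"
    unfolding \<rho>'_def[abs_def] using meas by (subst measurable_If_restrict_space_iff) (auto simp: greaterThan_def)
  have \<rho>': "\<rho>' t = \<rho> t" if "0 < t" for t using that by (simp add: \<rho>'_def)

  have A': "A * ennreal (L powr p) < \<infinity>" using assms by (simp add: ennreal_mult_less_top)
  obtain D1 where D1: "D1 < \<infinity>"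
    "\<And>h. tempered p A h \<Longrightarrow> haar_norm q (step h) \<le> D1 * haar_norm q h"
    using tempered_norm_step[OF assms(1-3)] by metis
  obtain D2 where D2: "D2 < \<infinity>"
    "\<And>h. tempered p (A * ennreal (L powr p)) h \<Longrightarrow> haar_norm q (step h) \<le> D2 * haar_norm q h"
    using tempered_norm_step[OF assms(1,2) A'] by metis

  let ?M = "4 * L"
  let ?B1 = "A * ennreal (?M powr p) * (A * ennreal (L powr p) * ennreal (2 powr p))"
  let ?B2 = "A * ennreal (2 powr p) * (A * ennreal (2 powr p))"
  let ?R1 = "?M" and ?R2 = "(L * 4)\<^sup>2"
  have B: "?B1 < \<infinity>" "?B2 < \<infinity>" using assms by (auto simp: ennreal_mult_less_top)
  have R: "1 \<le> ?R1" "1 \<le> ?R2" using L one_le_power[of "L * 4" 2] by auto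
  obtain D3 where D3: "D3 < \<infinity>"
    "\<And>E F G. Measurable.pred (borel \<Otimes>\<^sub>M borel) (case_prod E) \<Longrightarrow> G \<in> borel_measurable borel \<Longrightarrow>
      (\<And>u. 0 < u \<Longrightarrow> \<exists>t0>0. \<forall>t. t0 < t \<and> t < 2 * t0 \<longrightarrow> E u t \<and> F u \<le> ?B1 * G t) \<Longrightarrow>
      (\<And>t. 0 < t \<Longrightarrow> \<exists>u1>0. \<forall>u>0. E u t \<longrightarrow> dil u u1 \<le> ?R1) \<Longrightarrow>
      haar_norm q F \<le> D3 * haar_norm q G"
    using haar_norm_comparison[OF assms(1) B(1) R(1)] by blast
  obtain D4 where D4: "D4 < \<infinity>"
    "\<And>E F G. Measurable.pred (borel \<Otimes>\<^sub>M borel) (case_prod E) \<Longrightarrow> G \<in> borel_measurable borel \<Longrightarrow>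
      (\<And>u. 0 < u \<Longrightarrow> \<exists>t0>0. \<forall>t. t0 < t \<and> t < 2 * t0 \<longrightarrow> E u t \<and> F u \<le> ?B2 * G t) \<Longrightarrow>
      (\<And>t. 0 < t \<Longrightarrow> \<exists>u1>0. \<forall>u>0. E u t \<longrightarrow> dil u u1 \<le> ?R2) \<Longrightarrow>
      haar_norm q F \<le> D4 * haar_norm q G"
    using haar_norm_comparison[OF assms(1) B(2) R(2)] by blast

  have 1: "haar_norm q F \<le> D3 * D2 * haar_norm q (\<lambda>t. F (\<rho> t))" if F: "tempered p A F" for F
  proof -
    have "haar_norm q F \<le> D3 * haar_norm q (step (\<lambda>t. F (\<rho> t)))"
    proof (rule D3(2)[where E = "\<lambda>u t. dil u (\<rho>' t) \<le> ?M"])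
      show "Measurable.pred (borel \<Otimes>\<^sub>M borel) (\<lambda>(u, t). dil u (\<rho>' t) \<le> ?M)"
        unfolding dil_def by measurable
    next
      fix u :: real assume u: "0 < u"
      from onto[OF this] obtain t0 where t0: "0 < t0" "dil u (\<rho> t0) \<le> 2" by blast
      have "dil u (\<rho>' t) \<le> ?M \<and> F u \<le> ?B1 * step (\<lambda>t. F (\<rho> t)) t" if t: "t0 < t" "t < 2 * t0" for t
      proof -
        have "0 < t" using t t0 by linarith
        have "dil u (\<rho> t) \<le> dil u (\<rho> t0) * dil (\<rho> t0) (\<rho> t)"
          using u t0 \<open>0 < t\<close> pos by (intro dil_triangle) auto
        also have "\<dots> \<le> 2 * (L * dil t0 t)"
          using t0 u dil_up[OF t0(1) \<open>0 < t\<close>] pos[of t0] pos[of t] \<open>0 < t\<close> dil_ge_1[of "\<rho> t0" "\<rho> t"]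
          by (intro mult_mono) auto
        also have "dil t0 t \<le> 2" using t t0 by (auto simp: dil_le_iff)
        finally have d: "dil u (\<rho> t) \<le> ?M" using L by simp
        have "F u \<le> A * ennreal (?M powr p) * F (\<rho> t)"
          using F assms(2) u pos[OF \<open>0 < t\<close>] d by (rule tempered_near)
        also have "\<dots> \<le> A * ennreal (?M powr p) * (A * ennreal (L powr p) * ennreal (2 powr p) * step (\<lambda>t. F (\<rho> t)) t)"
          using tempered_step(1)[OF tempered_comp[OF F assms(2)] assms(2) \<open>0 < t\<close>] by (intro mult_left_mono) auto
        finally show ?thesis using d \<open>0 < t\<close> by (simp add: \<rho>' mult.assoc)
      qed
      with t0 show "\<exists>t0>0. \<forall>t. t0 < t \<and> t < 2 * t0 \<longrightarrow> dil u (\<rho>' t) \<le> ?M \<and> F u \<le> ?B1 * step (\<lambda>t. F (\<rho> t)) t"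
        by blast
    next
      fix t :: real assume "0 < t"
      then show "\<exists>u1>0. \<forall>u>0. dil u (\<rho>' t) \<le> ?M \<longrightarrow> dil u u1 \<le> ?M"
        using pos \<rho>' by (intro exI[of _ "\<rho> t"]) auto
    qed simp
    also have "\<dots> \<le> D3 * (D2 * haar_norm q (\<lambda>t. F (\<rho> t)))"
      using D2(2)[OF tempered_comp[OF F assms(2)]] by (intro mult_left_mono) auto
    finally show ?thesis by (simp add: mult.assoc)
  qed
  have 2: "haar_norm q (\<lambda>t. F (\<rho> t)) \<le> D4 * D1 * haar_norm q F" if F: "tempered p A F" for F
  proof -
    have "haar_norm q (\<lambda>t. F (\<rho> t)) \<le> D4 * haar_norm q (step F)"
    proof (rule D4(2)[where E = "\<lambda>t u. dil u (\<rho>' t) \<le> 2"])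
      show "Measurable.pred (borel \<Otimes>\<^sub>M borel) (\<lambda>(t, u). dil u (\<rho>' t) \<le> 2)"
        unfolding dil_def by measurable
    next
      fix t :: real assume t: "0 < t"
      have "dil u (\<rho>' t) \<le> 2 \<and> F (\<rho> t) \<le> ?B2 * step F u" if u: "\<rho> t < u" "u < 2 * \<rho> t" for u
      proof -
        have "0 < u" using u pos[OF t] by linarith
        have d: "dil u (\<rho> t) \<le> 2" using u \<open>0 < u\<close> pos[OF t] by (auto simp: dil_le_iff)
        then have "F (\<rho> t) \<le> A * ennreal (2 powr p) * F u"
          using F assms(2) \<open>0 < u\<close> pos[OF t] by (intro tempered_near) (auto simp: dil_commute)
        also have "\<dots> \<le> A * ennreal (2 powr p) * (A * ennreal (2 powr p) * step F u)"
          using tempered_step(1)[OF F assms(2) \<open>0 < u\<close>] by (intro mult_left_mono) auto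
        finally show ?thesis using d t by (simp add: \<rho>' mult.assoc)
      qed
      then show "\<exists>u0>0. \<forall>u. u0 < u \<and> u < 2 * u0 \<longrightarrow> dil u (\<rho>' t) \<le> 2 \<and> F (\<rho> t) \<le> ?B2 * step F u"
        using pos[OF t] by blast
    next
      fix u :: real assume u: "0 < u"
      show "\<exists>t1>0. \<forall>t>0. dil u (\<rho>' t) \<le> 2 \<longrightarrow> dil t t1 \<le> ?R2"
      proof (cases "\<exists>t1>0. dil u (\<rho> t1) \<le> 2")
        case True
        then obtain t1 where t1: "0 < t1" "dil u (\<rho> t1) \<le> 2" by blast
        have "dil t t1 \<le> ?R2" if t: "0 < t" "dil u (\<rho> t) \<le> 2" for t
        proof -
          have "dil (\<rho> t) (\<rho> t1) \<le> dil (\<rho> t) u * dil u (\<rho> t1)"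
            using u t t1 pos by (intro dil_triangle) auto
          also have "\<dots> \<le> 2 * 2"
            using u t t1 dil_ge_1[of u "\<rho> t1"] pos[of t1] by (intro mult_mono) (auto simp: dil_commute[of "\<rho> t"])
          finally have "(L * dil (\<rho> t) (\<rho> t1))\<^sup>2 \<le> ?R2"
            using L dil_ge_1[of "\<rho> t" "\<rho> t1"] pos t(1) t1(1) by (intro power_mono mult_left_mono) auto
          then show ?thesis using dil_lo[OF t(1) t1(1)] by linarith
        qed
        then show ?thesis using t1 \<rho>' by auto
      next
        case False
        then show ?thesis using \<rho>' by (intro exI[of _ 1]) auto
      qed
    qed simp
    also have "\<dots> \<le> D4 * (D1 * haar_norm q F)"
      using D1(2)[OF F] by (intro mult_left_mono) auto
    finally show ?thesis by (simp add: mult.assoc)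
  qed
  let ?D = "max (D3 * D2) (D4 * D1)"
  have "?D < \<infinity>" using D1 D2 D3 D4 by (auto simp: ennreal_mult_less_top)
  moreover have "D3 * D2 * x \<le> ?D * x" "D4 * D1 * x \<le> ?D * x" for x
    by (intro mult_right_mono; simp)+
  ultimately show ?thesis using that[of ?D] 1 2 order.trans by meson
qed

end

text \<open>
  A tempered function at \<open>u\<close> is controlled by its average over \<open>(u, 2 u)\<close>. For finite \<open>q\<close> the power
  of the supremum is therefore at most an integral with the kernel \<open>(t / v) powr (e q)\<close> on \<open>t \<le> v\<close>,
  whose integral in \<open>t\<close> is bounded. For \<open>q = \<infinity>\<close> the norm already bounds every value of \<open>h\<close>.
\<close>

lemma haar_norm_hardy:
  assumes "0 < q" "0 \<le> p" "A < \<infinity>" "0 < e"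
  obtains D where "D < \<infinity>"
    "\<And>h. tempered p A h \<Longrightarrow>
      haar_norm q (\<lambda>t. SUP u\<in>{t..}. ennreal ((t / u) powr e) * h u) \<le> D * haar_norm q h"
  using assms(1)
proof (cases q rule: exponent_cases)
  case 1
  obtain D where D: "D < \<infinity>"
    "\<And>h t. tempered p A h \<Longrightarrow> 0 < t \<Longrightarrow> h t \<le> D * haar_norm q h"
    using tempered_le_norm[OF assms(1-3)] by blast
  have "haar_norm q (\<lambda>t. SUP u\<in>{t..}. ennreal ((t / u) powr e) * h u) \<le> D * haar_norm q h"
    if h: "tempered p A h" for h
  proof -
    have "(SUP u\<in>{t..}. ennreal ((t / u) powr e) * h u) \<le> D * haar_norm q h" if t: "0 < t" for t
    proof (rule SUP_least)
      fix u assume "u \<in> {t..}"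
      then have "(t / u) powr e \<le> 1" "0 < u" using t assms(4) by (auto intro!: powr_le1)
      then have "ennreal ((t / u) powr e) * h u \<le> 1 * h u" by (intro mult_right_mono) auto
      then show "ennreal ((t / u) powr e) * h u \<le> D * haar_norm q h"
        using D(2)[OF h \<open>0 < u\<close>] by auto
    qed
    then show ?thesis
      unfolding 1 by (intro haar_norm_top_le) (auto intro: eventually_mono[OF AE_pos_neq[of 0]])
  qed
  then show ?thesis using that D(1) by blast
next
  case (2 r)
  obtain D1 where D1: "D1 < \<infinity>" "\<And>h. tempered p A h \<Longrightarrow> haar_norm q (step h) \<le> D1 * haar_norm q h"
    using tempered_norm_step[OF assms(1-3)] by metis
  let ?B = "A * ennreal (2 powr p) * ennreal (2 powr e) * (A * ennreal (2 powr p))"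
  let ?C = "2 * epowr ?B r" and ?D = "ennreal (1 / (e * r))"
  define k :: "real \<Rightarrow> real \<Rightarrow> ennreal" where
    "k t u = (if t \<le> u then ennreal ((t / u) powr (e * r)) else 0)" for t u
  have [measurable]: "case_prod k \<in> borel_measurable (borel \<Otimes>\<^sub>M borel)"
    unfolding k_def[abs_def] by measurable
  have [measurable]: "k t \<in> borel_measurable borel" for t
    unfolding k_def[abs_def] by measurable
  have "?B < \<infinity>" using assms by (auto simp: ennreal_mult_less_top)
  then have fin: "epowr (?C * ?D) (1 / r) < \<infinity>"
    using epowr_less_top[of ?B r] by (intro epowr_less_top) (auto simp: ennreal_mult_less_top)
  have main: "haar_norm q (\<lambda>t. SUP u\<in>{t..}. ennreal ((t / u) powr e) * h u) \<le>
      epowr (?C * ?D) (1 / r) * haar_norm q (step h)" if h: "tempered p A h" for h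
    unfolding \<open>q = ennreal r\<close>
  proof (rule haar_norm_schur[OF \<open>0 < r\<close>, where k = k])
    fix t :: real assume t: "0 < t"
    let ?X = "?C * haar_integral (\<lambda>u. k t u * epowr (step h u) r)"
    have "(SUP u\<in>{t..}. ennreal ((t / u) powr e) * h u) \<le> epowr ?X (1 / r)"
    proof (rule SUP_least)
      fix u assume "u \<in> {t..}"
      then have u: "t \<le> u" "0 < u" using t by auto
      have "epowr (ennreal ((t / u) powr e) * h u) r \<le> 2 * haar_integral (\<lambda>u. epowr ?B r * (k t u * epowr (step h u) r))"
      proof (rule haar_integral_ge_dyadic[OF u(2)])
        fix v assume v: "u < v" "v < 2 * u"
        have "0 < v" using u v by linarith
        have "h u \<le> A * ennreal (2 powr p) * h v"
          using h assms(2) u v by (intro tempered_near) (auto simp: dil_le_iff)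
        also have "\<dots> \<le> A * ennreal (2 powr p) * (A * ennreal (2 powr p) * step h v)"
          using tempered_step(1)[OF h assms(2) \<open>0 < v\<close>] by (intro mult_left_mono) auto
        finally have hu: "h u \<le> A * ennreal (2 powr p) * (A * ennreal (2 powr p) * step h v)" .
        have "(t / u) powr e \<le> (2 * (t / v)) powr e"
          using u v t assms(4) by (intro powr_mono2) (auto simp: field_simps)
        also have "\<dots> = 2 powr e * (t / v) powr e" using t \<open>0 < v\<close> by (intro powr_mult)
        finally have "ennreal ((t / u) powr e) \<le> ennreal (2 powr e) * ennreal ((t / v) powr e)"
          by (simp add: ennreal_leI flip: ennreal_mult)
        then have "ennreal ((t / u) powr e) * h u \<le> (ennreal (2 powr e) * ennreal ((t / v) powr e)) *
          (A * ennreal (2 powr p) * (A * ennreal (2 powr p) * step h v))"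
          using hu by (rule mult_mono) auto
        also have "\<dots> = ?B * (ennreal ((t / v) powr e) * step h v)" by (simp add: ac_simps)
        finally have "epowr (ennreal ((t / u) powr e) * h u) r \<le> epowr (?B * (ennreal ((t / v) powr e) * step h v)) r"
          using 2 by (intro epowr_mono) auto
        also have "\<dots> = epowr ?B r * (k t v * epowr (step h v) r)"
          unfolding k_def using 2 u v by (simp only: epowr_mult) (simp add: epowr_ennreal powr_powr)
        finally show "epowr (ennreal ((t / u) powr e) * h u) r \<le> epowr ?B r * (k t v * epowr (step h v) r)" .
      qed
      also have "\<dots> = ?X"
        by (subst haar_integral_cmult) (auto intro!: pos_meas_borel simp: mult.assoc)
      finally have "epowr (epowr (ennreal ((t / u) powr e) * h u) r) (1 / r) \<le> epowr ?X (1 / r)"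
        using 2 by (intro epowr_mono) auto
      then show "ennreal ((t / u) powr e) * h u \<le> epowr ?X (1 / r)"
        using 2 by (simp add: epowr_epowr epowr_one)
    qed
    then have "epowr (SUP u\<in>{t..}. ennreal ((t / u) powr e) * h u) r \<le> epowr (epowr ?X (1 / r)) r"
      using 2 by (intro epowr_mono) auto
    then show "epowr (SUP u\<in>{t..}. ennreal ((t / u) powr e) * h u) r \<le> ?X"
      using 2 by (simp add: epowr_epowr epowr_one)
  next
    fix u :: real assume u: "0 < u"
    have "haar_integral (\<lambda>t. k t u) \<le> haar_integral (\<lambda>t. indicator {..u} t * ennreal ((t / u) powr (e * r)))"
      by (rule haar_integral_mono) (auto simp: k_def)
    also have "\<dots> \<le> ?D"
      using u assms(4) 2 by (intro haar_integral_head) auto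
    finally show "haar_integral (\<lambda>t. k t u) \<le> ?D" .
  qed measurable
  have "haar_norm q (\<lambda>t. SUP u\<in>{t..}. ennreal ((t / u) powr e) * h u) \<le>
      epowr (?C * ?D) (1 / r) * D1 * haar_norm q h" if h: "tempered p A h" for h
    using order.trans[OF main[OF h] mult_left_mono[OF D1(2)[OF h]]] by (simp add: mult.assoc)
  moreover have "epowr (?C * ?D) (1 / r) * D1 < \<infinity>" using fin D1 by (auto simp: ennreal_mult_less_top)
  ultimately show ?thesis using that by blast
qed

text \<open>
  The quasi-triangle inequality for a weight that may be non-measurable: \<open>w\<close> is exchanged for
  \<open>step w\<close>, and back at the end.
\<close>

lemma haar_norm_weighted_add:
  assumes "0 < q" "0 \<le> p" "A < \<infinity>" "tempered p A w"
  obtains D where "D < \<infinity>"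
    "\<And>C g h h'. pos_meas h \<Longrightarrow> pos_meas h' \<Longrightarrow> (\<And>t. 0 < t \<Longrightarrow> g t \<le> C * (h t + h' t)) \<Longrightarrow>
      haar_norm q (\<lambda>t. w t * g t) \<le> C * D * (haar_norm q (\<lambda>t. w t * h t) + haar_norm q (\<lambda>t. w t * h' t))"
proof -
  obtain C0 where C0: "C0 < \<infinity>" "\<And>g h. pos_meas g \<Longrightarrow> pos_meas h \<Longrightarrow>
      haar_norm q (\<lambda>u. g u + h u) \<le> C0 * (haar_norm q g + haar_norm q h)"
    using haar_norm_add[OF assms(1)] by metis
  \<comment> \<open>the summand 1 makes the constant invertible\<close>
  define a where "a = A * ennreal (2 powr p) + 1"
  have a: "a < \<infinity>" "a \<noteq> 0" using assms by (auto simp: ennreal_mult_less_top a_def)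
  have le_a: "A * ennreal (2 powr p) * x \<le> a * x" for x unfolding a_def by (intro mult_right_mono) auto
  have w: "w u \<le> a * step w u" "step w u \<le> a * w u" if "0 < u" for u
    using tempered_step[OF assms(4,2) that] le_a order.trans by blast+
  have step_le: "haar_norm q (\<lambda>t. step w t * h t) \<le> a * haar_norm q (\<lambda>t. w t * h t)" if h: "pos_meas h" for h
  proof -
    have "inverse a * haar_norm q (\<lambda>t. step w t * h t) = haar_norm q (\<lambda>t. inverse a * (step w t * h t))"
      by (intro haar_norm_cmult[symmetric] assms borel_measurable_times_ennreal pos_meas_borel step_measurable h)
    also have "\<dots> \<le> haar_norm q (\<lambda>t. w t * h t)"
    proof (rule haar_norm_mono[OF assms(1)])
      fix u :: real assume "0 < u"
      have "inverse a * step w u \<le> inverse a * (a * w u)" using w(2)[OF \<open>0 < u\<close>] by (rule mult_left_mono) simp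
      then have "inverse a * step w u \<le> w u" by (simp only: ennreal_inverse_cancel(1)[OF a])
      then have "inverse a * step w u * h u \<le> w u * h u" by (rule mult_right_mono) simp
      then show "inverse a * (step w u * h u) \<le> w u * h u" by (simp only: mult.assoc)
    qed
    finally have "a * (inverse a * haar_norm q (\<lambda>t. step w t * h t)) \<le> a * haar_norm q (\<lambda>t. w t * h t)"
      by (rule mult_left_mono) simp
    then show ?thesis by (simp only: ennreal_inverse_cancel(2)[OF a])
  qed
  have main: "haar_norm q (\<lambda>t. w t * g t) \<le>
      C * (a * C0 * a) * (haar_norm q (\<lambda>t. w t * h t) + haar_norm q (\<lambda>t. w t * h' t))"
    if h: "pos_meas h" "pos_meas h'" and g: "\<And>t. 0 < t \<Longrightarrow> g t \<le> C * (h t + h' t)" for C g h h'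
  proof -
    have m: "pos_meas (\<lambda>t. step w t * h t)" "pos_meas (\<lambda>t. step w t * h' t)"
      by (intro borel_measurable_times_ennreal pos_meas_borel step_measurable h)+
    have "haar_norm q (\<lambda>t. w t * g t) \<le> haar_norm q (\<lambda>t. (C * a) * (step w t * h t + step w t * h' t))"
    proof (rule haar_norm_mono[OF assms(1)])
      fix t :: real assume t: "0 < t"
      have "w t * g t \<le> (a * step w t) * (C * (h t + h' t))"
        using w(1)[OF t] g[OF t] by (rule mult_mono) auto
      also have "\<dots> = (C * a) * (step w t * h t + step w t * h' t)" by (simp add: distrib_left ac_simps)
      finally show "w t * g t \<le> (C * a) * (step w t * h t + step w t * h' t)" .
    qed
    also have "\<dots> = (C * a) * haar_norm q (\<lambda>t. step w t * h t + step w t * h' t)"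
      by (intro haar_norm_cmult assms borel_measurable_add m)
    also have "\<dots> \<le> (C * a) * (C0 * (haar_norm q (\<lambda>t. step w t * h t) + haar_norm q (\<lambda>t. step w t * h' t)))"
      by (intro mult_left_mono C0(2) m) auto
    also have "\<dots> \<le> (C * a) * (C0 * (a * haar_norm q (\<lambda>t. w t * h t) + a * haar_norm q (\<lambda>t. w t * h' t)))"
      using step_le h by (intro mult_left_mono add_mono) auto
    finally show ?thesis by (simp add: distrib_left ac_simps)
  qed
  have fin: "a * C0 * a < \<infinity>" using a C0(1) by (auto simp: ennreal_mult_less_top)
  show ?thesis by (rule that[OF fin]) (rule main)
qed

lemma le_cmult_trans:
  fixes x y z c d :: ennreal
  shows "x \<le> c * y \<Longrightarrow> y \<le> d * z \<Longrightarrow> x \<le> c * d * z"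
  by (metis mult.assoc mult_left_mono order.trans zero_le)

lemma cmult_le_add:
  fixes x y z c d :: ennreal
  shows "x \<le> c * z \<Longrightarrow> y \<le> d * z \<Longrightarrow> x + y \<le> (c + d) * z"
  by (metis add_mono distrib_right)

section \<open>Slowly varying functions\<close>

text \<open>Slow variation as a family of Potter bounds, one for each positive exponent.\<close>

definition slow :: "(real \<Rightarrow> ennreal) \<Rightarrow> bool" where
  "slow b \<longleftrightarrow> (\<forall>t>0. 0 < b t \<and> b t < \<infinity>) \<and> (\<forall>e>0. \<exists>C<\<infinity>. tempered e C b)"

lemma SV_almost_monotone:
  assumes "b \<in> SV" "0 < e"
  shows "\<exists>g. (\<forall>t>0. g t > 0) \<and> mono_on {0<..} g \<and> equiv_pos (\<lambda>t. t powr e * b t) g"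
    and "\<exists>h. (\<forall>t>0. h t > 0) \<and> antimono_on {0<..} h \<and> equiv_pos (\<lambda>t. t powr (- e) * b t) h"
  using assms by (auto simp: SV_def)

text \<open>
  For \<open>s \<le> t\<close> the bound on \<open>b s\<close> comes from the almost increasing function \<open>t powr e * b t\<close>, for
  \<open>t < s\<close> from the almost decreasing \<open>t powr (- e) * b t\<close>.
\<close>

lemma SV_slow:
  assumes "b \<in> SV"
  shows "slow (\<lambda>u. ennreal (b u))"
  unfolding slow_def
proof (intro conjI allI impI)
  show "0 < ennreal (b t)" "ennreal (b t) < \<infinity>" if "0 < t" for t
    using assms that by (auto simp: SV_def)
  fix e :: real assume e: "0 < e"
  obtain g where g: "\<forall>t>0. 0 < g t" "mono_on {0<..} g" "equiv_pos (\<lambda>t. t powr e * b t) g"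
    using SV_almost_monotone(1)[OF assms e] by blast
  obtain C where C: "0 < C" "\<forall>t>0. g t / C \<le> t powr e * b t \<and> t powr e * b t \<le> C * g t"
    using g(3) unfolding equiv_pos_def by blast
  obtain h where h: "\<forall>t>0. 0 < h t" "antimono_on {0<..} h" "equiv_pos (\<lambda>t. t powr (- e) * b t) h"
    using SV_almost_monotone(2)[OF assms e] by blast
  obtain C' where C': "0 < C'" "\<forall>t>0. h t / C' \<le> t powr (- e) * b t \<and> t powr (- e) * b t \<le> C' * h t"
    using h(3) unfolding equiv_pos_def by blast
  have g': "g t \<le> C * (t powr e * b t)" if "0 < t" for t
    using C that by (simp add: field_simps)
  have h': "h t \<le> C' * (t powr (- e) * b t)" if "0 < t" for t
    using C' that by (simp add: field_simps)
  let ?D = "max (C * C) (C' * C')"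
  have "b s \<le> ?D * dil s t powr e * b t" if st: "0 < s" "0 < t" for s t
  proof (cases "s \<le> t")
    case True
    have "s powr e * b s \<le> C * g s" using C st by simp
    also have "\<dots> \<le> C * g t" using g(2) C(1) st True by (auto simp: monotone_on_def)
    also have "\<dots> \<le> C * (C * (t powr e * b t))" using C(1) g'[OF st(2)] by simp
    finally have "b s \<le> C * C * (t / s) powr e * b t"
      using st by (simp add: powr_divide field_simps)
    also have "\<dots> \<le> ?D * (t / s) powr e * b t"
      using assms st by (intro mult_right_mono) (auto simp: SV_def less_imp_le)
    finally show ?thesis using True st by (simp add: dil_le)
  next
    case False
    have "s powr (- e) * b s \<le> C' * h s" using C' st by simp
    also have "\<dots> \<le> C' * h t" using h(2) C'(1) st False by (auto simp: monotone_on_def)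
    also have "\<dots> \<le> C' * (C' * (t powr (- e) * b t))" using C'(1) h'[OF st(2)] by simp
    finally have "b s \<le> C' * C' * (s / t) powr e * b t"
      using st by (simp add: powr_divide powr_minus field_simps)
    also have "\<dots> \<le> ?D * (s / t) powr e * b t"
      using assms st by (intro mult_right_mono) (auto simp: SV_def less_imp_le)
    finally show ?thesis using False st by (simp add: dil_commute[of s t] dil_le)
  qed
  note le = this
  have "tempered e (ennreal ?D) (\<lambda>u. ennreal (b u))"
    unfolding tempered_def
  proof (intro allI impI)
    fix s t :: real assume "0 < s" "0 < t"
    from ennreal_leI[OF le[OF this]] show "ennreal (b s) \<le> ennreal ?D * ennreal (dil s t powr e) * ennreal (b t)"
      using C(1) by (simp only: ennreal_mult' le_max_iff_disj mult_nonneg_nonneg powr_ge_zero zero_le_mult_iff less_imp_le simp_thms)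
  qed
  then show "\<exists>C<\<infinity>. tempered e C (\<lambda>u. ennreal (b u))" by (intro exI conjI) simp_all
qed

lemma SV_pos_meas: "b \<in> SV \<Longrightarrow> pos_meas (\<lambda>u. ennreal (b u))"
  by (auto simp: SV_def)

lemma meas_ind: "S \<in> sets borel \<Longrightarrow> pos_meas h \<Longrightarrow> pos_meas (\<lambda>u. indicator S u * h u)"
  by (intro borel_measurable_times_ennreal pos_meas_indicator)

lemma slow_mult:
  assumes "slow b" "slow c"
  shows "slow (\<lambda>u. b u * c u)"
  unfolding slow_def
proof (intro conjI allI impI)
  show "0 < b t * c t" "b t * c t < \<infinity>" if "0 < t" for t
    using assms that by (auto simp: slow_def ennreal_zero_less_mult_iff ennreal_mult_less_top)
  fix e :: real assume "0 < e"
  then obtain C D where "C < \<infinity>" "tempered (e / 2) C b" "D < \<infinity>" "tempered (e / 2) D c"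
    using assms unfolding slow_def by (meson half_gt_zero)
  then have "C * D < \<infinity>" "tempered e (C * D) (\<lambda>u. b u * c u)"
    using tempered_mult[of "e / 2" C b "e / 2" D c] by (auto simp: ennreal_mult_less_top)
  then show "\<exists>C<\<infinity>. tempered e C (\<lambda>u. b u * c u)" by blast
qed

lemma slow_growth:
  assumes "slow b" "0 < e"
  obtains C where "C < \<infinity>" "\<And>s t. 0 < s \<Longrightarrow> s \<le> t \<Longrightarrow> b t \<le> C * (ennreal ((t / s) powr e) * b s)"
proof -
  obtain C where C: "C < \<infinity>" "tempered e C b" using assms by (auto simp: slow_def)
  have "b t \<le> C * (ennreal ((t / s) powr e) * b s)" if "0 < s" "s \<le> t" for s t
    using temperedD[OF C(2), of t s] that dil_commute[of t s] by (auto simp: dil_le mult.assoc)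
  then show ?thesis using that C by blast
qed

text \<open>
  Half of the exponent \<open>e\<close> absorbs the growth of \<open>b\<close>, and the other half keeps the norm finite.
\<close>

lemma slow_weighted_tail:
  assumes "slow b" "0 < q" "0 < e"
  obtains C where "C < \<infinity>"
    "\<And>t. 0 < t \<Longrightarrow> haar_norm q (\<lambda>u. indicator {t<..} u * (ennreal ((t / u) powr e) * b u)) \<le> C * b t"
proof -
  have e2: "0 < e / 2" using assms(3) by simp
  obtain C where C: "C < \<infinity>" "\<And>s t. 0 < s \<Longrightarrow> s \<le> t \<Longrightarrow> b t \<le> C * (ennreal ((t / s) powr (e / 2)) * b s)"
    using slow_growth[OF assms(1) e2] by metis
  obtain D where D: "D < \<infinity>"
    "\<And>t. 0 < t \<Longrightarrow> haar_norm q (\<lambda>u. indicator {t<..} u * ennreal ((t / u) powr (e / 2))) \<le> D"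
    using haar_norm_tail[OF assms(2) e2] by metis
  have "haar_norm q (\<lambda>u. indicator {t<..} u * (ennreal ((t / u) powr e) * b u)) \<le> C * D * b t"
    if t: "0 < t" for t
  proof -
    let ?f = "\<lambda>u. indicator {t<..} u * ennreal ((t / u) powr (e / 2))"
    have "haar_norm q (\<lambda>u. indicator {t<..} u * (ennreal ((t / u) powr e) * b u)) \<le> haar_norm q (\<lambda>u. C * b t * ?f u)"
    proof (rule haar_norm_mono[OF assms(2)])
      fix u :: real assume u: "0 < u"
      show "indicator {t<..} u * (ennreal ((t / u) powr e) * b u) \<le> C * b t * ?f u"
      proof (cases "t < u")
        case True
        have "(t / u) powr (e / 2) * (u / t) powr (e / 2) = 1"
          using t u by (simp flip: powr_mult)
        moreover have "(t / u) powr e = (t / u) powr (e / 2) * (t / u) powr (e / 2)"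
          by (simp flip: powr_add)
        ultimately have "(t / u) powr e * (u / t) powr (e / 2) = (t / u) powr (e / 2)"
          by (simp add: mult.assoc)
        then have eq: "ennreal ((t / u) powr e) * ennreal ((u / t) powr (e / 2)) = ennreal ((t / u) powr (e / 2))"
          by (simp flip: ennreal_mult)
        have "ennreal ((t / u) powr e) * b u \<le> ennreal ((t / u) powr e) * (C * (ennreal ((u / t) powr (e / 2)) * b t))"
          using C(2)[OF t, of u] True by (intro mult_left_mono) auto
        also have "\<dots> = C * b t * (ennreal ((t / u) powr e) * ennreal ((u / t) powr (e / 2)))" by (simp only: ac_simps)
        finally show ?thesis unfolding eq using True by simp
      qed simp
    qed
    also have "\<dots> = C * b t * haar_norm q ?f"
      by (intro haar_norm_cmult assms pos_meas_borel) measurable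
    also have "\<dots> \<le> C * b t * D" using D(2)[OF t] by (rule mult_left_mono) simp
    finally show ?thesis by (simp add: ac_simps)
  qed
  then show ?thesis using that[of "C * D"] C(1) D(1) by (auto simp: ennreal_mult_less_top)
qed

lemma slow_tail:
  assumes "slow b" "pos_meas b" "0 < q"
  obtains C where "C < \<infinity>"
    "\<And>t. 0 < t \<Longrightarrow> haar_norm q (\<lambda>u. indicator {t<..} u * (ennreal (1 / u) * b u)) \<le> C * (ennreal (1 / t) * b t)"
proof -
  obtain C where C: "C < \<infinity>"
    "\<And>t. 0 < t \<Longrightarrow> haar_norm q (\<lambda>u. indicator {t<..} u * (ennreal ((t / u) powr 1) * b u)) \<le> C * b t"
    using slow_weighted_tail[OF assms(1,3) zero_less_one] by metis
  have "haar_norm q (\<lambda>u. indicator {t<..} u * (ennreal (1 / u) * b u)) \<le> C * (ennreal (1 / t) * b t)"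
    if t: "0 < t" for t
  proof -
    have "haar_norm q (\<lambda>u. indicator {t<..} u * (ennreal (1 / u) * b u)) =
        haar_norm q (\<lambda>u. ennreal (1 / t) * (indicator {t<..} u * (ennreal ((t / u) powr 1) * b u)))"
    proof (rule haar_norm_cong)
      fix u :: real assume "0 < u"
      then have "ennreal (1 / u) = ennreal (1 / t) * ennreal ((t / u) powr 1)"
        using t by (simp flip: ennreal_mult)
      then show "indicator {t<..} u * (ennreal (1 / u) * b u) =
          ennreal (1 / t) * (indicator {t<..} u * (ennreal ((t / u) powr 1) * b u))"
        by (simp only: ac_simps)
    qed
    also have "\<dots> = ennreal (1 / t) * haar_norm q (\<lambda>u. indicator {t<..} u * (ennreal ((t / u) powr 1) * b u))"
      by (intro haar_norm_cmult assms meas_ind borel_measurable_times_ennreal pos_meas_borel) measurable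
    also have "\<dots> \<le> ennreal (1 / t) * (C * b t)" using C(2)[OF t] by (rule mult_left_mono) simp
    finally show ?thesis by (simp only: ac_simps)
  qed
  then show ?thesis using that C(1) by blast
qed

text \<open>
  On \<open>(s, t)\<close> one has \<open>1 \<le> (t / u) powr e = (t / s) powr e * (s / u) powr e\<close>.
\<close>

lemma slow_norm_interval:
  assumes "slow b" "pos_meas b" "0 < q" "0 < e"
  obtains C where "C < \<infinity>"
    "\<And>s t. 0 < s \<Longrightarrow> s \<le> t \<Longrightarrow> haar_norm q (\<lambda>u. indicator {s<..<t} u * b u) \<le> C * (ennreal ((t / s) powr e) * b s)"
proof -
  obtain C where C: "C < \<infinity>"
    "\<And>t. 0 < t \<Longrightarrow> haar_norm q (\<lambda>u. indicator {t<..} u * (ennreal ((t / u) powr e) * b u)) \<le> C * b t"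
    using slow_weighted_tail[OF assms(1,3,4)] by metis
  have "haar_norm q (\<lambda>u. indicator {s<..<t} u * b u) \<le> C * (ennreal ((t / s) powr e) * b s)"
    if st: "0 < s" "s \<le> t" for s t
  proof -
    let ?f = "\<lambda>u. indicator {s<..} u * (ennreal ((s / u) powr e) * b u)"
    have "haar_norm q (\<lambda>u. indicator {s<..<t} u * b u) \<le> haar_norm q (\<lambda>u. ennreal ((t / s) powr e) * ?f u)"
    proof (rule haar_norm_mono[OF assms(3)])
      fix u :: real assume u: "0 < u"
      show "indicator {s<..<t} u * b u \<le> ennreal ((t / s) powr e) * ?f u"
      proof (cases "s < u \<and> u < t")
        case True
        have "1 \<le> (t / u) powr e" using True u assms(4) by (intro ge_one_powr_ge_zero) auto
        also have "\<dots> = (t / s) powr e * (s / u) powr e" using st u by (simp flip: powr_mult)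
        finally have "1 * b u \<le> ennreal ((t / s) powr e) * ennreal ((s / u) powr e) * b u"
          by (intro mult_right_mono) (simp_all flip: ennreal_mult)
        then show ?thesis using True by (simp add: mult.assoc)
      qed simp
    qed
    also have "\<dots> = ennreal ((t / s) powr e) * haar_norm q ?f"
      by (intro haar_norm_cmult assms meas_ind borel_measurable_times_ennreal pos_meas_borel) measurable
    also have "\<dots> \<le> ennreal ((t / s) powr e) * (C * b s)" using C(2)[OF st(1)] by (rule mult_left_mono) simp
    finally show ?thesis by (simp only: ac_simps)
  qed
  then show ?thesis using that C(1) by blast
qed

lemma slow_le_norm_interval:
  assumes "slow b" "pos_meas b" "0 < q"
  obtains C where "C < \<infinity>"
    "\<And>t. 0 < t \<Longrightarrow> b t \<le> C * haar_norm q (\<lambda>u. indicator {t / 2<..<t} u * b u)"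
proof -
  obtain B where B: "B < \<infinity>" "tempered 1 B b" using assms by (metis slow_def zero_less_one)
  obtain C where C: "C < \<infinity>"
    "\<And>t x h. 0 < t \<Longrightarrow> (\<And>u. t < u \<Longrightarrow> u < 2 * t \<Longrightarrow> x \<le> h u) \<Longrightarrow> x \<le> C * haar_norm q h"
    using haar_norm_ge_dyadic[OF assms(3)] by metis
  have "b t \<le> C * (B * ennreal (2 powr 1)) * haar_norm q (\<lambda>u. indicator {t / 2<..<t} u * b u)" if t: "0 < t" for t
  proof -
    have "b t \<le> C * haar_norm q (\<lambda>u. (B * ennreal (2 powr 1)) * (indicator {t / 2<..<t} u * b u))"
    proof (rule C(2)[of "t / 2"])
      fix u assume u: "t / 2 < u" "u < 2 * (t / 2)"
      then have "b t \<le> B * ennreal (2 powr 1) * b u"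
        using B t by (intro tempered_near) (auto simp: dil_le_iff)
      then show "b t \<le> (B * ennreal (2 powr 1)) * (indicator {t / 2<..<t} u * b u)" using u by simp
    qed (use t in auto)
    also have "haar_norm q (\<lambda>u. (B * ennreal (2 powr 1)) * (indicator {t / 2<..<t} u * b u)) =
        (B * ennreal (2 powr 1)) * haar_norm q (\<lambda>u. indicator {t / 2<..<t} u * b u)"
      using assms by (intro haar_norm_cmult meas_ind) auto
    finally show ?thesis by (simp add: mult.assoc)
  qed
  then show ?thesis using that[of "C * (B * ennreal (2 powr 1))"] B C(1) by (auto simp: ennreal_mult_less_top)
qed

section \<open>Slow variation of chi and growth of rho\<close>

text \<open>
  Here \<open>q, r, a, b\<close> are the parameters \<open>q1, r1, a1, b1\<close> of the limiting space.
\<close>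

locale weights =
  fixes q r :: ennreal and a b :: "real \<Rightarrow> real"
  assumes q_pos: "0 < q" and r_pos: "0 < r"
    and a_SV: "a \<in> SV" and b_SV: "b \<in> SV"
    and chi_1: "chi r b q a 1 < \<infinity>"
begin

abbreviation \<alpha> :: "real \<Rightarrow> ennreal" where "\<alpha> u \<equiv> ennreal (a u)"
abbreviation \<beta> :: "real \<Rightarrow> ennreal" where "\<beta> u \<equiv> ennreal (b u)"
abbreviation chi1 :: "real \<Rightarrow> ennreal" where "chi1 \<equiv> chi r b q a"
abbreviation \<rho> :: "real \<Rightarrow> real" where "\<rho> \<equiv> rho r b q a"

definition local_norm :: "real \<Rightarrow> real \<Rightarrow> ennreal" where
  "local_norm s t = haar_norm q (\<lambda>u. indicator {s<..<t} u * \<alpha> u)"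

text \<open>The norm of \<open>b1\<close> that enters the weight \<open>B1\<close>.\<close>

definition head_b :: "real \<Rightarrow> ennreal" where
  "head_b t = haar_norm r (\<lambda>s. indicator {0<..<t} s * \<beta> s)"

lemmas slow_a = SV_slow[OF a_SV] and slow_b = SV_slow[OF b_SV]
lemmas meas_a [measurable] = SV_pos_meas[OF a_SV] and meas_b [measurable] = SV_pos_meas[OF b_SV]

lemma local_norm_mono: "s' \<le> s \<Longrightarrow> t \<le> t' \<Longrightarrow> local_norm s t \<le> local_norm s' t'"
  unfolding local_norm_def by (rule haar_norm_mono[OF q_pos]) (auto simp: indicator_def)

lemma meas_local_norm: "pos_meas (\<lambda>s. local_norm s t)"
  by (rule pos_meas_mono) (auto simp: monotone_on_def intro: local_norm_mono)

lemma chi_eq: "chi1 t = haar_norm r (\<lambda>s. indicator {0<..<t} s * (\<beta> s * local_norm s t))"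
proof -
  have 1: "Lq_norm q {s<..<t} (\<lambda>u. ennreal (u powr (- recip q) * a u)) = local_norm s t" if "0 < s" for s
    unfolding local_norm_def using that haar_norm_restrict[OF q_pos, of "{s<..<t}" \<alpha>]
    by (simp add: ennreal_mult' subset_iff)
  have "chi1 t = haar_norm r (\<lambda>s. indicator {0<..<t} s *
      (\<beta> s * Lq_norm q {s<..<t} (\<lambda>u. ennreal (u powr (- recip q) * a u))))"
    unfolding chi_def
    by (subst haar_norm_restrict[OF r_pos, symmetric]) (auto simp: ennreal_mult' mult.assoc)
  also have "\<dots> = haar_norm r (\<lambda>s. indicator {0<..<t} s * (\<beta> s * local_norm s t))"
    using 1 by (intro haar_norm_cong) simp
  finally show ?thesis .
qed

lemma chi_mono: "s \<le> t \<Longrightarrow> chi1 s \<le> chi1 t"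
  unfolding chi_eq by (rule haar_norm_mono[OF r_pos])
    (auto simp: indicator_def intro!: mult_left_mono local_norm_mono)

lemma head_b_mono: "s \<le> t \<Longrightarrow> head_b s \<le> head_b t"
  unfolding head_b_def by (rule haar_norm_mono[OF r_pos]) (auto simp: indicator_def)

lemma b_le_head_b: obtains C where "C < \<infinity>" "\<And>t. 0 < t \<Longrightarrow> \<beta> t \<le> C * head_b t"
proof -
  obtain C where C: "C < \<infinity>" "\<And>t. 0 < t \<Longrightarrow> \<beta> t \<le> C * haar_norm r (\<lambda>u. indicator {t / 2<..<t} u * \<beta> u)"
    using slow_le_norm_interval[OF slow_b meas_b r_pos] by metis
  have "haar_norm r (\<lambda>u. indicator {t / 2<..<t} u * \<beta> u) \<le> head_b t" if "0 < t" for t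
    unfolding head_b_def using that by (intro haar_norm_mono[OF r_pos]) (auto simp: indicator_def)
  then show ?thesis using that[OF C(1)] C(2) by (meson mult_left_mono order.trans zero_le)
qed

text \<open>
  The part of \<open>(0, t)\<close> beyond \<open>s\<close> contributes a multiple of \<open>b s\<close>, which \<open>head_b s\<close> dominates.
\<close>

lemma head_b_growth:
  assumes "0 < e"
  obtains C where "C < \<infinity>"
    "\<And>s t. 0 < s \<Longrightarrow> s \<le> t \<Longrightarrow> head_b t \<le> C * (ennreal ((t / s) powr e) * head_b s)"
proof -
  obtain C0 where C0: "C0 < \<infinity>" "\<And>g h. pos_meas g \<Longrightarrow> pos_meas h \<Longrightarrow>
      haar_norm r (\<lambda>u. g u + h u) \<le> C0 * (haar_norm r g + haar_norm r h)"
    using haar_norm_add[OF r_pos] by metis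
  obtain C1 where C1: "C1 < \<infinity>" "\<And>s t. 0 < s \<Longrightarrow> s \<le> t \<Longrightarrow>
      haar_norm r (\<lambda>u. indicator {s<..<t} u * \<beta> u) \<le> C1 * (ennreal ((t / s) powr e) * \<beta> s)"
    using slow_norm_interval[OF slow_b meas_b r_pos assms] by metis
  obtain C2 where C2: "C2 < \<infinity>" "\<And>t. 0 < t \<Longrightarrow> \<beta> t \<le> C2 * head_b t"
    using b_le_head_b by metis
  have "head_b t \<le> C0 * (1 + C1 * C2) * (ennreal ((t / s) powr e) * head_b s)" if st: "0 < s" "s \<le> t" for s t
  proof -
    let ?p = "ennreal ((t / s) powr e)"
    have p: "1 \<le> ?p" using st assms by (auto simp: ge_one_powr_ge_zero)
    have "head_b t \<le> haar_norm r (\<lambda>u. indicator {0<..<s} u * \<beta> u + indicator {s<..<t} u * \<beta> u)"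
      unfolding head_b_def by (rule haar_norm_mono_except[OF r_pos, of s]) (auto simp: indicator_def)
    also have "\<dots> \<le> C0 * (head_b s + haar_norm r (\<lambda>u. indicator {s<..<t} u * \<beta> u))"
      unfolding head_b_def by (intro C0(2) meas_ind meas_b) auto
    finally have 1: "head_b t \<le> C0 * (head_b s + haar_norm r (\<lambda>u. indicator {s<..<t} u * \<beta> u))" .
    have "haar_norm r (\<lambda>u. indicator {s<..<t} u * \<beta> u) \<le> C1 * (?p * (C2 * head_b s))"
      using C1(2)[OF st] mult_left_mono[OF mult_left_mono[OF C2(2)[OF st(1)]], of ?p C1] by auto
    also have "\<dots> = C1 * C2 * (?p * head_b s)" by (simp add: ac_simps)
    finally have 2: "haar_norm r (\<lambda>u. indicator {s<..<t} u * \<beta> u) \<le> C1 * C2 * (?p * head_b s)" .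
    have "head_b s \<le> 1 * (?p * head_b s)" using mult_right_mono[OF p, of "head_b s"] by simp
    then show ?thesis using le_cmult_trans[OF 1 cmult_le_add[OF _ 2]] by blast
  qed
  then show ?thesis using that[of "C0 * (1 + C1 * C2)"] C0(1) C1(1) C2(1) by (auto simp: ennreal_mult_less_top)
qed

text \<open>
  In \<open>\<chi>(t)\<close> keep only \<open>s < t / 2\<close>: there the inner norm contains \<open>(t / 2, t)\<close> and so dominates
  \<open>a t\<close>. What remains is \<open>head_b (t / 2)\<close>, comparable to \<open>head_b t\<close>.
\<close>

lemma head_b_a_le_chi: obtains C where "C < \<infinity>" "\<And>t. 0 < t \<Longrightarrow> head_b t * \<alpha> t \<le> C * chi1 t"
proof -
  obtain C1 where C1: "C1 < \<infinity>"
    "\<And>s t. 0 < s \<Longrightarrow> s \<le> t \<Longrightarrow> head_b t \<le> C1 * (ennreal ((t / s) powr 1) * head_b s)"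
    using head_b_growth[of 1] by (metis zero_less_one)
  obtain C2 where C2: "C2 < \<infinity>" "\<And>t. 0 < t \<Longrightarrow> \<alpha> t \<le> C2 * local_norm (t / 2) t"
    unfolding local_norm_def using slow_le_norm_interval[OF slow_a meas_a q_pos] by metis
  have "head_b t * \<alpha> t \<le> (C1 * ennreal (2 powr 1)) * C2 * chi1 t" if t: "0 < t" for t
  proof -
    have 1: "head_b t * \<alpha> t \<le> C1 * ennreal (2 powr 1) * (\<alpha> t * head_b (t / 2))"
      using mult_right_mono[OF C1(2)[of "t / 2" t], of "\<alpha> t"] t by (simp add: ac_simps)
    have "\<alpha> t * head_b (t / 2) = haar_norm r (\<lambda>s. \<alpha> t * (indicator {0<..<t / 2} s * \<beta> s))"
      unfolding head_b_def by (intro haar_norm_cmult[symmetric] r_pos meas_ind meas_b) auto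
    also have "\<dots> \<le> haar_norm r (\<lambda>s. C2 * (indicator {0<..<t} s * (\<beta> s * local_norm s t)))"
    proof (rule haar_norm_mono[OF r_pos])
      fix s :: real assume "0 < s"
      show "\<alpha> t * (indicator {0<..<t / 2} s * \<beta> s) \<le> C2 * (indicator {0<..<t} s * (\<beta> s * local_norm s t))"
      proof (cases "s < t / 2")
        case True
        have "\<alpha> t \<le> C2 * local_norm (t / 2) t" using C2(2)[OF t] .
        also have "\<dots> \<le> C2 * local_norm s t" using True by (intro mult_left_mono local_norm_mono) auto
        finally have "\<beta> s * \<alpha> t \<le> \<beta> s * (C2 * local_norm s t)" by (rule mult_left_mono) simp
        then show ?thesis using True \<open>0 < s\<close> t by (simp add: ac_simps)
      qed simp
    qed
    also have "\<dots> = C2 * chi1 t"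
      unfolding chi_eq by (intro haar_norm_cmult r_pos meas_ind borel_measurable_times_ennreal meas_b meas_local_norm) auto
    finally show ?thesis by (rule le_cmult_trans[OF 1])
  qed
  then show ?thesis using that[of "(C1 * ennreal (2 powr 1)) * C2"] C1(1) C2(1) by (auto simp: ennreal_mult_less_top)
qed

text \<open>
  Cut both norms in \<open>\<chi>(t)\<close> at \<open>s\<close>. Up to a power of \<open>t / s\<close> the new contributions are at most
  \<open>head_b s * a s\<close>, which is dominated by \<open>\<chi>(s)\<close>. With monotonicity this is slow variation of
  \<open>\<chi>\<close>; for \<open>s = 1\<close> it shows that \<open>\<chi>\<close> is finite.
\<close>

lemma chi_growth:
  assumes "0 < e"
  obtains C where "C < \<infinity>" "\<And>s t. 0 < s \<Longrightarrow> s \<le> t \<Longrightarrow> chi1 t \<le> C * (ennreal ((t / s) powr e) * chi1 s)"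
proof -
  have e2: "0 < e / 2" using assms by simp
  obtain Cq where Cq: "Cq < \<infinity>" "1 \<le> Cq" "\<And>g h. pos_meas g \<Longrightarrow> pos_meas h \<Longrightarrow>
      haar_norm q (\<lambda>u. g u + h u) \<le> Cq * (haar_norm q g + haar_norm q h)"
    using haar_norm_add[OF q_pos] by metis
  obtain Cr where Cr: "Cr < \<infinity>" "\<And>g h. pos_meas g \<Longrightarrow> pos_meas h \<Longrightarrow>
      haar_norm r (\<lambda>u. g u + h u) \<le> Cr * (haar_norm r g + haar_norm r h)"
    using haar_norm_add[OF r_pos] by metis
  obtain C1 where C1: "C1 < \<infinity>" "\<And>s t. 0 < s \<Longrightarrow> s \<le> t \<Longrightarrow>
      local_norm s t \<le> C1 * (ennreal ((t / s) powr (e / 2)) * \<alpha> s)"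
    unfolding local_norm_def using slow_norm_interval[OF slow_a meas_a q_pos e2] by metis
  obtain C2 where C2: "C2 < \<infinity>"
    "\<And>s t. 0 < s \<Longrightarrow> s \<le> t \<Longrightarrow> head_b t \<le> C2 * (ennreal ((t / s) powr (e / 2)) * head_b s)"
    using head_b_growth[OF e2] by metis
  obtain C3 where C3: "C3 < \<infinity>" "\<And>t. 0 < t \<Longrightarrow> head_b t * \<alpha> t \<le> C3 * chi1 t"
    using head_b_a_le_chi by metis
  have "chi1 t \<le> Cr * (Cq + Cq * C1 * C2 * C3) * (ennreal ((t / s) powr e) * chi1 s)" if st: "0 < s" "s \<le> t" for s t
  proof -
    let ?p = "ennreal ((t / s) powr e)" and ?p' = "ennreal ((t / s) powr (e / 2))"
    have p: "1 \<le> ?p" using st assms by (auto simp: ge_one_powr_ge_zero)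
    have pp: "?p' * ?p' = ?p" by (simp flip: ennreal_mult powr_add)
    let ?X = "Cq * local_norm s t"
    have split: "local_norm x t \<le> Cq * (local_norm x s + local_norm s t)" if "x < s" for x
    proof -
      have "local_norm x t \<le> haar_norm q (\<lambda>u. indicator {x<..<s} u * \<alpha> u + indicator {s<..<t} u * \<alpha> u)"
        unfolding local_norm_def by (rule haar_norm_mono_except[OF q_pos, of s]) (auto simp: indicator_def)
      also have "\<dots> \<le> Cq * (local_norm x s + local_norm s t)"
        unfolding local_norm_def by (intro Cq(3) meas_ind meas_a) auto
      finally show ?thesis .
    qed
    have "chi1 t \<le> haar_norm r (\<lambda>x. Cq * (indicator {0<..<s} x * (\<beta> x * local_norm x s)) +
        ?X * (indicator {0<..<t} x * \<beta> x))"
      unfolding chi_eq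
    proof (rule haar_norm_mono[OF r_pos])
      fix x :: real assume "0 < x"
      consider "x < s" | "s \<le> x" "x < t" | "t \<le> x" by linarith
      then show "indicator {0<..<t} x * (\<beta> x * local_norm x t) \<le>
          Cq * (indicator {0<..<s} x * (\<beta> x * local_norm x s)) + ?X * (indicator {0<..<t} x * \<beta> x)"
      proof cases
        case 1
        then show ?thesis using mult_left_mono[OF split[OF 1], of "\<beta> x"] st \<open>0 < x\<close>
          by (simp add: distrib_left ac_simps)
      next
        case 2
        have "local_norm x t \<le> 1 * local_norm s t" using 2 local_norm_mono[of s x t t] by simp
        also have "\<dots> \<le> ?X" using Cq(2) by (rule mult_right_mono) simp
        finally have "\<beta> x * local_norm x t \<le> \<beta> x * ?X" by (rule mult_left_mono) simp
        then show ?thesis using 2 \<open>0 < x\<close> by (simp add: ac_simps)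
      qed simp
    qed
    also have "\<dots> \<le> Cr * (haar_norm r (\<lambda>x. Cq * (indicator {0<..<s} x * (\<beta> x * local_norm x s))) +
        haar_norm r (\<lambda>x. ?X * (indicator {0<..<t} x * \<beta> x)))"
      by (intro Cr(2) borel_measurable_times_ennreal borel_measurable_const meas_ind meas_b meas_local_norm) auto
    also have "haar_norm r (\<lambda>x. Cq * (indicator {0<..<s} x * (\<beta> x * local_norm x s))) = Cq * chi1 s"
      unfolding chi_eq by (intro haar_norm_cmult r_pos borel_measurable_times_ennreal meas_ind meas_b meas_local_norm) auto
    also have "haar_norm r (\<lambda>x. ?X * (indicator {0<..<t} x * \<beta> x)) = ?X * head_b t"
      unfolding head_b_def by (intro haar_norm_cmult r_pos meas_ind meas_b) auto
    finally have 1: "chi1 t \<le> Cr * (Cq * chi1 s + ?X * head_b t)" .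
    have "?X * head_b t \<le> Cq * (C1 * (?p' * \<alpha> s)) * (C2 * (?p' * head_b s))"
      using C1(2)[OF st] C2(2)[OF st] by (intro mult_mono mult_left_mono) auto
    also have "\<dots> = Cq * C1 * C2 * (?p' * ?p' * (head_b s * \<alpha> s))" by (simp add: ac_simps)
    also have "\<dots> \<le> Cq * C1 * C2 * (?p * (C3 * chi1 s))"
      unfolding pp using C3(2)[OF st(1)] by (intro mult_left_mono) auto
    finally have 2: "?X * head_b t \<le> Cq * C1 * C2 * C3 * (?p * chi1 s)" by (simp add: ac_simps)
    have "Cq * chi1 s \<le> Cq * (?p * chi1 s)" using mult_left_mono[OF mult_right_mono[OF p, of "chi1 s"], of Cq] by simp
    then show ?thesis using le_cmult_trans[OF 1 cmult_le_add[OF _ 2]] by blast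
  qed
  then show ?thesis using that[of "Cr * (Cq + Cq * C1 * C2 * C3)"] Cr(1) Cq(1) C1(1) C2(1) C3(1)
    by (auto simp: ennreal_mult_less_top)
qed

lemma chi_finite: "chi1 t < \<infinity>"
proof (cases "t \<le> 1")
  case True
  then show ?thesis using chi_mono[of t 1] chi_1 by auto
next
  case False
  obtain C where C: "C < \<infinity>" "\<And>s t. 0 < s \<Longrightarrow> s \<le> t \<Longrightarrow> chi1 t \<le> C * (ennreal ((t / s) powr 1) * chi1 s)"
    using chi_growth[of 1] by (metis zero_less_one)
  have "chi1 t \<le> C * (ennreal ((t / 1) powr 1) * chi1 1)" using False by (intro C) auto
  also have "\<dots> < \<infinity>" using C chi_1 by (auto simp: ennreal_mult_less_top)
  finally show ?thesis .
qed

lemma chi_pos: "0 < t \<Longrightarrow> 0 < chi1 t"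
proof -
  assume t: "0 < t"
  obtain C where C: "C < \<infinity>" "\<And>t. 0 < t \<Longrightarrow> head_b t * \<alpha> t \<le> C * chi1 t"
    using head_b_a_le_chi by metis
  obtain D where D: "D < \<infinity>" "\<And>t. 0 < t \<Longrightarrow> \<beta> t \<le> D * head_b t"
    using b_le_head_b by metis
  have "0 < \<alpha> t" "0 < \<beta> t" using t slow_a slow_b by (auto simp: slow_def)
  then have "head_b t \<noteq> 0" using D(2)[OF t] by auto
  then have "0 < head_b t * \<alpha> t" using \<open>0 < \<alpha> t\<close> by (simp add: ennreal_zero_less_mult_iff zero_less_iff_neq_zero)
  then show ?thesis using C(2)[OF t] by (metis ennreal_zero_less_mult_iff order_less_le_trans)
qed

lemma head_b_finite: "0 < t \<Longrightarrow> head_b t < \<infinity>"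
proof -
  assume t: "0 < t"
  obtain C where C: "C < \<infinity>" "\<And>t. 0 < t \<Longrightarrow> head_b t * \<alpha> t \<le> C * chi1 t"
    using head_b_a_le_chi by metis
  have "C * chi1 t < \<infinity>" using C(1) chi_finite[of t] by (auto simp: ennreal_mult_less_top)
  then have "head_b t * \<alpha> t < \<infinity>" using C(2)[OF t] by (rule order_le_less_trans[rotated])
  moreover have "0 < \<alpha> t" using t slow_a by (auto simp: slow_def)
  ultimately show ?thesis by (auto simp: ennreal_mult_less_top)
qed

lemma enn2real_chi_pos: "0 < t \<Longrightarrow> 0 < enn2real (chi1 t)"
  using chi_pos[of t] chi_finite[of t] by (simp add: enn2real_positive_iff)

lemma rho_pos: "0 < t \<Longrightarrow> 0 < \<rho> t"
  using enn2real_chi_pos by (simp add: rho_def)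

lemma rho_times_chi: "0 < t \<Longrightarrow> ennreal (\<rho> t) * chi1 t = ennreal t"
proof -
  assume t: "0 < t"
  have "chi1 t = ennreal (enn2real (chi1 t))" using chi_finite[of t] by simp
  then show ?thesis
    using t enn2real_chi_pos[OF t] by (metis ennreal_mult less_eq_real_def nonzero_eq_divide_eq rho_def rho_pos order_less_irrefl)
qed

lemma rho_upper: "0 < s \<Longrightarrow> s \<le> t \<Longrightarrow> \<rho> t \<le> t / s * \<rho> s"
proof -
  assume st: "0 < s" "s \<le> t"
  have "enn2real (chi1 s) \<le> enn2real (chi1 t)"
    using chi_mono[OF st(2)] chi_finite[of t] by (intro enn2real_mono) auto
  then have "t / enn2real (chi1 t) \<le> t / enn2real (chi1 s)"
    using st enn2real_chi_pos by (intro divide_left_mono) auto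
  then show ?thesis using st by (simp add: rho_def)
qed

text \<open>The growth bound of \<open>\<chi>\<close> with exponent \<open>1 / 2\<close>.\<close>

lemma rho_lower: obtains L where "1 \<le> L" "\<And>s t. 0 < s \<Longrightarrow> s \<le> t \<Longrightarrow> sqrt (t / s) * \<rho> s \<le> L * \<rho> t"
proof -
  obtain C where C: "C < \<infinity>" "\<And>s t. 0 < s \<Longrightarrow> s \<le> t \<Longrightarrow> chi1 t \<le> C * (ennreal ((t / s) powr (1 / 2)) * chi1 s)"
    using chi_growth[of "1 / 2"] by (metis half_gt_zero zero_less_one)
  let ?L = "max 1 (enn2real C)"
  have "sqrt (t / s) * \<rho> s \<le> ?L * \<rho> t" if st: "0 < s" "s \<le> t" for s t
  proof -
    define w where "w = sqrt (t / s)"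
    have w: "0 \<le> w" "w * w = t / s" using st by (auto simp: w_def)
    let ?x = "enn2real (chi1 s)" and ?y = "enn2real (chi1 t)"
    have xy: "0 < ?x" "0 < ?y" using st enn2real_chi_pos by auto
    have "?y \<le> enn2real (C * (ennreal ((t / s) powr (1 / 2)) * chi1 s))"
      using C chi_finite[of s] st by (intro enn2real_mono) (auto simp: ennreal_mult_less_top)
    also have "\<dots> = enn2real C * (w * ?x)"
      using st by (simp add: enn2real_mult powr_half_sqrt w_def)
    also have "\<dots> \<le> ?L * (w * ?x)"
      using w xy by (intro mult_right_mono) auto
    finally have "w * s * ?y \<le> w * s * (?L * (w * ?x))"
      using st w by (intro mult_left_mono) auto
    also have "\<dots> = (w * w) * s * (?L * ?x)" by (simp only: ac_simps)
    also have "\<dots> = ?L * t * ?x" unfolding w(2) using st by simp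
    finally have "w * (s / ?x) \<le> ?L * (t / ?y)" using xy by (simp add: field_simps)
    then show ?thesis by (simp add: rho_def w_def)
  qed
  then show ?thesis using that[of ?L] by simp
qed

lemma rho_measurable: "\<rho> \<in> borel_measurable (restrict_space borel {0<..})"
proof -
  have "mono_on {0<..} (\<lambda>t. enn2real (chi1 t))"
    using chi_mono chi_finite by (auto intro!: mono_onI enn2real_mono)
  then have "(\<lambda>t. enn2real (chi1 t)) \<in> borel_measurable (restrict_space borel {0<..})"
    by (rule borel_measurable_mono_on_fnc)
  then show ?thesis unfolding rho_def[abs_def]
    by (intro borel_measurable_divide) (auto intro: measurable_restrict_space1)
qed

end

section \<open>The K-functional\<close>

text \<open>
  Passes from a bound for all decompositions \<open>f = f0 + f1\<close> to a bound in terms of the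
  \<open>K\<close>-functional, without choosing nearly optimal decompositions.
\<close>

lemma le_affine_Inf:
  fixes z a C :: ennreal
  assumes "C < \<infinity>" "C \<noteq> 0" "\<And>x. x \<in> S \<Longrightarrow> z \<le> a + C * x"
  shows "z \<le> a + C * Inf S"
proof (cases "a = \<infinity>")
  case False
  have "inverse C * (z - a) \<le> Inf S"
  proof (rule Inf_greatest)
    fix x assume "x \<in> S"
    from assms(3)[OF this] have "z - a \<le> C * x"
      using False by (simp add: ennreal_minus_le_iff)
    then have "inverse C * (z - a) \<le> inverse C * (C * x)" by (rule mult_left_mono) simp
    then show "inverse C * (z - a) \<le> x" by (simp only: ennreal_inverse_cancel(1)[OF assms(1,2)])
  qed
  then have "C * (inverse C * (z - a)) \<le> C * Inf S" by (rule mult_left_mono) simp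
  then have "z - a \<le> C * Inf S" by (simp only: ennreal_inverse_cancel(2)[OF assms(1,2)])
  then show ?thesis using False by (simp add: ennreal_minus_le_iff)
qed simp

lemma K_fun_le: "f = f0 + f1 \<Longrightarrow> 0 < t \<Longrightarrow> K_fun X0 X1 t f \<le> X0 f0 + ennreal t * X1 f1"
proof (cases "f0 \<in> carrier_of X0 \<and> f1 \<in> carrier_of X1")
  case True
  then show "f = f0 + f1 \<Longrightarrow> K_fun X0 X1 t f \<le> X0 f0 + ennreal t * X1 f1"
    unfolding K_fun_def by (intro Inf_lower) auto
next
  case False
  assume "0 < t"
  from False have "X0 f0 = \<infinity> \<or> X1 f1 = \<infinity>"
    by (auto simp: carrier_of_def less_top[symmetric])
  with \<open>0 < t\<close> have "X0 f0 + ennreal t * X1 f1 = \<infinity>"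
    by (auto simp: ennreal_mult_top)
  then show "K_fun X0 X1 t f \<le> X0 f0 + ennreal t * X1 f1" by (metis top_greatest infinity_ennreal_def)
qed

lemma K_fun_mono: "s \<le> t \<Longrightarrow> K_fun X0 X1 s f \<le> K_fun X0 X1 t f"
  unfolding K_fun_def
  by (rule Inf_mono) (fastforce intro!: add_left_mono mult_right_mono ennreal_leI)

text \<open>Combines that \<open>K\<close> increases and that \<open>K(t) / t\<close> decreases.\<close>

lemma K_fun_scale:
  assumes "0 < s" "0 < t"
  shows "K_fun X0 X1 s f \<le> ennreal (dil s t) * K_fun X0 X1 t f"
proof -
  let ?d = "ennreal (dil s t)"
  have d: "1 \<le> dil s t" using assms by (rule dil_ge_1)
  have "s \<le> dil s t * t" using dil_le_iff[of s t "dil s t"] assms by simp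
  then have s: "ennreal s \<le> ?d * ennreal t" using d by (simp add: ennreal_leI flip: ennreal_mult')
  have "K_fun X0 X1 s f \<le> 0 + ?d * Inf {X0 f0 + ennreal t * X1 f1 | f0 f1.
            f = f0 + f1 \<and> f0 \<in> carrier_of X0 \<and> f1 \<in> carrier_of X1}"
  proof (rule le_affine_Inf)
    fix x assume "x \<in> {X0 f0 + ennreal t * X1 f1 | f0 f1. f = f0 + f1 \<and> f0 \<in> carrier_of X0 \<and> f1 \<in> carrier_of X1}"
    then obtain f0 f1 where f: "x = X0 f0 + ennreal t * X1 f1" "f = f0 + f1" by blast
    have "K_fun X0 X1 s f \<le> X0 f0 + ennreal s * X1 f1" using f(2) assms by (intro K_fun_le)
    also have "\<dots> \<le> ?d * X0 f0 + (?d * ennreal t) * X1 f1"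
      using s d mult_right_mono[of 1 ?d "X0 f0"] by (intro add_mono mult_right_mono) auto
    also have "\<dots> = 0 + ?d * x" by (simp add: f distrib_left mult.assoc)
    finally show "K_fun X0 X1 s f \<le> 0 + ?d * x" .
  qed (use d in auto)
  then show ?thesis by (simp add: K_fun_def)
qed

lemma K_fun_tempered: "tempered 1 1 (\<lambda>t. K_fun X0 X1 t f)"
  using K_fun_scale dil_ge_1 by (fastforce simp: tempered_def)

lemma K_fun_meas: "pos_meas (\<lambda>t. K_fun X0 X1 t f)"
  by (rule pos_meas_mono) (auto simp: monotone_on_def intro: K_fun_mono)

text \<open>
  With this value the formulas below for interpolation quasi-norms hold for all \<open>f\<close>.
\<close>

lemma K_fun_off_sum_space: "f \<notin> sum_space X0 X1 \<Longrightarrow> K_fun X0 X1 t f = \<infinity>"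
proof -
  assume "f \<notin> sum_space X0 X1"
  then have "{X0 f0 + ennreal t * X1 f1 | f0 f1. f = f0 + f1 \<and> f0 \<in> carrier_of X0 \<and> f1 \<in> carrier_of X1} = {}"
    by (auto simp: sum_space_def)
  then show ?thesis unfolding K_fun_def by (simp only: Inf_empty) simp
qed

text \<open>
  Given a decomposition of \<open>h\<close>, add \<open>g\<close> to its component in \<open>X0\<close>.
\<close>

lemma K_fun_add_left:
  assumes "quasi_norm X0"
  obtains C where "C < \<infinity>" "1 \<le> C"
    "\<And>f g h X1 t. f = g + h \<Longrightarrow> 0 < t \<Longrightarrow> K_fun X0 X1 t f \<le> C * (X0 g + K_fun X0 X1 t h)"
proof -
  obtain c where c: "1 \<le> c" "\<And>x y. X0 (x + y) \<le> ennreal c * (X0 x + X0 y)"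
    using assms unfolding quasi_norm_def by blast
  have C1: "1 \<le> ennreal c" using c(1) by simp
  have "K_fun X0 X1 t f \<le> ennreal c * (X0 g + K_fun X0 X1 t h)" if f: "f = g + h" and t: "0 < t" for f g h X1 t
  proof -
    have "K_fun X0 X1 t f \<le> ennreal c * X0 g + ennreal c * Inf {X0 f0 + ennreal t * X1 f1 | f0 f1.
            h = f0 + f1 \<and> f0 \<in> carrier_of X0 \<and> f1 \<in> carrier_of X1}"
    proof (rule le_affine_Inf)
      fix x assume "x \<in> {X0 f0 + ennreal t * X1 f1 | f0 f1. h = f0 + f1 \<and> f0 \<in> carrier_of X0 \<and> f1 \<in> carrier_of X1}"
      then obtain h0 h1 where h: "x = X0 h0 + ennreal t * X1 h1" "h = h0 + h1" by blast
      have "K_fun X0 X1 t f \<le> X0 (g + h0) + ennreal t * X1 h1"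
        using f h t by (intro K_fun_le) (auto simp: add.assoc)
      also have "\<dots> \<le> ennreal c * (X0 g + X0 h0) + ennreal c * (ennreal t * X1 h1)"
        using c(2)[of g h0] mult_right_mono[OF C1, of "ennreal t * X1 h1"] by (intro add_mono) auto
      also have "\<dots> = ennreal c * X0 g + ennreal c * x" by (simp add: h distrib_left add.assoc)
      finally show "K_fun X0 X1 t f \<le> ennreal c * X0 g + ennreal c * x" .
    qed (use c in auto)
    then show ?thesis by (simp add: K_fun_def distrib_left)
  qed
  then show ?thesis using that[of "ennreal c"] C1 by simp
qed

lemma haar_norm_eq_top:
  assumes "0 < q" "0 < t" "\<And>u. t < u \<Longrightarrow> h u = \<infinity>"
  shows "haar_norm q h = \<infinity>"
proof -
  obtain C where C: "C < \<infinity>"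
    "\<And>t x h. 0 < t \<Longrightarrow> (\<And>u. t < u \<Longrightarrow> u < 2 * t \<Longrightarrow> x \<le> h u) \<Longrightarrow> x \<le> C * haar_norm q h"
    using haar_norm_ge_dyadic[OF assms(1)] by metis
  have "\<infinity> \<le> C * haar_norm q h" by (rule C(2)[OF assms(2)]) (simp add: assms(3))
  then show ?thesis using C(1) by (auto simp: top_unique ennreal_mult_eq_top_iff)
qed

lemma powr_weight_split:
  "ennreal (u powr (x - recip q) * w) = ennreal (u powr (- recip q)) * ennreal (u powr x * w)"
proof -
  have "u powr (x - recip q) = u powr (- recip q) * u powr x"
    by (subst powr_add[symmetric]) simp
  then show ?thesis by (simp add: ennreal_mult' mult.assoc)
qed

lemma interp_eq:
  assumes "0 < q" "\<And>u. 0 < u \<Longrightarrow> 0 < w u"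
  shows "interp X0 X1 \<theta> q w f = haar_norm q (\<lambda>u. ennreal (u powr (- \<theta>) * w u) * K_fun X0 X1 u f)"
proof -
  have eq: "Lq_norm q {0<..} (\<lambda>u. ennreal (u powr (- \<theta> - recip q) * w u) * K_fun X0 X1 u f) =
      haar_norm q (\<lambda>u. ennreal (u powr (- \<theta>) * w u) * K_fun X0 X1 u f)"
    by (simp only: powr_weight_split haar_norm_def mult.assoc)
  show ?thesis
  proof (cases "f \<in> sum_space X0 X1")
    case False
    have "haar_norm q (\<lambda>u. ennreal (u powr (- \<theta>) * w u) * K_fun X0 X1 u f) = \<infinity>"
    proof (rule haar_norm_eq_top[OF assms(1), of 1])
      fix u :: real assume "1 < u"
      then have "ennreal (u powr (- \<theta>) * w u) \<noteq> 0" using assms(2)[of u] by simp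
      then show "ennreal (u powr (- \<theta>) * w u) * K_fun X0 X1 u f = \<infinity>"
        by (simp add: K_fun_off_sum_space[OF False] ennreal_mult_top)
    qed simp
    then show ?thesis using False by (simp add: interp_def)
  qed (simp add: interp_def eq)
qed

section \<open>Splitting the quasi-norm of the limiting space\<close>

context weights
begin

definition window_norm :: "(real \<Rightarrow> ennreal) \<Rightarrow> real \<Rightarrow> real \<Rightarrow> ennreal" where
  "window_norm k s t = haar_norm q (\<lambda>u. indicator {s<..<t} u * (ennreal (1 / u) * \<alpha> u * k u))"

definition tail_norm :: "(real \<Rightarrow> ennreal) \<Rightarrow> real \<Rightarrow> ennreal" where
  "tail_norm k t = haar_norm q (\<lambda>u. indicator {t<..} u * (ennreal (1 / u) * \<alpha> u * k u))"

definition tail_iter :: "(real \<Rightarrow> ennreal) \<Rightarrow> real \<Rightarrow> ennreal" where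
  "tail_iter k t = haar_norm r (\<lambda>s. indicator {t<..} s * (\<beta> s * tail_norm k s))"

text \<open>
  The contribution to the quasi-norm of \<open>Y\<close> of the values of \<open>k\<close> on \<open>(t, \<infinity>)\<close>: the first summand
  collects the outer variables below \<open>t\<close>, the second those above.
\<close>

definition tail_part :: "(real \<Rightarrow> ennreal) \<Rightarrow> real \<Rightarrow> ennreal" where
  "tail_part k t = head_b t * tail_norm k t + tail_iter k t"

definition head_part :: "(real \<Rightarrow> ennreal) \<Rightarrow> real \<Rightarrow> ennreal" where
  "head_part k t = haar_norm r (\<lambda>s. indicator {0<..<t} s * (\<beta> s * window_norm k s t))"

text \<open>The quasi-norm of \<open>Y\<close> as a functional of \<open>k = K(\<cdot>, f)\<close>.\<close>

definition full_norm :: "(real \<Rightarrow> ennreal) \<Rightarrow> ennreal" where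
  "full_norm k = haar_norm r (\<lambda>s. \<beta> s * tail_norm k s)"

lemma tail_norm_antimono: "s \<le> t \<Longrightarrow> tail_norm k t \<le> tail_norm k s"
  unfolding tail_norm_def by (rule haar_norm_mono[OF q_pos]) (auto simp: indicator_def)

lemma tail_iter_antimono: "s \<le> t \<Longrightarrow> tail_iter k t \<le> tail_iter k s"
  unfolding tail_iter_def by (rule haar_norm_mono[OF r_pos]) (auto simp: indicator_def)

lemma meas_tail_norm: "pos_meas (tail_norm k)"
  by (rule pos_meas_mono) (auto simp: monotone_on_def intro: tail_norm_antimono)

lemma meas_tail_iter: "pos_meas (tail_iter k)"
  by (rule pos_meas_mono) (auto simp: monotone_on_def intro: tail_iter_antimono)

lemma meas_window_norm: "pos_meas (\<lambda>s. window_norm k s t)"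
proof (rule pos_meas_mono)
  have "window_norm k s' t \<le> window_norm k s t" if "s \<le> s'" for s s'
    unfolding window_norm_def using that by (intro haar_norm_mono[OF q_pos]) (auto simp: indicator_def)
  then show "mono_on {0<..} (\<lambda>s. window_norm k s t) \<or> antimono_on {0<..} (\<lambda>s. window_norm k s t)"
    by (auto simp: monotone_on_def)
qed

lemma meas_head_b: "pos_meas head_b"
  by (rule pos_meas_mono) (auto simp: monotone_on_def intro: head_b_mono)

lemma meas_weighted: "pos_meas k \<Longrightarrow> pos_meas (\<lambda>u. ennreal (1 / u) * \<alpha> u * k u)"
  by (intro borel_measurable_times_ennreal pos_meas_inverse meas_a)

lemmas meas_intros = pos_meas_indicator borel_measurable_times_ennreal meas_ind meas_a meas_b meas_tail_norm
  meas_tail_iter meas_window_norm meas_head_b meas_weighted borel_measurable_const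
  borel_measurable_add

lemma tail_norm_mono: "(\<And>u. 0 < u \<Longrightarrow> k u \<le> k' u) \<Longrightarrow> tail_norm k t \<le> tail_norm k' t"
  unfolding tail_norm_def by (rule haar_norm_mono[OF q_pos]) (auto simp: indicator_def intro!: mult_left_mono)

lemma tail_iter_mono: "(\<And>s. t < s \<Longrightarrow> tail_norm k s \<le> tail_norm k' s) \<Longrightarrow> tail_iter k t \<le> tail_iter k' t"
  unfolding tail_iter_def by (rule haar_norm_mono[OF r_pos]) (auto simp: indicator_def intro!: mult_left_mono)

lemma tail_part_mono: "(\<And>u. 0 < u \<Longrightarrow> k u \<le> k' u) \<Longrightarrow> tail_part k t \<le> tail_part k' t"
  unfolding tail_part_def by (intro add_mono mult_left_mono tail_norm_mono tail_iter_mono) auto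

lemma tail_norm_cmult: "pos_meas k \<Longrightarrow> tail_norm (\<lambda>u. c * k u) t = c * tail_norm k t"
  unfolding tail_norm_def
  by (subst haar_norm_cmult[OF q_pos, symmetric]) (auto intro!: meas_intros simp: ac_simps)

lemma tail_part_cmult: "pos_meas k \<Longrightarrow> tail_part (\<lambda>u. c * k u) t = c * tail_part k t"
proof -
  assume k: "pos_meas k"
  have "tail_iter (\<lambda>u. c * k u) t = c * tail_iter k t"
    unfolding tail_iter_def tail_norm_cmult[OF k]
    by (subst haar_norm_cmult[OF r_pos, symmetric]) (auto intro!: meas_intros simp: ac_simps)
  then show ?thesis by (simp add: tail_part_def tail_norm_cmult[OF k] distrib_left ac_simps)
qed

lemma tail_part_add:
  obtains C where "C < \<infinity>" "\<And>k k' t. pos_meas k \<Longrightarrow> pos_meas k' \<Longrightarrow>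
    tail_part (\<lambda>u. k u + k' u) t \<le> C * (tail_part k t + tail_part k' t)"
proof -
  obtain Cq where Cq: "Cq < \<infinity>" "\<And>g h. pos_meas g \<Longrightarrow> pos_meas h \<Longrightarrow>
      haar_norm q (\<lambda>u. g u + h u) \<le> Cq * (haar_norm q g + haar_norm q h)"
    using haar_norm_add[OF q_pos] by metis
  obtain Cr where Cr: "Cr < \<infinity>" "1 \<le> Cr" "\<And>g h. pos_meas g \<Longrightarrow> pos_meas h \<Longrightarrow>
      haar_norm r (\<lambda>u. g u + h u) \<le> Cr * (haar_norm r g + haar_norm r h)"
    using haar_norm_add[OF r_pos] by metis
  have "tail_part (\<lambda>u. k u + k' u) t \<le> Cr * Cq * (tail_part k t + tail_part k' t)"
    if k: "pos_meas k" "pos_meas k'" for k k' t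
  proof -
    have 1: "tail_norm (\<lambda>u. k u + k' u) s \<le> Cq * (tail_norm k s + tail_norm k' s)" for s
    proof -
      have "tail_norm (\<lambda>u. k u + k' u) s = haar_norm q (\<lambda>u.
          indicator {s<..} u * (ennreal (1 / u) * \<alpha> u * k u) + indicator {s<..} u * (ennreal (1 / u) * \<alpha> u * k' u))"
        unfolding tail_norm_def by (simp only: distrib_left)
      also have "\<dots> \<le> Cq * (tail_norm k s + tail_norm k' s)"
        unfolding tail_norm_def by (intro Cq(2) meas_intros k) auto
      finally show ?thesis .
    qed
    have "tail_iter (\<lambda>u. k u + k' u) t \<le>
        haar_norm r (\<lambda>s. Cq * (indicator {t<..} s * (\<beta> s * tail_norm k s) + indicator {t<..} s * (\<beta> s * tail_norm k' s)))"
      unfolding tail_iter_def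
    proof (rule haar_norm_mono[OF r_pos])
      fix s
      have "indicator {t<..} s * (\<beta> s * tail_norm (\<lambda>u. k u + k' u) s) \<le>
          indicator {t<..} s * (\<beta> s * (Cq * (tail_norm k s + tail_norm k' s)))"
        using 1 by (intro mult_left_mono) auto
      then show "indicator {t<..} s * (\<beta> s * tail_norm (\<lambda>u. k u + k' u) s) \<le>
          Cq * (indicator {t<..} s * (\<beta> s * tail_norm k s) + indicator {t<..} s * (\<beta> s * tail_norm k' s))"
        by (simp add: distrib_left ac_simps)
    qed
    also have "\<dots> = Cq * haar_norm r (\<lambda>s. indicator {t<..} s * (\<beta> s * tail_norm k s) + indicator {t<..} s * (\<beta> s * tail_norm k' s))"
      by (intro haar_norm_cmult r_pos meas_intros) auto
    also have "\<dots> \<le> Cq * (Cr * (tail_iter k t + tail_iter k' t))"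
      unfolding tail_iter_def by (intro mult_left_mono Cr(3) meas_intros) auto
    finally have 2: "tail_iter (\<lambda>u. k u + k' u) t \<le> Cr * Cq * (tail_iter k t + tail_iter k' t)"
      by (simp add: ac_simps)
    have "head_b t * tail_norm (\<lambda>u. k u + k' u) t \<le> head_b t * (Cq * (tail_norm k t + tail_norm k' t))"
      using 1 by (intro mult_left_mono) auto
    also have "\<dots> = 1 * (Cq * (head_b t * tail_norm k t + head_b t * tail_norm k' t))"
      by (simp add: distrib_left ac_simps)
    also have "\<dots> \<le> Cr * (Cq * (head_b t * tail_norm k t + head_b t * tail_norm k' t))"
      using Cr(2) by (rule mult_right_mono) simp
    finally have "tail_part (\<lambda>u. k u + k' u) t \<le>
        Cr * (Cq * (head_b t * tail_norm k t + head_b t * tail_norm k' t)) + Cr * Cq * (tail_iter k t + tail_iter k' t)"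
      unfolding tail_part_def using 2 by (rule add_mono)
    also have "\<dots> = Cr * Cq * (tail_part k t + tail_part k' t)"
      by (simp add: tail_part_def distrib_left ac_simps)
    finally show ?thesis .
  qed
  then show ?thesis using that[of "Cr * Cq"] Cr(1) Cq(1) by (auto simp: ennreal_mult_less_top)
qed

lemma rho_chi_over_t: "0 < t \<Longrightarrow> ennreal (\<rho> t) * (ennreal (1 / t) * chi1 t) = 1"
proof -
  assume t: "0 < t"
  have "ennreal (\<rho> t) * (ennreal (1 / t) * chi1 t) = ennreal (1 / t) * (ennreal (\<rho> t) * chi1 t)"
    by (simp only: ac_simps)
  then show ?thesis using t by (simp add: rho_times_chi flip: ennreal_mult)
qed

text \<open>
  Both summands are at most a multiple of \<open>head_b t * a t / t\<close>, hence of \<open>\<chi>(t) / t = 1 / \<rho>(t)\<close>.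
  It follows that the \<open>A0\<close>-component of a decomposition does not affect the tails.
\<close>

lemma tail_part_const: obtains C where "C < \<infinity>" "\<And>t. 0 < t \<Longrightarrow> ennreal (\<rho> t) * tail_part (\<lambda>_. 1) t \<le> C"
proof -
  obtain C1 where C1: "C1 < \<infinity>" "\<And>t. 0 < t \<Longrightarrow> tail_norm (\<lambda>_. 1) t \<le> C1 * (ennreal (1 / t) * \<alpha> t)"
    by (rule slow_tail[OF slow_a meas_a q_pos]) (rule that; simp add: tail_norm_def)
  obtain C2 where C2: "C2 < \<infinity>" "\<And>t. 0 < t \<Longrightarrow>
      haar_norm r (\<lambda>u. indicator {t<..} u * (ennreal (1 / u) * (\<beta> u * \<alpha> u))) \<le> C2 * (ennreal (1 / t) * (\<beta> t * \<alpha> t))"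
    by (rule slow_tail[OF slow_mult[OF slow_b slow_a] borel_measurable_times_ennreal[OF meas_b meas_a] r_pos]) (rule that; blast)
  obtain C3 where C3: "C3 < \<infinity>" "\<And>t. 0 < t \<Longrightarrow> head_b t * \<alpha> t \<le> C3 * chi1 t"
    using head_b_a_le_chi by metis
  obtain C4 where C4: "C4 < \<infinity>" "\<And>t. 0 < t \<Longrightarrow> \<beta> t \<le> C4 * head_b t"
    using b_le_head_b by metis
  let ?C = "C1 * C3 + C1 * C2 * C4 * C3"
  have "ennreal (\<rho> t) * tail_part (\<lambda>_. 1) t \<le> ?C" if t: "0 < t" for t
  proof -
    have "head_b t * tail_norm (\<lambda>_. 1) t \<le> head_b t * (C1 * (ennreal (1 / t) * \<alpha> t))"
      using C1(2)[OF t] by (rule mult_left_mono) simp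
    also have "\<dots> = C1 * (ennreal (1 / t) * (head_b t * \<alpha> t))" by (simp add: ac_simps)
    also have "\<dots> \<le> C1 * (ennreal (1 / t) * (C3 * chi1 t))"
      using C3(2)[OF t] by (intro mult_left_mono) auto
    finally have 1: "head_b t * tail_norm (\<lambda>_. 1) t \<le> C1 * C3 * (ennreal (1 / t) * chi1 t)"
      by (simp add: ac_simps)
    have "tail_iter (\<lambda>_. 1) t \<le> haar_norm r (\<lambda>s. C1 * (indicator {t<..} s * (ennreal (1 / s) * (\<beta> s * \<alpha> s))))"
      unfolding tail_iter_def
    proof (rule haar_norm_mono[OF r_pos])
      fix s :: real assume "0 < s"
      have "indicator {t<..} s * (\<beta> s * tail_norm (\<lambda>_. 1) s) \<le> indicator {t<..} s * (\<beta> s * (C1 * (ennreal (1 / s) * \<alpha> s)))"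
        using C1(2)[OF \<open>0 < s\<close>] by (intro mult_left_mono) auto
      then show "indicator {t<..} s * (\<beta> s * tail_norm (\<lambda>_. 1) s) \<le> C1 * (indicator {t<..} s * (ennreal (1 / s) * (\<beta> s * \<alpha> s)))"
        by (simp add: ac_simps)
    qed
    also have "\<dots> = C1 * haar_norm r (\<lambda>s. indicator {t<..} s * (ennreal (1 / s) * (\<beta> s * \<alpha> s)))"
      by (intro haar_norm_cmult r_pos meas_intros pos_meas_inverse) auto
    also have "\<dots> \<le> C1 * (C2 * (ennreal (1 / t) * ((C4 * head_b t) * \<alpha> t)))"
      using C4(2)[OF t] by (intro mult_left_mono order.trans[OF C2(2)[OF t]] mult_right_mono) auto
    also have "\<dots> = C1 * (C2 * (ennreal (1 / t) * (C4 * (head_b t * \<alpha> t))))" by (simp add: ac_simps)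
    also have "\<dots> \<le> C1 * (C2 * (ennreal (1 / t) * (C4 * (C3 * chi1 t))))"
      using C3(2)[OF t] by (intro mult_left_mono) auto
    finally have 2: "tail_iter (\<lambda>_. 1) t \<le> C1 * C2 * C4 * C3 * (ennreal (1 / t) * chi1 t)"
      by (simp add: ac_simps)
    have "ennreal (\<rho> t) * tail_part (\<lambda>_. 1) t \<le> ennreal (\<rho> t) * (?C * (ennreal (1 / t) * chi1 t))"
      unfolding tail_part_def using cmult_le_add[OF 1 2] by (rule mult_left_mono) simp
    also have "\<dots> = ?C * (ennreal (\<rho> t) * (ennreal (1 / t) * chi1 t))" by (simp only: ac_simps)
    finally show ?thesis by (simp add: rho_chi_over_t[OF t])
  qed
  then show ?thesis using that[of ?C] C1(1) C2(1) C3(1) C4(1) by (auto simp: ennreal_mult_less_top)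
qed

text \<open>For outer variables \<open>s < t\<close> the inner norm is split at \<open>t\<close>.\<close>

lemma full_norm_le_parts:
  obtains C where "C < \<infinity>" "\<And>k t. pos_meas k \<Longrightarrow> 0 < t \<Longrightarrow> full_norm k \<le> C * (head_part k t + tail_part k t)"
proof -
  obtain Cq where Cq: "Cq < \<infinity>" "\<And>g h. pos_meas g \<Longrightarrow> pos_meas h \<Longrightarrow>
      haar_norm q (\<lambda>u. g u + h u) \<le> Cq * (haar_norm q g + haar_norm q h)"
    using haar_norm_add[OF q_pos] by metis
  obtain Cr where Cr: "Cr < \<infinity>" "1 \<le> Cr" "\<And>g h. pos_meas g \<Longrightarrow> pos_meas h \<Longrightarrow>
      haar_norm r (\<lambda>u. g u + h u) \<le> Cr * (haar_norm r g + haar_norm r h)"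
    using haar_norm_add[OF r_pos] by metis
  define D where "D = Cq + 1"
  have "full_norm k \<le> Cr * Cr * D * (head_part k t + tail_part k t)" if k: "pos_meas k" and t: "0 < t" for k t
  proof -
    have split: "tail_norm k s \<le> Cq * (window_norm k s t + tail_norm k t)" if "s < t" for s
    proof -
      let ?g = "\<lambda>u. ennreal (1 / u) * \<alpha> u * k u"
      have "tail_norm k s \<le> haar_norm q (\<lambda>u. indicator {s<..<t} u * ?g u + indicator {t<..} u * ?g u)"
        unfolding tail_norm_def by (rule haar_norm_mono_except[OF q_pos, of t]) (auto simp: indicator_def)
      also have "\<dots> \<le> Cq * (window_norm k s t + tail_norm k t)"
        unfolding tail_norm_def window_norm_def by (intro Cq(2) meas_intros k) auto
      finally show ?thesis .
    qed
    let ?h1 = "\<lambda>s. indicator {0<..<t} s * (\<beta> s * window_norm k s t)"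
    let ?h2 = "\<lambda>s. tail_norm k t * (indicator {0<..<t} s * \<beta> s)"
    let ?h3 = "\<lambda>s. indicator {t<..} s * (\<beta> s * tail_norm k s)"
    have "full_norm k \<le> haar_norm r (\<lambda>s. D * (?h1 s + (?h2 s + ?h3 s)))"
      unfolding full_norm_def
    proof (rule haar_norm_mono_except[OF r_pos, of t])
      fix s :: real assume s: "0 < s" "s \<noteq> t"
      show "\<beta> s * tail_norm k s \<le> D * (?h1 s + (?h2 s + ?h3 s))"
      proof (cases "s < t")
        case True
        have "\<beta> s * tail_norm k s \<le> \<beta> s * (Cq * (window_norm k s t + tail_norm k t))"
          using split[OF True] by (rule mult_left_mono) simp
        also have "\<dots> = Cq * (?h1 s + (?h2 s + ?h3 s))" using True s by (simp add: distrib_left ac_simps)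
        also have "\<dots> \<le> D * (?h1 s + (?h2 s + ?h3 s))" unfolding D_def by (intro mult_right_mono) auto
        finally show ?thesis .
      next
        case False
        have "1 * (\<beta> s * tail_norm k s) \<le> D * (\<beta> s * tail_norm k s)" unfolding D_def by (intro mult_right_mono) auto
        then show ?thesis using False s by simp
      qed
    qed
    also have "\<dots> = D * haar_norm r (\<lambda>s. ?h1 s + (?h2 s + ?h3 s))"
      by (intro haar_norm_cmult r_pos meas_intros) auto
    also have "\<dots> \<le> D * (Cr * (haar_norm r ?h1 + haar_norm r (\<lambda>s. ?h2 s + ?h3 s)))"
      by (intro mult_left_mono Cr(3) meas_intros) auto
    also have "\<dots> \<le> D * (Cr * (haar_norm r ?h1 + Cr * (haar_norm r ?h2 + haar_norm r ?h3)))"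
      by (intro mult_left_mono add_left_mono Cr(3) meas_intros) auto
    also have "haar_norm r ?h2 = tail_norm k t * head_b t"
      unfolding head_b_def by (intro haar_norm_cmult r_pos meas_intros) auto
    also have "haar_norm r ?h1 = head_part k t" by (simp add: head_part_def)
    also have "haar_norm r ?h3 = tail_iter k t" by (simp add: tail_iter_def)
    also have "D * (Cr * (head_part k t + Cr * (tail_norm k t * head_b t + tail_iter k t))) \<le>
        D * (Cr * (Cr * head_part k t + Cr * (tail_norm k t * head_b t + tail_iter k t)))"
      using mult_right_mono[OF Cr(2), of "head_part k t"] by (intro mult_left_mono add_right_mono) auto
    finally show ?thesis by (simp add: tail_part_def distrib_left ac_simps)
  qed
  then show ?thesis using that[of "Cr * Cr * D"] Cr(1) Cq(1) by (auto simp: ennreal_mult_less_top D_def)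
qed

lemma head_part_le_full_norm: "0 < t \<Longrightarrow> head_part k t \<le> full_norm k"
  unfolding head_part_def full_norm_def window_norm_def tail_norm_def
  by (rule haar_norm_mono[OF r_pos])
    (auto simp: indicator_def intro!: mult_left_mono haar_norm_mono[OF q_pos])

lemma tail_part_le_full_norm: "0 < t \<Longrightarrow> tail_part k t \<le> 2 * full_norm k"
proof -
  have "head_b t * tail_norm k t = haar_norm r (\<lambda>s. tail_norm k t * (indicator {0<..<t} s * \<beta> s))"
    unfolding head_b_def
    by (subst haar_norm_cmult[OF r_pos]) (auto intro!: meas_intros simp: mult.commute)
  also have "\<dots> \<le> full_norm k"
    unfolding full_norm_def
    by (rule haar_norm_mono[OF r_pos])
      (auto simp: indicator_def mult.commute intro!: mult_left_mono tail_norm_antimono)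
  finally have 1: "head_b t * tail_norm k t \<le> full_norm k" .
  have "tail_iter k t \<le> full_norm k"
    unfolding tail_iter_def full_norm_def by (rule haar_norm_mono[OF r_pos]) (auto simp: indicator_def)
  with 1 show ?thesis unfolding tail_part_def mult_2 by (rule add_mono)
qed

lemma head_part_mono:
  assumes "\<And>u. 0 < u \<Longrightarrow> u < t \<Longrightarrow> k u \<le> k' u"
  shows "head_part k t \<le> head_part k' t"
proof -
  have "window_norm k s t \<le> window_norm k' s t" for s
    unfolding window_norm_def
    by (rule haar_norm_mono[OF q_pos]) (auto simp: indicator_def assms intro!: mult_left_mono)
  then show ?thesis unfolding head_part_def
    by (intro haar_norm_mono[OF r_pos] mult_left_mono) auto
qed

text \<open>
  The origin of \<open>\<chi>\<close>: it is the contribution of \<open>(0, t)\<close> for \<open>k(u) = u\<close>.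
\<close>

lemma head_part_linear: "head_part (\<lambda>u. c * ennreal u) t = c * chi1 t"
proof -
  have "window_norm (\<lambda>u. c * ennreal u) s t = c * local_norm s t" for s
  proof -
    have "window_norm (\<lambda>u. c * ennreal u) s t = haar_norm q (\<lambda>u. c * (indicator {s<..<t} u * \<alpha> u))"
      unfolding window_norm_def
    proof (rule haar_norm_cong)
      fix u :: real assume "0 < u"
      then have "ennreal (1 / u) * ennreal u = 1" by (simp flip: ennreal_mult)
      moreover have "ennreal (1 / u) * \<alpha> u * (c * ennreal u) = (ennreal (1 / u) * ennreal u) * (c * \<alpha> u)"
        by (simp only: ac_simps)
      ultimately show "indicator {s<..<t} u * (ennreal (1 / u) * \<alpha> u * (c * ennreal u)) = c * (indicator {s<..<t} u * \<alpha> u)"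
        by (simp add: ac_simps)
    qed
    also have "\<dots> = c * local_norm s t"
      unfolding local_norm_def by (intro haar_norm_cmult q_pos meas_intros) auto
    finally show ?thesis .
  qed
  then have "head_part (\<lambda>u. c * ennreal u) t = haar_norm r (\<lambda>s. c * (indicator {0<..<t} s * (\<beta> s * local_norm s t)))"
    unfolding head_part_def by (simp add: ac_simps)
  also have "\<dots> = c * chi1 t"
    unfolding chi_eq by (intro haar_norm_cmult r_pos meas_intros meas_local_norm) auto
  finally show ?thesis .
qed

lemma tail_norm_Lq:
  "0 < t \<Longrightarrow> Lq_norm q {t<..} (\<lambda>u. ennreal (u powr (- 1 - recip q) * a u) * k u) = tail_norm k t"
proof -
  assume t: "0 < t"
  have "Lq_norm q {t<..} (\<lambda>u. ennreal (u powr (- 1 - recip q) * a u) * k u) =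
      haar_norm q (\<lambda>u. indicator {t<..} u * (ennreal (u powr (- 1) * a u) * k u))"
    unfolding powr_weight_split mult.assoc using t by (intro haar_norm_restrict q_pos) auto
  also have "\<dots> = tail_norm k t"
    unfolding tail_norm_def by (rule haar_norm_cong) (simp add: powr_minus_divide ennreal_mult'[symmetric])
  finally show ?thesis .
qed

lemma weights_nonzero: "0 < u \<Longrightarrow> \<alpha> u \<noteq> 0" "0 < u \<Longrightarrow> \<beta> u \<noteq> 0"
  using slow_a slow_b unfolding slow_def by (metis less_irrefl)+

lemma tail_norm_top:
  assumes "0 < t" "\<And>u. 0 < u \<Longrightarrow> k u = \<infinity>"
  shows "tail_norm k t = \<infinity>"
  unfolding tail_norm_def
proof (rule haar_norm_eq_top[OF q_pos assms(1)])
  fix u assume u: "t < u"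
  then have "\<alpha> u \<noteq> 0" "ennreal (1 / u) \<noteq> 0" using assms(1) weights_nonzero(1)[of u] by auto
  then show "indicator {t<..} u * (ennreal (1 / u) * \<alpha> u * k u) = \<infinity>"
    using u assms by (simp add: ennreal_mult_top)
qed

lemma tail_iter_top:
  assumes "0 < t" "\<And>u. 0 < u \<Longrightarrow> k u = \<infinity>"
  shows "tail_iter k t = \<infinity>"
  unfolding tail_iter_def
proof (rule haar_norm_eq_top[OF r_pos assms(1)])
  fix u assume u: "t < u"
  then have "\<beta> u \<noteq> 0" using assms(1) weights_nonzero(2)[of u] by auto
  moreover have "tail_norm k u = \<infinity>" using u assms by (intro tail_norm_top) auto
  ultimately show "indicator {t<..} u * (\<beta> u * tail_norm k u) = \<infinity>"
    using u by (simp add: ennreal_mult_top)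
qed

lemma weighted_top:
  assumes "0 < p" "\<And>t. 0 < t \<Longrightarrow> 0 < w t" "\<And>t. 0 < t \<Longrightarrow> h t = \<infinity>"
  shows "haar_norm p (\<lambda>t. ennreal (w t) * h t) = \<infinity>"
proof (rule haar_norm_eq_top[OF assms(1), of 1])
  fix u :: real assume "1 < u"
  then have "ennreal (w u) \<noteq> 0" "h u = \<infinity>" using assms(2)[of u] assms(3)[of u] by auto
  then show "ennreal (w u) * h u = \<infinity>" by (simp add: ennreal_mult_top)
qed simp

lemma interp_R_eq:
  assumes "0 < p" "\<And>t. 0 < t \<Longrightarrow> 0 < w t"
  shows "interp_R X0 X1 1 p w q a f =
    haar_norm p (\<lambda>t. ennreal (w t) * tail_norm (\<lambda>u. K_fun X0 X1 u f) t)"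
proof (cases "f \<in> sum_space X0 X1")
  case True
  have "interp_R X0 X1 1 p w q a f = haar_norm p (\<lambda>t. ennreal (w t) *
      Lq_norm q {t<..} (\<lambda>u. ennreal (u powr (- 1 - recip q) * a u) * K_fun X0 X1 u f))"
    using True by (simp add: interp_R_def haar_norm_def ennreal_mult' mult.assoc)
  also have "\<dots> = haar_norm p (\<lambda>t. ennreal (w t) * tail_norm (\<lambda>u. K_fun X0 X1 u f) t)"
    by (rule haar_norm_cong) (simp only: tail_norm_Lq)
  finally show ?thesis .
next
  case False
  have "haar_norm p (\<lambda>t. ennreal (w t) * tail_norm (\<lambda>u. K_fun X0 X1 u f) t) = \<infinity>"
    using assms by (intro weighted_top tail_norm_top K_fun_off_sum_space[OF False])
  then show ?thesis using False by (simp add: interp_R_def)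
qed

lemma interp_RR_eq:
  assumes "0 < p" "\<And>t. 0 < t \<Longrightarrow> 0 < w t"
  shows "interp_RR X0 X1 1 p w r b q a f =
    haar_norm p (\<lambda>t. ennreal (w t) * tail_iter (\<lambda>u. K_fun X0 X1 u f) t)"
proof (cases "f \<in> sum_space X0 X1")
  case True
  let ?L = "\<lambda>u. Lq_norm q {u<..} (\<lambda>v. ennreal (v powr (- 1 - recip q) * a v) * K_fun X0 X1 v f)"
  have "Lq_norm r {t<..} (\<lambda>u. ennreal (u powr (- recip r) * b u) * ?L u) = tail_iter (\<lambda>u. K_fun X0 X1 u f) t"
    if t: "0 < t" for t
  proof -
    have "Lq_norm r {t<..} (\<lambda>u. ennreal (u powr (- recip r) * b u) * ?L u) =
        haar_norm r (\<lambda>u. indicator {t<..} u * (\<beta> u * ?L u))"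
      using t by (subst haar_norm_restrict[OF r_pos, symmetric]) (auto simp: ennreal_mult' mult.assoc)
    also have "\<dots> = tail_iter (\<lambda>u. K_fun X0 X1 u f) t"
      unfolding tail_iter_def by (rule haar_norm_cong) (simp only: tail_norm_Lq)
    finally show ?thesis .
  qed
  then have "haar_norm p (\<lambda>t. ennreal (w t) * Lq_norm r {t<..} (\<lambda>u. ennreal (u powr (- recip r) * b u) * ?L u)) =
      haar_norm p (\<lambda>t. ennreal (w t) * tail_iter (\<lambda>u. K_fun X0 X1 u f) t)"
    by (intro haar_norm_cong) simp
  then show ?thesis
    using True by (simp add: interp_RR_def haar_norm_def ennreal_mult' mult.assoc)
next
  case False
  have "haar_norm p (\<lambda>t. ennreal (w t) * tail_iter (\<lambda>u. K_fun X0 X1 u f) t) = \<infinity>"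
    using assms by (intro weighted_top tail_iter_top K_fun_off_sum_space[OF False])
  then show ?thesis using False by (simp add: interp_RR_def)
qed

lemma interp_R_full_norm:
  "interp_R X0 X1 1 r b q a f = full_norm (\<lambda>u. K_fun X0 X1 u f)"
  unfolding full_norm_def using b_SV by (intro interp_R_eq r_pos) (auto simp: SV_def)

section \<open>The Holmstedt formula\<close>

text \<open>
  Use the given decomposition \<open>f = f0 + f1\<close> in \<open>A0 + A1\<close> also for \<open>A0\<close> and \<open>Y\<close>, and split the
  quasi-norm of \<open>f1\<close> in \<open>Y\<close> at \<open>t\<close>. The head is estimated by \<open>K(u, f1) \<le> u * A1 f1\<close>, the tail by
  \<open>K(u, f1) \<le> C * (A0 f0 + K(u, f))\<close>.
\<close>

lemma holmstedt_upper:
  assumes A0: "quasi_norm A0"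
  obtains C where "C < \<infinity>" "\<And>A1 f t. 0 < t \<Longrightarrow>
    K_fun A0 (interp_R A0 A1 1 r b q a) (\<rho> t) f \<le>
      C * (K_fun A0 A1 t f + ennreal (\<rho> t) * tail_part (\<lambda>u. K_fun A0 A1 u f) t)"
proof -
  obtain C1 where C1: "C1 < \<infinity>" "\<And>k t. pos_meas k \<Longrightarrow> 0 < t \<Longrightarrow> full_norm k \<le> C1 * (head_part k t + tail_part k t)"
    by (rule full_norm_le_parts) (rule that; blast)
  obtain C2 where C2: "C2 < \<infinity>" "\<And>k k' t. pos_meas k \<Longrightarrow> pos_meas k' \<Longrightarrow>
    tail_part (\<lambda>u. k u + k' u) t \<le> C2 * (tail_part k t + tail_part k' t)"
    by (rule tail_part_add) (rule that; blast)
  obtain C3 where C3: "C3 < \<infinity>" "\<And>t. 0 < t \<Longrightarrow> ennreal (\<rho> t) * tail_part (\<lambda>_. 1) t \<le> C3"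
    by (rule tail_part_const) (rule that; blast)
  obtain CA where CA: "CA < \<infinity>" "1 \<le> CA"
    "\<And>f g h X1 t. f = g + h \<Longrightarrow> 0 < t \<Longrightarrow> K_fun A0 X1 t f \<le> CA * (A0 g + K_fun A0 X1 t h)"
    by (rule K_fun_add_left[OF A0]) (rule that; blast)
  have neg: "A0 (- x) = A0 x" for x
  proof -
    have "A0 ((-1) *\<^sub>R x) = ennreal \<bar>-1\<bar> * A0 x" using A0 unfolding quasi_norm_def by blast
    then show ?thesis by simp
  qed
  have zero: "A0 0 = 0" using A0 unfolding quasi_norm_def by blast
  define B where "B = 1 + C1 + C1 * (CA * C2 * C3)"
  define D where "D = C1 * (CA * C2)"
  have "K_fun A0 (interp_R A0 A1 1 r b q a) (\<rho> t) f \<le>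
      (B + D) * (K_fun A0 A1 t f + ennreal (\<rho> t) * tail_part (\<lambda>u. K_fun A0 A1 u f) t)"
    if t: "0 < t" for A1 f t
  proof -
    let ?Y = "interp_R A0 A1 1 r b q a" and ?K = "\<lambda>g u. K_fun A0 A1 u g"
    let ?T = "ennreal (\<rho> t) * tail_part (?K f) t"
    have "K_fun A0 ?Y (\<rho> t) f \<le> D * ?T + B * Inf {A0 f0 + ennreal t * A1 f1 | f0 f1.
            f = f0 + f1 \<and> f0 \<in> carrier_of A0 \<and> f1 \<in> carrier_of A1}"
    proof (rule le_affine_Inf)
      show "B < \<infinity>" using C1(1) C2(1) C3(1) CA(1) by (auto simp: B_def ennreal_mult_less_top)
      show "B \<noteq> 0" by (auto simp: B_def)
      fix x assume "x \<in> {A0 f0 + ennreal t * A1 f1 | f0 f1. f = f0 + f1 \<and> f0 \<in> carrier_of A0 \<and> f1 \<in> carrier_of A1}"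
      then obtain f0 f1 where x: "x = A0 f0 + ennreal t * A1 f1" and f: "f = f0 + f1" by blast
      have f0_le: "A0 f0 \<le> x" by (simp add: x)
      have K1: "?K f1 u \<le> A1 f1 * ennreal u" if "0 < u" for u
        using K_fun_le[of f1 0 f1 u A0 A1] that by (simp add: zero mult.commute)
      have K2: "?K f1 u \<le> CA * (A0 f0 * 1 + ?K f u)" if "0 < u" for u
        using CA(3)[of f1 "- f0" f u A1] that f by (simp add: neg)
      have "ennreal (\<rho> t) * head_part (?K f1) t \<le> ennreal (\<rho> t) * head_part (\<lambda>u. A1 f1 * ennreal u) t"
        using K1 by (intro mult_left_mono head_part_mono) auto
      also have "\<dots> = ennreal (\<rho> t) * chi1 t * A1 f1" by (simp add: head_part_linear ac_simps)
      also have "\<dots> \<le> x" by (simp add: rho_times_chi[OF t] x)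
      finally have head: "ennreal (\<rho> t) * head_part (?K f1) t \<le> x" .
      have "tail_part (?K f1) t \<le> tail_part (\<lambda>u. CA * (A0 f0 * 1 + ?K f u)) t"
        using K2 by (rule tail_part_mono)
      also have "\<dots> = CA * tail_part (\<lambda>u. A0 f0 * 1 + ?K f u) t"
        by (rule tail_part_cmult) (intro borel_measurable_add borel_measurable_const K_fun_meas)
      also have "\<dots> \<le> CA * (C2 * (tail_part (\<lambda>u. A0 f0 * 1) t + tail_part (?K f) t))"
        by (intro mult_left_mono C2(2) K_fun_meas borel_measurable_const) auto
      also have "tail_part (\<lambda>u. A0 f0 * 1) t = A0 f0 * tail_part (\<lambda>_. 1) t"
        by (rule tail_part_cmult) simp
      finally have "ennreal (\<rho> t) * tail_part (?K f1) t \<le>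
          ennreal (\<rho> t) * (CA * (C2 * (A0 f0 * tail_part (\<lambda>_. 1) t + tail_part (?K f) t)))"
        by (rule mult_left_mono) simp
      also have "\<dots> = CA * (C2 * (A0 f0 * (ennreal (\<rho> t) * tail_part (\<lambda>_. 1) t) + ?T))"
        by (simp add: distrib_left ac_simps)
      also have "\<dots> \<le> CA * (C2 * (x * C3 + ?T))"
        using C3(2)[OF t] f0_le by (intro mult_left_mono add_right_mono mult_mono) auto
      finally have tail: "ennreal (\<rho> t) * tail_part (?K f1) t \<le> CA * (C2 * (x * C3 + ?T))" .
      have "K_fun A0 ?Y (\<rho> t) f \<le> A0 f0 + ennreal (\<rho> t) * ?Y f1"
        using f rho_pos[OF t] by (rule K_fun_le)
      also have "\<dots> \<le> x + ennreal (\<rho> t) * (C1 * (head_part (?K f1) t + tail_part (?K f1) t))"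
        unfolding interp_R_full_norm by (intro add_mono f0_le mult_left_mono C1(2) K_fun_meas t) auto
      also have "\<dots> = x + C1 * (ennreal (\<rho> t) * head_part (?K f1) t + ennreal (\<rho> t) * tail_part (?K f1) t)"
        by (simp add: distrib_left ac_simps)
      also have "\<dots> \<le> x + C1 * (x + CA * (C2 * (x * C3 + ?T)))"
        using head tail by (intro add_left_mono mult_left_mono add_mono) auto
      also have "\<dots> = D * ?T + B * x"
        by (simp add: B_def D_def distrib_left distrib_right ac_simps)
      finally show "K_fun A0 ?Y (\<rho> t) f \<le> D * ?T + B * x" .
    qed
    also have "\<dots> \<le> (B + D) * (K_fun A0 A1 t f + ?T)"
    proof -
      have "D * ?T + B * x \<le> (B + D) * ?T + (B + D) * x" for x
        by (intro add_mono mult_right_mono) auto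
      then have "D * ?T + B * x \<le> (B + D) * (x + ?T)" for x
        by (simp only: distrib_left add.commute)
      then show ?thesis by (simp add: K_fun_def)
    qed
    finally show ?thesis .
  qed
  note main = this
  have fin: "B + D < \<infinity>" using C1(1) C2(1) C3(1) CA(1) by (auto simp: B_def D_def ennreal_mult_less_top)
  show ?thesis by (rule that[OF fin]) (rule main)
qed

text \<open>
  For \<open>f = g0 + g1\<close> in \<open>A0 + Y\<close>, each term on the left is at most a multiple of the same term for
  \<open>g1\<close> plus \<open>A0 g0\<close>. The terms for \<open>g1\<close> are parts of its quasi-norm in \<open>Y\<close>: for \<open>K(t, g1)\<close> because
  \<open>K(u, g1) \<ge> (u / t) K(t, g1)\<close> on \<open>(0, t)\<close>.
\<close>

lemma holmstedt_lower:
  assumes A0: "quasi_norm A0"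
  obtains C where "C < \<infinity>" "\<And>A1 f t. 0 < t \<Longrightarrow>
      K_fun A0 A1 t f + ennreal (\<rho> t) * tail_part (\<lambda>u. K_fun A0 A1 u f) t \<le>
      C * K_fun A0 (interp_R A0 A1 1 r b q a) (\<rho> t) f"
proof -
  obtain C2 where C2: "C2 < \<infinity>" "\<And>k k' t. pos_meas k \<Longrightarrow> pos_meas k' \<Longrightarrow>
    tail_part (\<lambda>u. k u + k' u) t \<le> C2 * (tail_part k t + tail_part k' t)"
    by (rule tail_part_add) (rule that; blast)
  obtain C3 where C3: "C3 < \<infinity>" "\<And>t. 0 < t \<Longrightarrow> ennreal (\<rho> t) * tail_part (\<lambda>_. 1) t \<le> C3"
    by (rule tail_part_const) (rule that; blast)
  obtain CA where CA: "CA < \<infinity>" "1 \<le> CA"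
    "\<And>f g h X1 t. f = g + h \<Longrightarrow> 0 < t \<Longrightarrow> K_fun A0 X1 t f \<le> CA * (A0 g + K_fun A0 X1 t h)"
    by (rule K_fun_add_left[OF A0]) (rule that; blast)
  define B where "B = CA + CA * (C2 * (C3 + 2))"
  have "K_fun A0 A1 t f + ennreal (\<rho> t) * tail_part (\<lambda>u. K_fun A0 A1 u f) t \<le>
      B * K_fun A0 (interp_R A0 A1 1 r b q a) (\<rho> t) f" if t: "0 < t" for A1 f t
  proof -
    let ?Y = "interp_R A0 A1 1 r b q a" and ?K = "\<lambda>g u. K_fun A0 A1 u g"
    let ?p = "ennreal (\<rho> t)"
    have "?K f t + ?p * tail_part (?K f) t \<le> 0 + B * Inf {A0 f0 + ?p * ?Y f1 | f0 f1.
            f = f0 + f1 \<and> f0 \<in> carrier_of A0 \<and> f1 \<in> carrier_of ?Y}"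
    proof (rule le_affine_Inf)
      show "B < \<infinity>" using C2(1) C3(1) CA(1) by (auto simp: B_def ennreal_mult_less_top)
      show "B \<noteq> 0" using CA(2) by (auto simp: B_def)
      fix x assume "x \<in> {A0 f0 + ?p * ?Y f1 | f0 f1. f = f0 + f1 \<and> f0 \<in> carrier_of A0 \<and> f1 \<in> carrier_of ?Y}"
      then obtain g0 g1 where x: "x = A0 g0 + ?p * ?Y g1" and f: "f = g0 + g1" by blast
      let ?c = "ennreal (1 / t) * ?K g1 t"
      have "?K g1 t = ?p * (ennreal (1 / t) * chi1 t) * ?K g1 t" by (simp add: rho_chi_over_t[OF t])
      also have "\<dots> = ?p * (?c * chi1 t)" by (simp only: ac_simps)
      also have "?c * chi1 t = head_part (\<lambda>u. ?c * ennreal u) t" by (simp add: head_part_linear)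
      also have "\<dots> \<le> head_part (?K g1) t"
      proof (rule head_part_mono)
        fix u assume u: "0 < u" "u < t"
        have "?c * ennreal u = (ennreal (1 / t) * ennreal u) * ?K g1 t" by (simp only: ac_simps)
        also have "ennreal (1 / t) * ennreal u = ennreal (u / t)"
          using u t by (simp flip: ennreal_mult)
        finally have "?c * ennreal u = ennreal (u / t) * ?K g1 t" .
        also have "\<dots> \<le> ennreal (u / t) * (ennreal (t / u) * ?K g1 u)"
          using K_fun_scale[of t u A0 A1 g1] u t dil_le[of u t] dil_commute[of u t]
          by (intro mult_left_mono) auto
        also have "\<dots> = (ennreal (u / t) * ennreal (t / u)) * ?K g1 u" by (simp only: mult.assoc)
        also have "ennreal (u / t) * ennreal (t / u) = 1"
          using u t by (simp flip: ennreal_mult)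
        finally show "?c * ennreal u \<le> ?K g1 u" by simp
      qed
      also have "head_part (?K g1) t \<le> ?Y g1"
        unfolding interp_R_full_norm using t by (rule head_part_le_full_norm)
      finally have K1: "?K g1 t \<le> ?p * ?Y g1" by (simp add: mult_left_mono)
      have "?K f t \<le> CA * (A0 g0 + ?K g1 t)" using f t by (rule CA(3))
      also have "\<dots> \<le> CA * x" unfolding x using K1 by (intro mult_left_mono add_left_mono) auto
      finally have 1: "?K f t \<le> CA * x" .
      have "tail_part (?K f) t \<le> tail_part (\<lambda>u. CA * (A0 g0 * 1 + ?K g1 u)) t"
        using CA(3)[OF f] by (intro tail_part_mono) simp
      also have "\<dots> = CA * tail_part (\<lambda>u. A0 g0 * 1 + ?K g1 u) t"
        by (rule tail_part_cmult) (intro borel_measurable_add borel_measurable_const K_fun_meas)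
      also have "\<dots> \<le> CA * (C2 * (tail_part (\<lambda>u. A0 g0 * 1) t + tail_part (?K g1) t))"
        by (intro mult_left_mono C2(2) K_fun_meas borel_measurable_const) auto
      also have "tail_part (\<lambda>u. A0 g0 * 1) t = A0 g0 * tail_part (\<lambda>_. 1) t"
        by (rule tail_part_cmult) simp
      finally have "?p * tail_part (?K f) t \<le> ?p * (CA * (C2 * (A0 g0 * tail_part (\<lambda>_. 1) t + tail_part (?K g1) t)))"
        by (rule mult_left_mono) simp
      also have "\<dots> = CA * (C2 * (A0 g0 * (?p * tail_part (\<lambda>_. 1) t) + ?p * tail_part (?K g1) t))"
        by (simp add: distrib_left ac_simps)
      also have "\<dots> \<le> CA * (C2 * (A0 g0 * C3 + ?p * (2 * ?Y g1)))"
        unfolding interp_R_full_norm using C3(2)[OF t] tail_part_le_full_norm[OF t]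
        by (intro mult_left_mono add_mono) auto
      also have "\<dots> \<le> CA * (C2 * (x * C3 + 2 * x))"
        by (intro mult_left_mono add_mono mult_right_mono) (auto simp: x mult.left_commute intro!: mult_left_mono)
      finally have 2: "?p * tail_part (?K f) t \<le> CA * (C2 * (C3 + 2)) * x"
        by (simp add: distrib_left distrib_right ac_simps)
      show "?K f t + ?p * tail_part (?K f) t \<le> 0 + B * x"
        using cmult_le_add[OF 1 2] by (simp add: B_def)
    qed
    then show ?thesis by (simp add: K_fun_def)
  qed
  note main = this
  have fin: "B < \<infinity>" using C2(1) C3(1) CA(1) by (auto simp: B_def ennreal_mult_less_top)
  show ?thesis by (rule that[OF fin]) (rule main)
qed

end

section \<open>Interpolation between A0 and the limiting space\<close>

lemma borel_measurable_mono_ennreal: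
  fixes g :: "real \<Rightarrow> ennreal"
  assumes "mono g"
  shows "g \<in> borel_measurable borel"
proof (rule borel_measurableI_greater)
  fix y
  have "is_interval {x. y < g x}"
    unfolding is_interval_1 using assms by (auto simp: mono_def intro: order_less_le_trans)
  then show "{x \<in> space borel. y < g x} \<in> sets borel"
    using real_interval_borel_measurable by simp
qed

lemma cont_embeddedI:
  assumes "C < \<infinity>" "\<And>f. Y f \<le> C * X f"
  shows "cont_embedded X Y"
  unfolding cont_embedded_def
proof (intro conjI exI ballI)
  have C: "ennreal (enn2real C) = C" using assms(1) by simp
  show "Y f \<le> ennreal (enn2real C) * X f" for f unfolding C by (rule assms(2))
  show "carrier_of X \<subseteq> carrier_of Y"
  proof
    fix f assume "f \<in> carrier_of X"
    then have "C * X f < \<infinity>" using assms(1) by (auto simp: carrier_of_def ennreal_mult_less_top)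
    then show "f \<in> carrier_of Y"
      using assms(2)[of f] by (auto simp: carrier_of_def)
  qed
qed

text \<open>
  The exponent \<open>p\<close> and the weight \<open>c\<close> belong to the outer interpolation space; in the theorem they are
  \<open>r\<close> and \<open>a\<close>.
\<close>

locale interpolation = weights +
  fixes A0 A1 :: "'v::real_vector \<Rightarrow> ennreal" and p :: ennreal and c :: "real \<Rightarrow> real"
  assumes A0: "quasi_norm A0" and p_pos: "0 < p" and c_SV: "c \<in> SV"
begin

abbreviation Y :: "'v \<Rightarrow> ennreal" where "Y \<equiv> interp_R A0 A1 1 r b q a"
abbreviation K :: "'v \<Rightarrow> real \<Rightarrow> ennreal" where "K f u \<equiv> K_fun A0 A1 u f"

text \<open>
  The weight in front of \<open>K(\<rho>(t), f; A0, Y)\<close> after the substitution \<open>u = \<rho>(t)\<close>.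
\<close>

definition w :: "real \<Rightarrow> real \<Rightarrow> ennreal" where
  "w \<theta> t = ennreal (\<rho> t powr (- \<theta>) * c (\<rho> t))"

lemma c_pos: "0 < t \<Longrightarrow> 0 < c t"
  using c_SV by (auto simp: SV_def)

lemma rho_growth: obtains L where "sublinear_growth \<rho> L"
proof -
  obtain L where "1 \<le> L" "\<And>s t. 0 < s \<Longrightarrow> s \<le> t \<Longrightarrow> sqrt (t / s) * \<rho> s \<le> L * \<rho> t"
    using rho_lower by metis
  then have "sublinear_growth \<rho> L"
    by (intro sublinear_growth.intro rho_pos rho_upper)
  then show ?thesis by (rule that)
qed

text \<open>
  Measurability of \<open>\<rho>\<close> is known on \<open>(0, \<infinity>)\<close> only, so \<open>\<rho>\<close> is first extended by a constant.
\<close>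

lemma pos_meas_comp_rho:
  assumes g: "g \<in> borel_measurable borel"
  shows "pos_meas (\<lambda>t. g (\<rho> t))"
proof -
  let ?\<rho> = "\<lambda>t. if t \<in> {0<..} then \<rho> t else 1"
  have \<rho>: "?\<rho> \<in> borel_measurable borel"
    using rho_measurable by (subst measurable_If_restrict_space_iff) (auto simp: greaterThan_def)
  have "pos_meas (\<lambda>t. g (?\<rho> t)) \<longleftrightarrow> pos_meas (\<lambda>t. g (\<rho> t))"
    by (rule measurable_cong) (simp add: space_restrict_space)
  then show ?thesis
    using pos_meas_borel[OF measurable_compose[OF \<rho> g]] by blast
qed

lemma meas_rho: "pos_meas (\<lambda>t. ennreal (\<rho> t))"
  by (rule pos_meas_comp_rho[OF measurable_ennreal])

lemma meas_K_Y_rho: "pos_meas (\<lambda>t. K_fun A0 Y (\<rho> t) f)"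
  by (intro pos_meas_comp_rho[of "\<lambda>s. K_fun A0 Y s f"] borel_measurable_mono_ennreal)
    (simp add: mono_def K_fun_mono)

lemma power_weight_tempered:
  obtains e A where "0 \<le> e" "A < \<infinity>" "tempered e A (\<lambda>u. ennreal (u powr (- \<theta>) * c u))"
proof -
  obtain C where C: "C < \<infinity>" "tempered 1 C (\<lambda>u. ennreal (c u))"
    using SV_slow[OF c_SV] unfolding slow_def by (metis zero_less_one)
  have "tempered (\<bar>- \<theta>\<bar> + 1) (1 * C) (\<lambda>u. ennreal (u powr (- \<theta>)) * ennreal (c u))"
    by (rule tempered_mult[OF tempered_powr C(2)])
  then show ?thesis
    using C(1) that[of "\<bar>- \<theta>\<bar> + 1" "1 * C"] by (simp add: ennreal_mult')
qed

lemma w_tempered: obtains e A where "0 \<le> e" "A < \<infinity>" "tempered e A (w \<theta>)"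
proof -
  obtain e A where A: "0 \<le> e" "A < \<infinity>" "tempered e A (\<lambda>u. ennreal (u powr (- \<theta>) * c u))"
    by (rule power_weight_tempered)
  obtain L where "sublinear_growth \<rho> L" by (rule rho_growth)
  from sublinear_growth.tempered_comp[OF this A(3,1)]
  have "tempered e (A * ennreal (L powr e)) (w \<theta>)" by (simp add: w_def[abs_def])
  then show ?thesis using A by (intro that[of e "A * ennreal (L powr e)"]) (auto simp: ennreal_mult_less_top)
qed

lemma interp_Y_change_of_variables:
  obtains D where "D < \<infinity>"
    "\<And>f. interp A0 Y \<theta> p c f \<le> D * haar_norm p (\<lambda>t. w \<theta> t * K_fun A0 Y (\<rho> t) f)"
    "\<And>f. haar_norm p (\<lambda>t. w \<theta> t * K_fun A0 Y (\<rho> t) f) \<le> D * interp A0 Y \<theta> p c f"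
proof -
  obtain e A where A: "0 \<le> e" "A < \<infinity>" "tempered e A (\<lambda>u. ennreal (u powr (- \<theta>) * c u))"
    by (rule power_weight_tempered)
  define F where "F f u = ennreal (u powr (- \<theta>) * c u) * K_fun A0 Y u f" for f u
  have F: "tempered (e + 1) (A * 1) (F f)" for f
    unfolding F_def[abs_def] by (rule tempered_mult[OF A(3) K_fun_tempered])
  obtain L where L: "sublinear_growth \<rho> L" by (rule rho_growth)
  have e: "0 \<le> e + 1" "A * 1 < \<infinity>" using A by auto
  obtain D where D: "D < \<infinity>"
    "\<And>F. tempered (e + 1) (A * 1) F \<Longrightarrow> haar_norm p F \<le> D * haar_norm p (\<lambda>t. F (\<rho> t))"
    "\<And>F. tempered (e + 1) (A * 1) F \<Longrightarrow> haar_norm p (\<lambda>t. F (\<rho> t)) \<le> D * haar_norm p F"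
    by (rule sublinear_growth.haar_norm_change_of_variables[OF L p_pos e rho_measurable]) (rule that; blast)
  have "interp A0 Y \<theta> p c f = haar_norm p (F f)" for f
    unfolding F_def[abs_def] by (rule interp_eq[OF p_pos c_pos])
  moreover have "haar_norm p (\<lambda>t. w \<theta> t * K_fun A0 Y (\<rho> t) f) = haar_norm p (\<lambda>t. F f (\<rho> t))" for f
    by (simp add: F_def w_def)
  ultimately show ?thesis using that[OF D(1)] D(2,3)[OF F] by simp
qed

lemma w_one_times_rho:
  assumes "0 < t"
  shows "w 1 t * (ennreal (\<rho> t) * x) = ennreal (c (\<rho> t)) * x"
proof -
  have "\<rho> t powr (- 1) * c (\<rho> t) * \<rho> t = c (\<rho> t)"
    using rho_pos[OF assms] by (simp add: powr_minus_divide)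
  then have "w 1 t * ennreal (\<rho> t) = ennreal (c (\<rho> t))"
    using rho_pos[OF assms] c_pos[OF rho_pos[OF assms]]
    by (simp add: w_def flip: ennreal_mult)
  then show ?thesis by (simp add: mult.assoc[symmetric])
qed

lemma interp_a_sharp_eq:
  "interp A0 A1 \<theta> p (a_sharp r b q a c \<theta>) f = haar_norm p (\<lambda>t. w \<theta> t * K f t)"
proof -
  have "interp A0 A1 \<theta> p (a_sharp r b q a c \<theta>) f =
      haar_norm p (\<lambda>t. ennreal (t powr (- \<theta>) * a_sharp r b q a c \<theta> t) * K f t)"
  proof (rule interp_eq[OF p_pos])
    fix t :: real assume "0 < t"
    then show "0 < a_sharp r b q a c \<theta> t"
      using enn2real_chi_pos[of t] c_pos[OF rho_pos, of t] by (simp add: a_sharp_def)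
  qed
  also have "\<dots> = haar_norm p (\<lambda>t. w \<theta> t * K f t)"
  proof (rule haar_norm_cong)
    fix t :: real assume t: "0 < t"
    have "t powr (- \<theta>) * enn2real (chi1 t) powr \<theta> = \<rho> t powr (- \<theta>)"
      using t enn2real_chi_pos[OF t] unfolding rho_def by (subst powr_divide) (auto simp: powr_minus field_simps)
    then have "t powr (- \<theta>) * a_sharp r b q a c \<theta> t = \<rho> t powr (- \<theta>) * c (\<rho> t)"
      unfolding a_sharp_def mult.assoc[symmetric] by simp
    then show "ennreal (t powr (- \<theta>) * a_sharp r b q a c \<theta> t) * K f t = w \<theta> t * K f t"
      by (simp add: w_def)
  qed
  finally show ?thesis .
qed

lemma head_b_eq: "Lq_norm r {0<..<t} (\<lambda>s. ennreal (s powr (- recip r) * b s)) = head_b t"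
  unfolding head_b_def ennreal_mult'[OF powr_ge_zero] by (rule haar_norm_restrict[OF r_pos]) auto

lemma interp_R_B_weight_eq:
  "interp_R A0 A1 1 p (B_weight r b q a c) q a f =
    haar_norm p (\<lambda>t. w 1 t * (ennreal (\<rho> t) * (head_b t * tail_norm (K f) t)))"
proof -
  obtain C where C: "C < \<infinity>" "\<And>t. 0 < t \<Longrightarrow> \<beta> t \<le> C * head_b t"
    using b_le_head_b by metis
  have pos: "0 < enn2real (head_b t)" if "0 < t" for t
    using C(2)[OF that] weights_nonzero(2)[OF that] head_b_finite[OF that]
    by (auto simp: enn2real_positive_iff intro: gr_zeroI)
  have "interp_R A0 A1 1 p (B_weight r b q a c) q a f =
      haar_norm p (\<lambda>t. ennreal (B_weight r b q a c t) * tail_norm (K f) t)"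
  proof (rule interp_R_eq[OF p_pos])
    fix t :: real assume "0 < t"
    then show "0 < B_weight r b q a c t"
      using pos[of t] c_pos[OF rho_pos, of t] by (simp add: B_weight_def head_b_eq)
  qed
  also have "\<dots> = haar_norm p (\<lambda>t. w 1 t * (ennreal (\<rho> t) * (head_b t * tail_norm (K f) t)))"
  proof (rule haar_norm_cong)
    fix t :: real assume t: "0 < t"
    have "ennreal (enn2real (head_b t)) = head_b t" using head_b_finite[OF t] by simp
    then show "ennreal (B_weight r b q a c t) * tail_norm (K f) t =
        w 1 t * (ennreal (\<rho> t) * (head_b t * tail_norm (K f) t))"
      unfolding w_one_times_rho[OF t] B_weight_def head_b_eq by (simp add: ennreal_mult' ac_simps)
  qed
  finally show ?thesis .
qed

lemma interp_RR_rho_eq: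
  "interp_RR A0 A1 1 p (c \<circ> \<rho>) r b q a f =
    haar_norm p (\<lambda>t. w 1 t * (ennreal (\<rho> t) * tail_iter (K f) t))"
proof -
  have "interp_RR A0 A1 1 p (c \<circ> \<rho>) r b q a f = haar_norm p (\<lambda>t. ennreal ((c \<circ> \<rho>) t) * tail_iter (K f) t)"
    by (rule interp_RR_eq[OF p_pos]) (simp add: c_pos rho_pos)
  also have "\<dots> = haar_norm p (\<lambda>t. w 1 t * (ennreal (\<rho> t) * tail_iter (K f) t))"
    by (rule haar_norm_cong) (simp only: w_one_times_rho comp_apply)
  finally show ?thesis .
qed

text \<open>
  The function \<open>w \<theta> * \<rho>\<close> is \<open>\<rho> powr (1 - \<theta>) * (c \<circ> \<rho>)\<close>. Half of the exponent absorbs the slow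
  variation of \<open>c\<close>; the other half and the lower growth bound of \<open>\<rho>\<close> leave a positive power of
  \<open>t / u\<close>. It is stated as a square because its two factors are spent separately: one makes the
  norms of the tails converge, the other enters the supremum of the Hardy inequality.
\<close>

lemma w_rho_growth:
  assumes "\<theta> < 1"
  obtains e C where "0 < e" "C < \<infinity>" "\<And>t u. 0 < t \<Longrightarrow> t \<le> u \<Longrightarrow>
    w \<theta> t * ennreal (\<rho> t) \<le> C * (ennreal ((t / u) powr e) * ennreal ((t / u) powr e)) * (w \<theta> u * ennreal (\<rho> u))"
proof -
  obtain L where L: "sublinear_growth \<rho> L" by (rule rho_growth)
  have L1: "1 \<le> L" by (rule sublinear_growth.L[OF L])
  \<comment> \<open>Potter bounds of \<open>c\<close> are used with exponent \<open>d\<close>, half of the available \<open>1 - \<theta>\<close>\<close>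
  define d where "d = (1 - \<theta>) / 2"
  have d: "0 < d" "2 * d = 1 - \<theta>" using assms by (auto simp: d_def)
  obtain C where C: "C < \<infinity>" "tempered d C (\<lambda>u. ennreal (c u))"
    using SV_slow[OF c_SV] d(1) unfolding slow_def by blast
  have w_rho: "w \<theta> t * ennreal (\<rho> t) = ennreal (\<rho> t powr (2 * d)) * ennreal (c (\<rho> t))" if "0 < t" for t
  proof -
    have "\<rho> t powr (2 * d) = \<rho> t powr (- \<theta>) * \<rho> t"
      unfolding d(2) using rho_pos[OF that] by (simp add: powr_diff powr_minus_divide)
    then have eq: "\<rho> t powr (- \<theta>) * c (\<rho> t) * \<rho> t = \<rho> t powr (2 * d) * c (\<rho> t)" by simp
    have "w \<theta> t * ennreal (\<rho> t) = ennreal (\<rho> t powr (- \<theta>) * c (\<rho> t) * \<rho> t)"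
      unfolding w_def using rho_pos[OF that] c_pos[OF rho_pos[OF that]] by (intro ennreal_mult[symmetric]) auto
    also have "\<dots> = ennreal (\<rho> t powr (2 * d)) * ennreal (c (\<rho> t))"
      unfolding eq by (rule ennreal_mult') simp
    finally show ?thesis .
  qed
  have main: "w \<theta> t * ennreal (\<rho> t) \<le> C * ennreal (L powr (3 * d)) *
      (ennreal ((t / u) powr (d / 4)) * ennreal ((t / u) powr (d / 4))) * (w \<theta> u * ennreal (\<rho> u))"
    if tu: "0 < t" "t \<le> u" for t u
  proof -
    define x where "x = \<rho> t"
    define y where "y = \<rho> u"
    have xy: "0 < x" "0 < y" using tu rho_pos by (auto simp: x_def y_def)
    have lo: "sqrt (u / t) * x \<le> L * y"
      unfolding x_def y_def by (rule sublinear_growth.lo[OF L tu])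
    have le: "x / y \<le> L * (t / u) powr (1 / 2)"
    proof -
      have "sqrt (u / t) * sqrt (t / u) = 1" using tu by (simp flip: real_sqrt_mult)
      then have "x = (sqrt (u / t) * x) * sqrt (t / u)" by (simp add: ac_simps)
      also have "\<dots> \<le> (L * y) * sqrt (t / u)" using lo tu by (intro mult_right_mono) auto
      finally show ?thesis using xy tu by (simp add: powr_half_sqrt field_simps)
    qed
    have "(t / u) powr (1 / 2) \<le> 1" using tu by (intro powr_le1) auto
    then have "x / y \<le> L" using le mult_left_mono[of "(t / u) powr (1 / 2)" 1 L] L1 by linarith
    have two_d: "z powr (2 * d) = z powr d * z powr d" for z :: real
      by (simp flip: powr_add)
    have dil: "x powr (2 * d) * dil x y powr d \<le> L powr (2 * d) * ((x / y) powr d * y powr (2 * d))"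
    proof (cases "x \<le> y")
      case True
      have "x powr (2 * d) * dil x y powr d = x powr d * (x powr d * (y / x) powr d)"
        using True xy by (simp add: dil_le two_d)
      also have "\<dots> = x powr d * y powr d" using xy by (simp flip: powr_mult)
      also have "\<dots> = (x / y) powr d * (y powr d * y powr d)" using xy by (simp add: powr_divide)
      also have "\<dots> = 1 * ((x / y) powr d * y powr (2 * d))" by (simp add: two_d)
      also have "\<dots> \<le> L powr (2 * d) * ((x / y) powr d * y powr (2 * d))"
        using L1 d by (intro mult_right_mono) (auto simp: ge_one_powr_ge_zero)
      finally show ?thesis .
    next
      case False
      have "x powr (2 * d) * dil x y powr d = (x / y) powr (2 * d) * y powr (2 * d) * (x / y) powr d"
        using False xy by (simp add: dil_commute[of x y] dil_le powr_divide)
      also have "\<dots> \<le> L powr (2 * d) * y powr (2 * d) * (x / y) powr d"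
        using \<open>x / y \<le> L\<close> xy d by (intro mult_right_mono powr_mono2) auto
      finally show ?thesis by (simp add: ac_simps)
    qed
    have "(x / y) powr d \<le> (L * (t / u) powr (1 / 2)) powr d"
      using le xy d by (intro powr_mono2) auto
    also have "\<dots> = L powr d * ((t / u) powr (1 / 2)) powr d"
      using L1 by (intro powr_mult)
    also have "((t / u) powr (1 / 2)) powr d = (t / u) powr (d / 4) * (t / u) powr (d / 4)"
      by (simp add: powr_powr flip: powr_add)
    finally have "L powr (2 * d) * ((x / y) powr d * y powr (2 * d)) \<le>
        L powr (2 * d) * ((L powr d * ((t / u) powr (d / 4) * (t / u) powr (d / 4))) * y powr (2 * d))"
      by (intro mult_left_mono mult_right_mono) auto
    also have "\<dots> = L powr (3 * d) * ((t / u) powr (d / 4) * (t / u) powr (d / 4)) * y powr (2 * d)"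
    proof -
      have "L powr (3 * d) = L powr (2 * d) * L powr d" by (simp flip: powr_add)
      then show ?thesis by (simp only: ac_simps)
    qed
    finally have real: "x powr (2 * d) * dil x y powr d \<le>
        L powr (3 * d) * ((t / u) powr (d / 4) * (t / u) powr (d / 4)) * y powr (2 * d)"
      using dil by linarith
    have "w \<theta> t * ennreal (\<rho> t) \<le> ennreal (x powr (2 * d)) * (C * ennreal (dil x y powr d) * ennreal (c y))"
      unfolding w_rho[OF tu(1)] unfolding x_def[symmetric] using temperedD[OF C(2) xy] by (rule mult_left_mono) simp
    also have "\<dots> = C * ennreal (x powr (2 * d) * dil x y powr d) * ennreal (c y)"
      by (simp add: ennreal_mult' ac_simps)
    also have "\<dots> \<le> C * ennreal (L powr (3 * d) * ((t / u) powr (d / 4) * (t / u) powr (d / 4)) * y powr (2 * d)) * ennreal (c y)"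
      using real by (intro mult_left_mono mult_right_mono ennreal_leI) auto
    also have "\<dots> = C * ennreal (L powr (3 * d)) * (ennreal ((t / u) powr (d / 4)) * ennreal ((t / u) powr (d / 4))) * (w \<theta> u * ennreal (\<rho> u))"
      using w_rho[of u] tu by (simp add: y_def ennreal_mult' ac_simps)
    finally show ?thesis .
  qed
  have fin: "C * ennreal (L powr (3 * d)) < \<infinity>" using C(1) by (simp add: ennreal_mult_less_top)
  have "0 < d / 4" using d by simp
  then show ?thesis by (rule that[OF _ fin]) (rule main)
qed

text \<open>
  For \<open>u > t\<close> monotonicity of \<open>head_b\<close>, the bound of \<open>head_b * a\<close> by \<open>\<chi>\<close> and \<open>\<chi>(u) / u = 1 / \<rho>(u)\<close>
  turn the integrand \<open>head_b t * a u * K(u) / u\<close> into a multiple of \<open>K(u) / \<rho>(u)\<close>. The second summand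
  of \<open>tail_part\<close> is reduced to the first one by \<open>b s \<le> C * head_b s\<close>.
\<close>

lemma tail_part_le_SUP:
  assumes "\<theta> < 1"
  obtains e C where "0 < e" "C < \<infinity>" "\<And>f t. 0 < t \<Longrightarrow>
    w \<theta> t * (ennreal (\<rho> t) * tail_part (K f) t) \<le> C * (SUP u\<in>{t..}. ennreal ((t / u) powr e) * (w \<theta> u * K f u))"
proof -
  obtain e C1 where e: "0 < e" and C1: "C1 < \<infinity>" "\<And>t u. 0 < t \<Longrightarrow> t \<le> u \<Longrightarrow>
      w \<theta> t * ennreal (\<rho> t) \<le> C1 * (ennreal ((t / u) powr e) * ennreal ((t / u) powr e)) * (w \<theta> u * ennreal (\<rho> u))"
    by (rule w_rho_growth[OF assms]) (rule that; blast)
  obtain C2 where C2: "C2 < \<infinity>" "\<And>t. 0 < t \<Longrightarrow> head_b t * \<alpha> t \<le> C2 * chi1 t"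
    using head_b_a_le_chi by metis
  obtain C3 where C3: "C3 < \<infinity>"
    "\<And>t. 0 < t \<Longrightarrow> haar_norm q (\<lambda>u. indicator {t<..} u * ennreal ((t / u) powr e)) \<le> C3"
    using haar_norm_tail[OF q_pos e] by metis
  obtain C4 where C4: "C4 < \<infinity>"
    "\<And>t. 0 < t \<Longrightarrow> haar_norm r (\<lambda>u. indicator {t<..} u * ennreal ((t / u) powr e)) \<le> C4"
    using haar_norm_tail[OF r_pos e] by metis
  obtain C5 where C5: "C5 < \<infinity>" "\<And>t. 0 < t \<Longrightarrow> \<beta> t \<le> C5 * head_b t"
    using b_le_head_b by metis
  define g where "g t = w \<theta> t * ennreal (\<rho> t)" for t
  define D1 where "D1 = C1 * C2 * C3"
  define D2 where "D2 = C1 * C5 * D1 * C4"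
  have main: "w \<theta> t * (ennreal (\<rho> t) * tail_part (K f) t) \<le>
      (D1 + D2) * (SUP u\<in>{t..}. ennreal ((t / u) powr e) * (w \<theta> u * K f u))" if t: "0 < t" for f t
  proof -
    define S where "S t = (SUP u\<in>{t..}. ennreal ((t / u) powr e) * (w \<theta> u * K f u))" for t
    have S: "ennreal ((t / u) powr e) * (w \<theta> u * K f u) \<le> S t" if "t \<le> u" for t u
      unfolding S_def using that by (intro SUP_upper) auto
    \<comment> \<open>the supremum over a smaller half-line is smaller by a power, which the outer tail norm can use\<close>
    have S_scale: "ennreal ((t / s) powr e) * S s \<le> S t" if ts: "0 < t" "t \<le> s" for t s
      unfolding S_def SUP_mult_left_ennreal
    proof (rule SUP_least)
      fix u assume "u \<in> {s..}"
      then have u: "s \<le> u" by simp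
      have "(t / s) powr e * (s / u) powr e = (t / u) powr e"
        using ts u by (simp flip: powr_mult)
      then have eq: "ennreal ((t / s) powr e) * ennreal ((s / u) powr e) = ennreal ((t / u) powr e)"
        by (simp flip: ennreal_mult)
      have "ennreal ((t / s) powr e) * (ennreal ((s / u) powr e) * (w \<theta> u * K f u)) = ennreal ((t / u) powr e) * (w \<theta> u * K f u)"
        unfolding eq[symmetric] by (simp only: mult.assoc)
      also have "\<dots> \<le> (SUP u\<in>{t..}. ennreal ((t / u) powr e) * (w \<theta> u * K f u))"
        using ts u by (intro SUP_upper) auto
      finally show "ennreal ((t / s) powr e) * (ennreal ((s / u) powr e) * (w \<theta> u * K f u)) \<le>
          (SUP u\<in>{t..}. ennreal ((t / u) powr e) * (w \<theta> u * K f u))" .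
    qed
    have norm: "g t * (head_b t * tail_norm (K f) t) \<le> D1 * S t" if t: "0 < t" for t
    proof -
      let ?e = "\<lambda>u. ennreal ((t / u) powr e)"
      have "g t * (head_b t * tail_norm (K f) t) =
          haar_norm q (\<lambda>u. (g t * head_b t) * (indicator {t<..} u * (ennreal (1 / u) * \<alpha> u * K f u)))"
        unfolding tail_norm_def mult.assoc[symmetric, of "g t"]
        by (intro haar_norm_cmult[symmetric] q_pos meas_ind meas_weighted K_fun_meas) auto
      also have "\<dots> \<le> haar_norm q (\<lambda>u. (C1 * C2 * S t) * (indicator {t<..} u * ?e u))"
      proof (rule haar_norm_mono[OF q_pos])
        fix u :: real assume u: "0 < u"
        show "(g t * head_b t) * (indicator {t<..} u * (ennreal (1 / u) * \<alpha> u * K f u)) \<le>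
            (C1 * C2 * S t) * (indicator {t<..} u * ?e u)"
        proof (cases "t < u")
          case True
          have "(g t * head_b t) * (ennreal (1 / u) * \<alpha> u * K f u) \<le>
              (C1 * (?e u * ?e u) * g u * head_b u) * (ennreal (1 / u) * \<alpha> u * K f u)"
            using C1(2)[OF t, of u] head_b_mono[of t u] True
            by (intro mult_right_mono mult_mono) (auto simp: g_def)
          also have "\<dots> = C1 * (?e u * ?e u) * (g u * (ennreal (1 / u) * (head_b u * \<alpha> u))) * K f u"
            by (simp only: ac_simps)
          also have "\<dots> \<le> C1 * (?e u * ?e u) * (g u * (ennreal (1 / u) * (C2 * chi1 u))) * K f u"
            using C2(2)[OF u] by (intro mult_right_mono mult_left_mono) auto
          also have "\<dots> = C1 * C2 * (?e u * ?e u) * (ennreal (\<rho> u) * (ennreal (1 / u) * chi1 u)) * (w \<theta> u * K f u)"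
            by (simp only: g_def ac_simps)
          also have "\<dots> = C1 * C2 * (?e u * (w \<theta> u * K f u)) * ?e u"
            unfolding rho_chi_over_t[OF u] mult_1_right by (simp only: ac_simps)
          also have "\<dots> \<le> C1 * C2 * S t * ?e u"
            using S[of t u] True by (intro mult_right_mono mult_left_mono) auto
          finally show ?thesis using True by (simp add: mult.assoc)
        qed simp
      qed
      also have "\<dots> = (C1 * C2 * S t) * haar_norm q (\<lambda>u. indicator {t<..} u * ?e u)"
        by (intro haar_norm_cmult q_pos meas_ind pos_meas_borel) auto
      also have "\<dots> \<le> (C1 * C2 * S t) * C3"
        using C3(2)[OF t] by (rule mult_left_mono) simp
      finally show ?thesis by (simp add: D1_def ac_simps)
    qed
    have iter: "g t * tail_iter (K f) t \<le> D2 * S t"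
    proof -
      let ?e = "\<lambda>u. ennreal ((t / u) powr e)"
      have "g t * tail_iter (K f) t = haar_norm r (\<lambda>s. g t * (indicator {t<..} s * (\<beta> s * tail_norm (K f) s)))"
        unfolding tail_iter_def
        by (intro haar_norm_cmult[symmetric] r_pos meas_ind borel_measurable_times_ennreal meas_b meas_tail_norm) auto
      also have "\<dots> \<le> haar_norm r (\<lambda>s. (C1 * C5 * D1 * S t) * (indicator {t<..} s * ?e s))"
      proof (rule haar_norm_mono[OF r_pos])
        fix s :: real assume s: "0 < s"
        show "g t * (indicator {t<..} s * (\<beta> s * tail_norm (K f) s)) \<le> (C1 * C5 * D1 * S t) * (indicator {t<..} s * ?e s)"
        proof (cases "t < s")
          case True
          have "g t * (\<beta> s * tail_norm (K f) s) \<le> (C1 * (?e s * ?e s) * g s) * ((C5 * head_b s) * tail_norm (K f) s)"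
            using C1(2)[OF t, of s] C5(2)[OF s] True by (intro mult_right_mono mult_mono) (auto simp: g_def)
          also have "\<dots> = C1 * C5 * (?e s * ?e s) * (g s * (head_b s * tail_norm (K f) s))"
            by (simp only: ac_simps)
          also have "\<dots> \<le> C1 * C5 * (?e s * ?e s) * (D1 * S s)"
            using norm[OF s] by (rule mult_left_mono) simp
          also have "\<dots> = C1 * C5 * D1 * (?e s * S s) * ?e s" by (simp only: ac_simps)
          also have "\<dots> \<le> C1 * C5 * D1 * S t * ?e s"
            using S_scale[OF t, of s] True by (intro mult_right_mono mult_left_mono) auto
          finally show ?thesis using True by simp
        qed simp
      qed
      also have "\<dots> = (C1 * C5 * D1 * S t) * haar_norm r (\<lambda>s. indicator {t<..} s * ?e s)"
        by (intro haar_norm_cmult r_pos meas_ind pos_meas_borel) auto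
      also have "\<dots> \<le> (C1 * C5 * D1 * S t) * C4"
        using C4(2)[OF t] by (rule mult_left_mono) simp
      finally show ?thesis by (simp add: D2_def ac_simps)
    qed
    have "w \<theta> t * (ennreal (\<rho> t) * tail_part (K f) t) = g t * (head_b t * tail_norm (K f) t) + g t * tail_iter (K f) t"
      by (simp add: g_def tail_part_def distrib_left mult.assoc)
    also have "\<dots> \<le> (D1 + D2) * S t" using norm[OF t] iter by (rule cmult_le_add)
    finally show ?thesis by (simp add: S_def)
  qed
  have fin: "D1 + D2 < \<infinity>" using C1(1) C2(1) C3(1) C4(1) C5(1) by (auto simp: D1_def D2_def ennreal_mult_less_top)
  show ?thesis by (rule that[OF e fin]) (rule main)
qed

lemma tail_part_hardy:
  assumes "\<theta> < 1"
  obtains D where "D < \<infinity>"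
    "\<And>f. haar_norm p (\<lambda>t. w \<theta> t * (ennreal (\<rho> t) * tail_part (K f) t)) \<le> D * haar_norm p (\<lambda>t. w \<theta> t * K f t)"
proof -
  obtain e C where e: "0 < e" and C: "C < \<infinity>" "\<And>f t. 0 < t \<Longrightarrow>
      w \<theta> t * (ennreal (\<rho> t) * tail_part (K f) t) \<le> C * (SUP u\<in>{t..}. ennreal ((t / u) powr e) * (w \<theta> u * K f u))"
    by (rule tail_part_le_SUP[OF assms]) (rule that; blast)
  obtain e' A where A: "0 \<le> e'" "A < \<infinity>" "tempered e' A (w \<theta>)" by (rule w_tempered)
  obtain D1 where D1: "D1 < \<infinity>"
    "\<And>C g h h'. pos_meas h \<Longrightarrow> pos_meas h' \<Longrightarrow> (\<And>t. 0 < t \<Longrightarrow> g t \<le> C * (h t + h' t)) \<Longrightarrow>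
      haar_norm p (\<lambda>t. w \<theta> t * g t) \<le> C * D1 * (haar_norm p (\<lambda>t. w \<theta> t * h t) + haar_norm p (\<lambda>t. w \<theta> t * h' t))"
    by (rule haar_norm_weighted_add[OF p_pos A]) (rule that; blast)
  have e1: "0 \<le> e' + 1" "A * 1 < \<infinity>" using A by auto
  obtain D2 where D2: "D2 < \<infinity>" "\<And>h. tempered (e' + 1) (A * 1) h \<Longrightarrow>
      haar_norm p (\<lambda>t. SUP u\<in>{t..}. ennreal ((t / u) powr e) * h u) \<le> D2 * haar_norm p h"
    by (rule haar_norm_hardy[OF p_pos e1 e]) (rule that; blast)
  have main: "haar_norm p (\<lambda>t. w \<theta> t * (ennreal (\<rho> t) * tail_part (K f) t)) \<le>
      D2 * (C * D1 * 2) * haar_norm p (\<lambda>t. w \<theta> t * K f t)" for f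
  proof -
    let ?h = "\<lambda>u. w \<theta> u * (C * K f u)"
    have "tempered 1 1 (\<lambda>u. C * K f u)"
      unfolding tempered_def
    proof (intro allI impI)
      fix s t :: real assume "0 < s" "0 < t"
      from mult_left_mono[OF temperedD[OF K_fun_tempered this], of C]
      show "C * K f s \<le> 1 * ennreal (dil s t powr 1) * (C * K f t)" by (simp add: ac_simps)
    qed
    then have temp: "tempered (e' + 1) (A * 1) ?h" by (rule tempered_mult[OF A(3)])
    have "haar_norm p (\<lambda>t. w \<theta> t * (ennreal (\<rho> t) * tail_part (K f) t)) \<le>
        haar_norm p (\<lambda>t. SUP u\<in>{t..}. ennreal ((t / u) powr e) * ?h u)"
    proof (rule haar_norm_mono[OF p_pos])
      fix t :: real assume "0 < t"
      from C(2)[OF this, of f] show "w \<theta> t * (ennreal (\<rho> t) * tail_part (K f) t) \<le>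
          (SUP u\<in>{t..}. ennreal ((t / u) powr e) * ?h u)"
        by (simp only: SUP_mult_left_ennreal mult.left_commute[of C])
    qed
    also have "\<dots> \<le> D2 * haar_norm p ?h" by (rule D2(2)[OF temp])
    also have "\<dots> \<le> D2 * (C * D1 * (haar_norm p (\<lambda>t. w \<theta> t * K f t) + haar_norm p (\<lambda>t. w \<theta> t * K f t)))"
      by (intro mult_left_mono D1(2) K_fun_meas) (auto intro!: mult_left_mono)
    finally show ?thesis by (simp add: mult_2[symmetric] mult.assoc)
  qed
  have fin: "D2 * (C * D1 * 2) < \<infinity>" using D2(1) C(1) D1(1) by (auto simp: ennreal_mult_less_top)
  show ?thesis by (rule that[OF fin]) (rule main)
qed

text \<open>
  Substitution and Holmstedt formula combined. The function \<open>g\<close> in the lower bound will be a single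
  summand of the Holmstedt expression.
\<close>

lemma norm_bounds:
  obtains D where "D < \<infinity>"
    "\<And>f. interp A0 Y \<theta> p c f \<le> D * (haar_norm p (\<lambda>t. w \<theta> t * K f t) +
      haar_norm p (\<lambda>t. w \<theta> t * (ennreal (\<rho> t) * tail_part (K f) t)))"
    "\<And>f g. (\<And>t. 0 < t \<Longrightarrow> g t \<le> K f t + ennreal (\<rho> t) * tail_part (K f) t) \<Longrightarrow>
      haar_norm p (\<lambda>t. w \<theta> t * g t) \<le> D * interp A0 Y \<theta> p c f"
proof -
  obtain e' A where A: "0 \<le> e'" "A < \<infinity>" "tempered e' A (w \<theta>)" by (rule w_tempered)
  obtain D1 where D1: "D1 < \<infinity>"
    "\<And>C g h h'. pos_meas h \<Longrightarrow> pos_meas h' \<Longrightarrow> (\<And>t. 0 < t \<Longrightarrow> g t \<le> C * (h t + h' t)) \<Longrightarrow>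
      haar_norm p (\<lambda>t. w \<theta> t * g t) \<le> C * D1 * (haar_norm p (\<lambda>t. w \<theta> t * h t) + haar_norm p (\<lambda>t. w \<theta> t * h' t))"
    by (rule haar_norm_weighted_add[OF p_pos A]) (rule that; blast)
  obtain D2 where D2: "D2 < \<infinity>"
    "\<And>f. interp A0 Y \<theta> p c f \<le> D2 * haar_norm p (\<lambda>t. w \<theta> t * K_fun A0 Y (\<rho> t) f)"
    "\<And>f. haar_norm p (\<lambda>t. w \<theta> t * K_fun A0 Y (\<rho> t) f) \<le> D2 * interp A0 Y \<theta> p c f"
    by (rule interp_Y_change_of_variables) (rule that; blast)
  obtain C1 where C1: "C1 < \<infinity>" "\<And>A1 f t. 0 < t \<Longrightarrow>
    K_fun A0 (interp_R A0 A1 1 r b q a) (\<rho> t) f \<le>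
      C1 * (K_fun A0 A1 t f + ennreal (\<rho> t) * tail_part (\<lambda>u. K_fun A0 A1 u f) t)"
    by (rule holmstedt_upper[OF A0]) (rule that; blast)
  obtain C2 where C2: "C2 < \<infinity>" "\<And>A1 f t. 0 < t \<Longrightarrow>
      K_fun A0 A1 t f + ennreal (\<rho> t) * tail_part (\<lambda>u. K_fun A0 A1 u f) t \<le>
      C2 * K_fun A0 (interp_R A0 A1 1 r b q a) (\<rho> t) f"
    by (rule holmstedt_lower[OF A0]) (rule that; blast)
  have m: "pos_meas (\<lambda>t. ennreal (\<rho> t) * tail_part (K f) t)" for f
    unfolding tail_part_def
    by (intro borel_measurable_times_ennreal borel_measurable_add meas_rho meas_head_b meas_tail_norm meas_tail_iter)
  have upper: "interp A0 Y \<theta> p c f \<le> D2 * (C1 * D1) * (haar_norm p (\<lambda>t. w \<theta> t * K f t) +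
      haar_norm p (\<lambda>t. w \<theta> t * (ennreal (\<rho> t) * tail_part (K f) t)))" for f
    using D2(2) D1(2)[OF K_fun_meas m C1(2)] by (rule le_cmult_trans)
  have lower: "haar_norm p (\<lambda>t. w \<theta> t * g t) \<le> (C2 * D1 * 2) * D2 * interp A0 Y \<theta> p c f"
    if g: "\<And>t. 0 < t \<Longrightarrow> g t \<le> K f t + ennreal (\<rho> t) * tail_part (K f) t" for f g
  proof -
    have "g t \<le> C2 * (K_fun A0 Y (\<rho> t) f + K_fun A0 Y (\<rho> t) f)" if t: "0 < t" for t
    proof -
      have "g t \<le> C2 * (K_fun A0 Y (\<rho> t) f)" using g[OF t] C2(2)[OF t, of A1 f] by (rule order.trans)
      also have "\<dots> \<le> C2 * (K_fun A0 Y (\<rho> t) f + K_fun A0 Y (\<rho> t) f)" by (intro mult_left_mono) auto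
      finally show ?thesis .
    qed
    from D1(2)[OF meas_K_Y_rho meas_K_Y_rho this]
    have "haar_norm p (\<lambda>t. w \<theta> t * g t) \<le> (C2 * D1 * 2) * haar_norm p (\<lambda>t. w \<theta> t * K_fun A0 Y (\<rho> t) f)"
      by (simp add: mult_2[symmetric] mult.assoc)
    then show ?thesis using D2(3) by (rule le_cmult_trans)
  qed
  define D where "D = D2 * (C1 * D1) + (C2 * D1 * 2) * D2"
  have fin: "D < \<infinity>" using D1(1) D2(1) C1(1) C2(1) by (auto simp: D_def ennreal_mult_less_top)
  have le: "D2 * (C1 * D1) * x \<le> D * x" "(C2 * D1 * 2) * D2 * x \<le> D * x" for x
    unfolding D_def by (intro mult_right_mono; simp)+
  show ?thesis
  proof (rule that[OF fin])
    show "interp A0 Y \<theta> p c f \<le> D * (haar_norm p (\<lambda>t. w \<theta> t * K f t) +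
      haar_norm p (\<lambda>t. w \<theta> t * (ennreal (\<rho> t) * tail_part (K f) t)))" for f
      using upper le(1) by (rule order.trans)
    show "haar_norm p (\<lambda>t. w \<theta> t * g t) \<le> D * interp A0 Y \<theta> p c f"
      if "\<And>t. 0 < t \<Longrightarrow> g t \<le> K f t + ennreal (\<rho> t) * tail_part (K f) t" for f g
      using lower[OF that] le(2) by (rule order.trans)
  qed
qed

text \<open>By the Hardy inequality the first summand of the Holmstedt expression dominates.\<close>

theorem interpolation_below_one:
  assumes "\<theta> < 1"
  shows "same_space (interp A0 Y \<theta> p c) (interp A0 A1 \<theta> p (a_sharp r b q a c \<theta>))"
proof -
  obtain D where D: "D < \<infinity>"
    "\<And>f. interp A0 Y \<theta> p c f \<le> D * (haar_norm p (\<lambda>t. w \<theta> t * K f t) +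
      haar_norm p (\<lambda>t. w \<theta> t * (ennreal (\<rho> t) * tail_part (K f) t)))"
    "\<And>f g. (\<And>t. 0 < t \<Longrightarrow> g t \<le> K f t + ennreal (\<rho> t) * tail_part (K f) t) \<Longrightarrow>
      haar_norm p (\<lambda>t. w \<theta> t * g t) \<le> D * interp A0 Y \<theta> p c f"
    by (rule norm_bounds) (rule that; blast)
  obtain H where H: "H < \<infinity>"
    "\<And>f. haar_norm p (\<lambda>t. w \<theta> t * (ennreal (\<rho> t) * tail_part (K f) t)) \<le> H * haar_norm p (\<lambda>t. w \<theta> t * K f t)"
    by (rule tail_part_hardy[OF assms]) (rule that; blast)
  show ?thesis
    unfolding same_space_def
  proof (intro conjI cont_embeddedI)
    show "interp A0 A1 \<theta> p (a_sharp r b q a c \<theta>) f \<le> D * interp A0 Y \<theta> p c f" for f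
      unfolding interp_a_sharp_eq by (rule D(3)) simp
    show "interp A0 Y \<theta> p c f \<le> D * (1 + H) * interp A0 A1 \<theta> p (a_sharp r b q a c \<theta>) f" for f
    proof -
      let ?N = "haar_norm p (\<lambda>t. w \<theta> t * K f t)"
      have "?N + haar_norm p (\<lambda>t. w \<theta> t * (ennreal (\<rho> t) * tail_part (K f) t)) \<le> (1 + H) * ?N"
        using H(2)[of f] by (intro cmult_le_add) auto
      then show ?thesis unfolding interp_a_sharp_eq by (rule le_cmult_trans[OF D(2)])
    qed
    show "D < \<infinity>" by (rule D(1))
    show "D * (1 + H) < \<infinity>" using D(1) H(1) by (auto simp: ennreal_mult_less_top)
  qed
qed

text \<open>
  For \<open>\<theta> = 1\<close> the factor \<open>\<rho>\<close> of the tails cancels against the weight, and each of the three summands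
  is the integrand of one of the three spaces.
\<close>

theorem interpolation_at_one:
  "same_space (interp A0 Y 1 p c)
    (inter_space (interp A0 A1 1 p (a_sharp r b q a c 1))
      (inter_space (interp_R A0 A1 1 p (B_weight r b q a c) q a)
        (interp_RR A0 A1 1 p (c \<circ> \<rho>) r b q a)))"
  (is "same_space ?X (inter_space ?N1 (inter_space ?N2 ?N3))")
proof -
  obtain D where D: "D < \<infinity>"
    "\<And>f. interp A0 Y 1 p c f \<le> D * (haar_norm p (\<lambda>t. w 1 t * K f t) +
      haar_norm p (\<lambda>t. w 1 t * (ennreal (\<rho> t) * tail_part (K f) t)))"
    "\<And>f g. (\<And>t. 0 < t \<Longrightarrow> g t \<le> K f t + ennreal (\<rho> t) * tail_part (K f) t) \<Longrightarrow>
      haar_norm p (\<lambda>t. w 1 t * g t) \<le> D * interp A0 Y 1 p c f"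
    by (rule norm_bounds) (rule that; blast)
  obtain e' A where A: "0 \<le> e'" "A < \<infinity>" "tempered e' A (w 1)" by (rule w_tempered)
  obtain E where E: "E < \<infinity>"
    "\<And>C g h h'. pos_meas h \<Longrightarrow> pos_meas h' \<Longrightarrow> (\<And>t. 0 < t \<Longrightarrow> g t \<le> C * (h t + h' t)) \<Longrightarrow>
      haar_norm p (\<lambda>t. w 1 t * g t) \<le> C * E * (haar_norm p (\<lambda>t. w 1 t * h t) + haar_norm p (\<lambda>t. w 1 t * h' t))"
    by (rule haar_norm_weighted_add[OF p_pos A]) (rule that; blast)
  have parts: "ennreal (\<rho> t) * tail_part (K f) t =
      ennreal (\<rho> t) * (head_b t * tail_norm (K f) t) + ennreal (\<rho> t) * tail_iter (K f) t" for f t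
    by (simp add: tail_part_def distrib_left)
  have N1: "?N1 f \<le> D * ?X f" for f
    unfolding interp_a_sharp_eq by (rule D(3)) simp
  have N2: "?N2 f \<le> D * ?X f" for f
    unfolding interp_R_B_weight_eq by (rule D(3)) (simp add: parts add_increasing add_increasing2)
  have N3: "?N3 f \<le> D * ?X f" for f
    unfolding interp_RR_rho_eq by (rule D(3)) (simp add: parts add_increasing add_increasing2)
  have X: "?X f \<le> D * (1 + E * 2) * inter_space ?N1 (inter_space ?N2 ?N3) f" for f
  proof -
    let ?M = "inter_space ?N1 (inter_space ?N2 ?N3) f"
    have "haar_norm p (\<lambda>t. w 1 t * (ennreal (\<rho> t) * tail_part (K f) t)) \<le> 1 * E * (?N2 f + ?N3 f)"
      unfolding interp_R_B_weight_eq interp_RR_rho_eq parts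
      by (rule E(2)) (auto intro!: borel_measurable_times_ennreal meas_rho meas_head_b meas_tail_norm meas_tail_iter)
    also have "\<dots> \<le> E * 2 * ?M"
      unfolding mult.assoc mult_1_left mult_2
      by (intro mult_left_mono add_mono) (auto simp: inter_space_def le_max_iff_disj)
    finally have "haar_norm p (\<lambda>t. w 1 t * (ennreal (\<rho> t) * tail_part (K f) t)) \<le> E * 2 * ?M" .
    moreover have "haar_norm p (\<lambda>t. w 1 t * K f t) \<le> 1 * ?M"
      unfolding interp_a_sharp_eq[symmetric] by (simp add: inter_space_def)
    ultimately show ?thesis
      by (intro le_cmult_trans[OF D(2)] cmult_le_add)
  qed
  show ?thesis
    unfolding same_space_def
  proof (intro conjI cont_embeddedI)
    show "D < \<infinity>" by (rule D(1))
    show "inter_space ?N1 (inter_space ?N2 ?N3) f \<le> D * ?X f" for f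
      using N1 N2 N3 by (simp add: inter_space_def)
    show "D * (1 + E * 2) < \<infinity>" using D(1) E(1) by (auto simp: ennreal_mult_less_top)
  qed (rule X)
qed

end

theorem theorem40:
  fixes A0 A1 :: "'v::hausdorff_tvs \<Rightarrow> ennreal"
    and q1 r1 r :: ennreal
    and a1 b1 a :: "real \<Rightarrow> real"
  assumes couple: "compatible_couple A0 A1"
    and inter: "carrier_of A0 \<inter> carrier_of A1 \<noteq> {0}"
    and exponents: "0 < q1" "0 < r1" "0 < r"
    and sv: "a1 \<in> SV" "b1 \<in> SV" "a \<in> SV"
    and chi_finite:
      "Lq_norm r1 {0<..<1} (\<lambda>s. ennreal (s powr (- recip r1) * b1 s) *
         Lq_norm q1 {s<..<1} (\<lambda>u. ennreal (u powr (- recip q1) * a1 u))) < \<infinity>"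
    and nontrivial_Y: "nontrivial (interp_R A0 A1 1 r1 b1 q1 a1)"
  shows
    "let Y = interp_R A0 A1 1 r1 b1 q1 a1;
         a_rho = a \<circ> rho r1 b1 q1 a1;
         a_hash = a_sharp r1 b1 q1 a1 a;
         B1 = B_weight r1 b1 q1 a1 a
     in
      (\<forall>\<theta>. 0 < \<theta> \<and> \<theta> < 1 \<longrightarrow>
         nontrivial (interp A0 Y \<theta> r a) \<longrightarrow>
         nontrivial (interp A0 A1 \<theta> r (a_hash \<theta>)) \<longrightarrow>
         same_space (interp A0 Y \<theta> r a) (interp A0 A1 \<theta> r (a_hash \<theta>)))
      \<and>
      (Lq_norm r {1<..} (\<lambda>s. ennreal (s powr (- recip r) * a s)) < \<infinity> \<longrightarrow>
         nontrivial (interp A0 Y 0 r a) \<longrightarrow>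
         nontrivial (interp A0 A1 0 r a_rho) \<longrightarrow>
         same_space (interp A0 Y 0 r a) (interp A0 A1 0 r a_rho))
      \<and>
      (Lq_norm r {0<..<1} (\<lambda>s. ennreal (s powr (- recip r) * a s)) < \<infinity> \<longrightarrow>
         nontrivial (interp A0 Y 1 r a) \<longrightarrow>
         nontrivial (inter_space (interp A0 A1 1 r (a_hash 1))
            (inter_space (interp_R A0 A1 1 r B1 q1 a1)
                         (interp_RR A0 A1 1 r a_rho r1 b1 q1 a1))) \<longrightarrow>
         same_space (interp A0 Y 1 r a)
           (inter_space (interp A0 A1 1 r (a_hash 1))
             (inter_space (interp_R A0 A1 1 r B1 q1 a1)
                          (interp_RR A0 A1 1 r a_rho r1 b1 q1 a1))))"
proof -
  have "quasi_norm A0"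
    using couple by (simp add: compatible_couple_def quasi_banach_def)
  then interpret interpolation q1 r1 a1 b1 A0 A1 r a
    using exponents sv chi_finite by unfold_locales (simp_all add: chi_def)
  \<comment> \<open>for \<open>\<theta> = 0\<close> the power of \<open>\<chi>1\<close> in the sharp weight is 1\<close>
  have "interp A0 A1 0 r (a_sharp r1 b1 q1 a1 a 0) = interp A0 A1 0 r (a \<circ> rho r1 b1 q1 a1)"
  proof
    fix f
    have eq: "interp A0 A1 0 r (a \<circ> \<rho>) f = haar_norm r (\<lambda>t. ennreal (t powr (- 0) * (a \<circ> \<rho>) t) * K f t)"
      by (rule interp_eq[OF exponents(3)]) (simp add: c_pos rho_pos)
    show "interp A0 A1 0 r (a_sharp r1 b1 q1 a1 a 0) f = interp A0 A1 0 r (a \<circ> rho r1 b1 q1 a1) f"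
      unfolding interp_a_sharp_eq eq
    proof (rule haar_norm_cong)
      fix t :: real assume "0 < t"
      then show "w 0 t * K f t = ennreal (t powr (- 0) * (a \<circ> \<rho>) t) * K f t"
        using rho_pos[of t] by (simp add: w_def)
    qed
  qed
  then show ?thesis
    unfolding Let_def using interpolation_below_one[of 0] interpolation_below_one interpolation_at_one by simp
qed

end
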